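(* Let $(\psi^X,\psi^Y)$ be a semi-regular potential pair on open intervals $I_x,I_y$, with corresponding maps $\hat X,\hat Y$ and $\hat\Phi=\hat X^{-1}\hat Y: I_x\times I_y\to\mathcal G$, and write $$\psi^X_1=\begin{pmatrix}0&\alpha\\ \beta&0\end{pmatrix},\qquad \psi^Y_{-1}=\begin{pmatrix}0&\gamma\\ \delta&0\end{pmatrix},$$ where $\alpha,\beta$ are functions of $x$ and $\gamma,\delta$ are functions of $y$. Suppose that $\hat\Phi$ takes values in $\mathcal B_L$. Let $\hat\Phi=\hat H_-\hat H_+$ be the pointwise left normalized Birkhoff decomposition, $\hat F=\hat Y\hat H_+^{-1}$ and $f=\frac1{2H}\mathcal S_1(\hat F)$. Then a generic singularity of $f$ is a cuspidal edge. That is: if $(x_0,y_0)$ is a point such that either $\beta(x_0)=0$, $\frac{\mathrm d\beta}{\mathrm dx}(x_0)\neq0$, $\gamma(y_0)\ne0$ and $\alpha(x_0)\neq0$, or (the analogue with the roles of $x$ and $y$ interchanged) $\gamma(y_0)=0$, $\frac{\mathrm d\gamma}{\mathrm dy}(y_0)\neq0$, $\beta(x_0)\neq0$ and $\delta(y_0)\ne0$, then $f$ is locally diffeomorphic at $(x_0,y_0)$ to a cuspidal edge.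
   Context: $H\neq0$ is a fixed real constant. Loop groups. $\mathcal G$ is the group of loops $\gamma$ in $\mathrm{SL}(2,\mathbb C)$, with loop parameter $\lambda$, satisfying $\gamma(\lambda)=P\gamma(-\lambda)P^{-1}$, $P=\mathrm{diag}(1,-1)$, and $\overline{\gamma(\bar\lambda)}=\gamma(\lambda)$. Loops are taken in a class for which the Birkhoff decomposition below holds and which can be evaluated at every $\lambda\in\mathbb R\setminus\{0\}$, e.g. loops extending holomorphically to $\mathbb C\setminus\{0\}$. $\mathcal G^{+}$ (resp. $\mathcal G^{-}$) is the subgroup of loops in $\mathcal G$ extending holomorphically to the unit disc (resp. to the exterior of the closed unit disc in the Riemann sphere, including $\infty$); $\mathcal G^-_*=\{\gamma\in\mathcal G^-:\gamma(\infty)=I\}$. The left big cell is $\mathcal B_L=\mathcal G^-\cdot\mathcal G^+$; it is open and dense in $\mathcal G$ and multiplication $\mathcal G^-_*\times\mathcal G^+\to\mathcal B_L$ is a real analytic diffeomorphism (left normalized Birkhoff decomposition). Potential pair: a pair of smooth $\mathrm{Lie}(\mathcal G)$-valued 1-forms $\psi^X=\sum_{i\le1}\psi^X_i\lambda^i\,\mathrm dx$ on $I_x$ and $\psi^Y=\sum_{i\ge-1}\psi^Y_i\lambda^i\,\mathrm dy$ on $I_y$. It is semi-regular if at every $(x,y)\in I_x\times I_y$ at most one of $[\psi^X_1]_{21}(x)$, $[\psi^Y_{-1}]_{12}(y)$ vanishes, and any zero is of first order. The corresponding maps $\hat X:I_x\to\mathcal G$, $\hat Y:I_y\to\mathcal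 G$ solve $\hat X^{-1}\mathrm d\hat X=\psi^X$, $\hat Y^{-1}\mathrm d\hat Y=\psi^Y$ with value $I$ at chosen base points. Geometry. $\mathbb L^3=\mathfrak{sl}(2,\mathbb R)$ with $e_0=\begin{pmatrix}0&-1\\1&0\end{pmatrix}$, $e_1=\begin{pmatrix}0&1\\1&0\end{pmatrix}$, $e_2=\begin{pmatrix}-1&0\\0&1\end{pmatrix}$ and $\langle X,Y\rangle_L=\frac12\mathrm{trace}(XY)$; $\mathrm{Ad}_XZ=XZX^{-1}$. Sym map: $\mathcal S_\lambda(\hat G)=\big(2\lambda\,\partial_\lambda\hat G\,\hat G^{-1}-\mathrm{Ad}_{\hat G}(e_2)\big)\big|_\lambda$. Under the stated hypotheses the singular (non-immersed) points of $f$ are exactly the points where $\beta$ or $\gamma$ vanishes. A singular point with $\beta=0$ is called generic if in addition $\alpha\neq0$ there (analogously $\delta\ne0$ if $\gamma=0$). Locally diffeomorphic to a cuspidal edge: the map germ is equivalent, via local diffeomorphisms of source and target, to $(p,q)\mapsto(p^2,p^3,q)$ at the origin. *)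

theory Defs
  imports "HOL-Analysis.Analysis"
begin

section \<open>Smooth maps and equivalence of map germs\<close>

fun Ck_on :: "nat \<Rightarrow> 'a::real_normed_vector set \<Rightarrow> ('a \<Rightarrow> 'b::real_normed_vector) \<Rightarrow> bool" where
  "Ck_on 0 S f \<longleftrightarrow> continuous_on S f"
| "Ck_on (Suc k) S f \<longleftrightarrow>
     (\<forall>x\<in>S. f differentiable (at x)) \<and> (\<forall>v. Ck_on k S (\<lambda>x. frechet_derivative f (at x) v))"

text \<open>Only meant for open sets \<^term>\<open>S\<close> in finite-dimensional spaces, where the directional
  derivatives capture the usual notion of a \<open>C\<^sup>k\<close> map.\<close>

definition smooth_on :: "'a::real_normed_vector set \<Rightarrow> ('a \<Rightarrow> 'b::real_normed_vector) \<Rightarrow> bool" where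
  "smooth_on S f \<longleftrightarrow> (\<forall>k. Ck_on k S f)"

definition smooth_diffeo ::
  "'a::real_normed_vector set \<Rightarrow> 'b::real_normed_vector set \<Rightarrow> ('a \<Rightarrow> 'b) \<Rightarrow> bool" where
  "smooth_diffeo U V \<phi> \<longleftrightarrow> open U \<and> open V \<and> bij_betw \<phi> U V \<and>
     smooth_on U \<phi> \<and> smooth_on V (inv_into U \<phi>)"

definition germs_equivalent ::
  "('a::real_normed_vector \<Rightarrow> 'b::real_normed_vector) \<Rightarrow> 'a \<Rightarrow>
   ('c::real_normed_vector \<Rightarrow> 'd::real_normed_vector) \<Rightarrow> 'c \<Rightarrow> bool" where
  "germs_equivalent f a g b \<longleftrightarrow>
     (\<exists>U V \<phi> W Z \<Psi>. smooth_diffeo U V \<phi> \<and> a \<in> U \<and> \<phi> a = b \<and>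
        smooth_diffeo W Z \<Psi> \<and> f ` U \<subseteq> W \<and> \<Psi> (f a) = g b \<and>
        (\<forall>p\<in>U. \<Psi> (f p) = g (\<phi> p)))"

definition cuspidal_edge_model :: "real \<times> real \<Rightarrow> real \<times> real \<times> real" where
  "cuspidal_edge_model = (\<lambda>(p, q). (p\<^sup>2, p ^ 3, q))"

definition cuspidal_edge_at :: "(real \<times> real \<Rightarrow> real \<times> real \<times> real) \<Rightarrow> real \<times> real \<Rightarrow> bool" where
  "cuspidal_edge_at f p \<longleftrightarrow> germs_equivalent f p cuspidal_edge_model (0, 0)"


section \<open>Loop groups\<close>

type_synonym mat2 = "complex^2^2"

text \<open>A loop is a matrix function on the punctured plane; its value at the parameter \<open>0\<close> is
  irrelevant and never used, so equality of loops always means equality at all nonzero parameters.\<close>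

type_synonym loop = "complex \<Rightarrow> mat2"

definition mat22 :: "'a::zero \<Rightarrow> 'a \<Rightarrow> 'a \<Rightarrow> 'a \<Rightarrow> 'a^2^2" where
  "mat22 a b c d = vector [vector [a, b], vector [c, d]]"

definition mat_holomorphic_on :: "loop \<Rightarrow> complex set \<Rightarrow> bool" where
  "mat_holomorphic_on A S \<longleftrightarrow> (\<forall>i j. (\<lambda>z. A z $ i $ j) holomorphic_on S)"

definition P_twist :: mat2 where
  "P_twist = mat22 1 0 0 (- 1)"

definition twisted :: "loop \<Rightarrow> bool" where
  "twisted \<gamma> \<longleftrightarrow> (\<forall>z. z \<noteq> 0 \<longrightarrow> \<gamma> z = P_twist ** \<gamma> (- z) ** matrix_inv P_twist)"

definition real_loop :: "loop \<Rightarrow> bool" where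
  "real_loop \<gamma> \<longleftrightarrow> (\<forall>z. z \<noteq> 0 \<longrightarrow> (\<chi> i j. cnj (\<gamma> (cnj z) $ i $ j)) = \<gamma> z)"

definition loop_group :: "loop set" where
  "loop_group = {\<gamma>. mat_holomorphic_on \<gamma> (- {0}) \<and> (\<forall>z. z \<noteq> 0 \<longrightarrow> det (\<gamma> z) = 1) \<and>
     twisted \<gamma> \<and> real_loop \<gamma>}"

definition loop_algebra :: "loop set" where
  "loop_algebra = {\<xi>. mat_holomorphic_on \<xi> (- {0}) \<and> (\<forall>z. z \<noteq> 0 \<longrightarrow> trace (\<xi> z) = 0) \<and>
     twisted \<xi> \<and> real_loop \<xi>}"

definition loop_mult :: "loop \<Rightarrow> loop \<Rightarrow> loop" where
  "loop_mult \<gamma> \<eta> = (\<lambda>z. \<gamma> z ** \<eta> z)"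

definition loop_inv :: "loop \<Rightarrow> loop" where
  "loop_inv \<gamma> = (\<lambda>z. matrix_inv (\<gamma> z))"

definition loop_group_plus :: "loop set" where
  "loop_group_plus = {\<gamma> \<in> loop_group.
     \<exists>g. mat_holomorphic_on g (ball 0 1) \<and> (\<forall>z \<in> ball 0 1 - {0}. g z = \<gamma> z)}"

text \<open>The exterior of the closed unit disc in the Riemann sphere is parametrised by the unit disc
  via \<open>w \<mapsto> 1 / w\<close>.\<close>

definition loop_group_minus :: "loop set" where
  "loop_group_minus = {\<gamma> \<in> loop_group.
     \<exists>g. mat_holomorphic_on g (ball 0 1) \<and> (\<forall>w \<in> ball 0 1 - {0}. g w = \<gamma> (inverse w))}"

definition loop_group_minus_star :: "loop set" where
  "loop_group_minus_star = {\<gamma> \<in> loop_group_minus. (\<gamma> \<longlongrightarrow> mat 1) at_infinity}"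

definition left_big_cell :: "loop set" where
  "left_big_cell = {\<gamma> \<in> loop_group. \<exists>\<gamma>m \<in> loop_group_minus. \<exists>\<gamma>p \<in> loop_group_plus.
     \<forall>z. z \<noteq> 0 \<longrightarrow> \<gamma> z = loop_mult \<gamma>m \<gamma>p z}"

definition left_normalized_birkhoff :: "loop \<Rightarrow> loop \<Rightarrow> loop \<Rightarrow> bool" where
  "left_normalized_birkhoff \<gamma> \<gamma>m \<gamma>p \<longleftrightarrow>
     \<gamma>m \<in> loop_group_minus_star \<and> \<gamma>p \<in> loop_group_plus \<and>
     (\<forall>z. z \<noteq> 0 \<longrightarrow> \<gamma> z = loop_mult \<gamma>m \<gamma>p z)"


section \<open>Potential pairs\<close>

text \<open>Smoothness of a curve into the Frechet space of holomorphic loops, expressed as joint smoothness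
  of its evaluation map on the product of the parameter interval and the punctured plane.\<close>

definition smooth_loop_curve :: "real set \<Rightarrow> (real \<Rightarrow> loop) \<Rightarrow> bool" where
  "smooth_loop_curve I A \<longleftrightarrow> smooth_on (I \<times> (- {0})) (\<lambda>(t, z). A t z)"

text \<open>The function \<^term>\<open>\<psi>\<close> stands for the one-form \<open>\<psi> dt\<close>, where \<open>\<psi> = (\<Sum>i\<in>J. c\<^sub>i \<lambda>\<^sup>i)\<close>.\<close>

definition loop_potential ::
  "int set \<Rightarrow> real set \<Rightarrow> (real \<Rightarrow> loop) \<Rightarrow> (int \<Rightarrow> real \<Rightarrow> mat2) \<Rightarrow> bool" where
  "loop_potential J I \<psi> c \<longleftrightarrow>
     smooth_loop_curve I \<psi> \<and>
     (\<forall>t\<in>I. \<psi> t \<in> loop_algebra \<and>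
        (\<forall>z. z \<noteq> 0 \<longrightarrow>
          (\<forall>j k. ((\<lambda>i. c i t $ j $ k * z powi i) has_sum \<psi> t z $ j $ k) J)))"

definition potential_pair ::
  "real set \<Rightarrow> real set \<Rightarrow> (real \<Rightarrow> loop) \<Rightarrow> (int \<Rightarrow> real \<Rightarrow> mat2) \<Rightarrow>
   (real \<Rightarrow> loop) \<Rightarrow> (int \<Rightarrow> real \<Rightarrow> mat2) \<Rightarrow> bool" where
  "potential_pair Ix Iy \<psi>X cX \<psi>Y cY \<longleftrightarrow>
     loop_potential {..1} Ix \<psi>X cX \<and> loop_potential {- 1..} Iy \<psi>Y cY"

definition semi_regular ::
  "real set \<Rightarrow> real set \<Rightarrow> (int \<Rightarrow> real \<Rightarrow> mat2) \<Rightarrow> (int \<Rightarrow> real \<Rightarrow> mat2) \<Rightarrow> bool" where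
  "semi_regular Ix Iy cX cY \<longleftrightarrow>
     (\<forall>x\<in>Ix. \<forall>y\<in>Iy. \<not> (cX 1 x $ 2 $ 1 = 0 \<and> cY (- 1) y $ 1 $ 2 = 0)) \<and>
     (\<forall>x\<in>Ix. cX 1 x $ 2 $ 1 = 0 \<longrightarrow> vector_derivative (\<lambda>t. cX 1 t $ 2 $ 1) (at x) \<noteq> 0) \<and>
     (\<forall>y\<in>Iy. cY (- 1) y $ 1 $ 2 = 0 \<longrightarrow> vector_derivative (\<lambda>t. cY (- 1) t $ 1 $ 2) (at y) \<noteq> 0)"

definition integrates_potential :: "real set \<Rightarrow> real \<Rightarrow> (real \<Rightarrow> loop) \<Rightarrow> (real \<Rightarrow> loop) \<Rightarrow> bool" where
  "integrates_potential I b \<psi> X \<longleftrightarrow>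
     smooth_loop_curve I X \<and> (\<forall>t\<in>I. X t \<in> loop_group) \<and>
     (\<forall>t\<in>I. \<forall>z. z \<noteq> 0 \<longrightarrow>
        matrix_inv (X t z) ** vector_derivative (\<lambda>s. X s z) (at t) = \<psi> t z) \<and>
     b \<in> I \<and> (\<forall>z. z \<noteq> 0 \<longrightarrow> X b z = mat 1)"


section \<open>Minkowski space and the Sym map\<close>

text \<open>Minkowski space is \<open>sl(2,\<real>)\<close>, regarded inside the complex matrices.\<close>

definition L3 :: "mat2 set" where
  "L3 = {A. trace A = 0 \<and> (\<forall>i j. A $ i $ j \<in> \<real>)}"

definition e0 :: mat2 where "e0 = mat22 0 (- 1) 1 0"
definition e1 :: mat2 where "e1 = mat22 0 1 1 0"
definition e2 :: mat2 where "e2 = mat22 (- 1) 0 0 1"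

definition lorentz_inner :: "mat2 \<Rightarrow> mat2 \<Rightarrow> complex" where
  "lorentz_inner A B = trace (A ** B) / 2"

text \<open>Coordinates with respect to the orthonormal basis \<open>e0, e1, e2\<close> of signature \<open>(-,+,+)\<close>. On
  \<^term>\<open>L3\<close> the inner products are real and the coordinates determine the matrix, see below.\<close>

definition L3_coords :: "mat2 \<Rightarrow> real \<times> real \<times> real" where
  "L3_coords A =
     (- Re (lorentz_inner A e0), Re (lorentz_inner A e1), Re (lorentz_inner A e2))"

definition L3_point :: "real \<times> real \<times> real \<Rightarrow> mat2" where
  "L3_point = (\<lambda>(a, b, c). a *\<^sub>R e0 + b *\<^sub>R e1 + c *\<^sub>R e2)"

lemma L3_coords_point: "L3_coords (L3_point v) = v"
  by (cases v)
    (simp add: L3_coords_def L3_point_def lorentz_inner_def trace_def sum_2 matrix_matrix_mult_def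
      mat22_def e0_def e1_def e2_def)

lemma L3_point_coords:
  assumes "A \<in> L3"
  shows "L3_point (L3_coords A) = A"
proof -
  from assms have "Re (A $ 1 $ 1) = - Re (A $ 2 $ 2)" "\<And>i j. Im (A $ i $ j) = 0"
    by (auto simp: L3_def trace_def sum_2 complex_eq_iff complex_is_Real_iff)
  then show ?thesis
    by (simp add: L3_coords_def L3_point_def lorentz_inner_def trace_def sum_2
      matrix_matrix_mult_def mat22_def e0_def e1_def e2_def vec_eq_iff forall_2 complex_eq_iff
      field_simps)
qed

definition Ad_mat :: "mat2 \<Rightarrow> mat2 \<Rightarrow> mat2" where
  "Ad_mat A Z = A ** Z ** matrix_inv A"

definition loop_deriv :: "loop \<Rightarrow> loop" where
  "loop_deriv G = (\<lambda>z. \<chi> i j. deriv (\<lambda>w. G w $ i $ j) z)"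

text \<open>\<^term>\<open>mat (2 * z)\<close> is a scalar matrix.\<close>

definition sym_map :: "complex \<Rightarrow> loop \<Rightarrow> mat2" where
  "sym_map z G = mat (2 * z) ** loop_deriv G z ** matrix_inv (G z) - Ad_mat (G z) e2"

end

theory Submission
  imports Defs "HOL-Complex_Analysis.Cauchy_Integral_Formula"
begin

text \<open>Let \<open>G\<close> be the inverse of the plus factor, so that \<open>F = Y G = X H\<^sub>-\<close>. The two expressions confine
  \<open>F\<inverse> F\<^sub>x\<close> to \<open>U\<^sub>0 + \<lambda> \<psi>X\<^sub>1\<close> with \<open>U\<^sub>0\<close> diagonal, and \<open>F\<inverse> F\<^sub>y\<close> to \<open>\<lambda>\<inverse> G(0)\<inverse> \<psi>Y\<^sub>-\<^sub>1 G(0)\<close>. The Sym formula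
  then gives \<open>f\<^sub>x = (2 \<beta> / H) Ad\<^sub>F E\<^sub>2\<^sub>1\<close>, while \<open>f\<^sub>y\<close> is a multiple of \<open>Ad\<^sub>F E\<^sub>1\<^sub>2\<close> that vanishes
  exactly with \<open>\<gamma>\<close>. At a generic zero of \<open>\<beta>\<close> the vectors \<open>f\<^sub>y\<close>, \<open>f\<^sub>x\<^sub>x\<close>, \<open>f\<^sub>x\<^sub>x\<^sub>x\<close> are linearly independent, and \<open>f\<^sub>x\<close>
  vanishes along \<open>x = x\<^sub>0\<close>. Splitting the second-order Taylor quotient of \<open>f\<close> at \<open>x = x\<^sub>0 = 0\<close> into its even and odd parts in \<open>x\<close>
  and applying Whitney's theorem on even functions yields \<open>f(x, y) = N(x\<^sup>2, x\<^sup>3, y)\<close> with \<open>N\<close> a local diffeomorphism.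

  Smoothness of the Birkhoff factors in \<open>(x, y)\<close> comes from Cauchy's formula: for parameters \<open>p\<close> and
  \<open>q\<close>, the functions \<open>H\<^sub>-(p)\<inverse> H\<^sub>-(q)\<close> and \<open>G(p)\<inverse> G(q)\<close> are the outer and inner parts of an explicit function on a circle.
  Their orthogonality in \<open>L\<^sup>2\<close> gives continuity, and the integral formula for the inner part then gives
  all derivatives by induction.\<close>

subsection \<open>Calculus of \<open>C\<^sup>k\<close> maps\<close>

text \<open>Three points shape the proof. The Birkhoff factors are given point by point, without
  regularity in the parameters, so their smoothness must be extracted from holomorphy in the loop
  parameter. The map \<open>N\<close> must be smooth on a full neighbourhood of the origin although
  p^2 is never negative; Seeley's reflection, with coefficients s_n satisfying sum s_n (-2^n)^m = 1
  for every m, continues functions of sqrt s to s < 0 with all derivatives matching. The Sym formula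
  kills one nilpotent direction because differentiating \<lambda> (or 1/\<lambda>) at 1 contributes,
  up to sign, twice the off-diagonal part of the connection; this cancels one entry of the
  commutator with \<open>e2\<close> and doubles the other. As to independence, at the singular point
  f_xx is a multiple of Ad_F E_21, while f_xxx involves Ad_F [U, E_21], whose diagonal part carries
  the factor \<alpha>: here genericity enters. The case of \<gamma> follows by exchanging the
  variables.\<close>

lemma Ck_on_cong:
  assumes "open S" "\<And>x. x \<in> S \<Longrightarrow> f x = g x"
  shows "Ck_on k S f \<longleftrightarrow> Ck_on k S g"
proof -
  have "Ck_on k S f" if "Ck_on k S g" "\<And>x. x \<in> S \<Longrightarrow> f x = g x" for f g
    using that
  proof (induction k arbitrary: f g)
    case 0
    then show ?case by (simp cong: continuous_on_cong)
  next
    case (Suc k)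
    have d: "(f has_derivative D) (at x) \<longleftrightarrow> (g has_derivative D) (at x)" if "x \<in> S" for x D
      using Suc.prems(2) assms(1) that
      by (metis has_derivative_transform_within_open)
    then have "\<And>x v. x \<in> S \<Longrightarrow> frechet_derivative f (at x) v = frechet_derivative g (at x) v"
      by (simp add: frechet_derivative_def)
    moreover have "\<And>x. x \<in> S \<Longrightarrow> f differentiable (at x)"
      using Suc.prems(1) d by (auto simp: differentiable_def)
    ultimately show ?case
      using Suc.IH[of "\<lambda>x. frechet_derivative g (at x) v" "\<lambda>x. frechet_derivative f (at x) v" for v]
        Suc.prems(1) by simp
  qed
  with assms(2) show ?thesis
    by metis
qed

lemma Ck_on_transform:
  "Ck_on k S g \<Longrightarrow> open S \<Longrightarrow> (\<And>x. x \<in> S \<Longrightarrow> f x = g x) \<Longrightarrow> Ck_on k S f"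
  using Ck_on_cong[of S f g k] by simp

lemma Ck_on_SucD: "Ck_on (Suc k) S f \<Longrightarrow> Ck_on k S f"
proof (induction k arbitrary: f)
  case 0
  then show ?case
    using differentiable_imp_continuous_on[of f S]
    by (auto simp: differentiable_on_def differentiable_at_withinI)
next
  case (Suc k)
  then show ?case by auto
qed

lemma Ck_on_le: "Ck_on k S f \<Longrightarrow> j \<le> k \<Longrightarrow> Ck_on j S f"
proof (induction k)
  case (Suc k)
  then show ?case
    by (cases "j = Suc k") (metis, metis Ck_on_SucD le_SucE)
qed simp

lemma Ck_on_imp_continuous_on: "Ck_on k S f \<Longrightarrow> continuous_on S f"
  using Ck_on_le[of k S f 0] by simp

lemma Ck_on_subset: "Ck_on k S f \<Longrightarrow> T \<subseteq> S \<Longrightarrow> Ck_on k T f"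
  by (induction k arbitrary: f) (auto intro: continuous_on_subset)

lemma Ck_on_SucI:
  assumes "open S" "\<And>x. x \<in> S \<Longrightarrow> (f has_derivative f' x) (at x)"
    and "\<And>v. Ck_on k S (\<lambda>x. f' x v)"
  shows "Ck_on (Suc k) S f"
proof -
  have "frechet_derivative f (at x) v = f' x v" if "x \<in> S" for x v
    using assms(2)[OF that] frechet_derivative_at by metis
  then have "Ck_on k S (\<lambda>x. frechet_derivative f (at x) v)" for v
    by (rule Ck_on_transform[OF assms(3)[of v] assms(1)])
  moreover have "f differentiable (at x)" if "x \<in> S" for x
    using assms(2)[OF that] by (rule differentiableI)
  ultimately show ?thesis
    by simp
qed

lemma Ck_on_Suc_has_derivative:
  "Ck_on (Suc k) S f \<Longrightarrow> x \<in> S \<Longrightarrow> (f has_derivative frechet_derivative f (at x)) (at x)"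
  by (simp add: frechet_derivative_works)

lemma Ck_on_Suc_frechet_derivative:
  "Ck_on (Suc k) S f \<Longrightarrow> Ck_on k S (\<lambda>x. frechet_derivative f (at x) v)"
  by simp

text \<open>Cauchy's formula represents a loop only inside a chosen circle, so the regularity of
  \<open>G\<close> is obtained on discs and patched together here.\<close>

lemma Ck_on_local:
  assumes "\<And>x. x \<in> S \<Longrightarrow> \<exists>T. open T \<and> x \<in> T \<and> Ck_on k T f"
  shows "Ck_on k S f"
  using assms
proof (induction k arbitrary: f)
  case 0
  then show ?case
    by (metis Ck_on.simps(1) continuous_at_imp_continuous_on continuous_on_eq_continuous_at)
next
  case (Suc k)
  have "Ck_on k S (\<lambda>x. frechet_derivative f (at x) v)" for v
  proof (rule Suc.IH)
    show "\<exists>T. open T \<and> x \<in> T \<and> Ck_on k T (\<lambda>x. frechet_derivative f (at x) v)" if "x \<in> S" for x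
      using Suc.prems[OF that] by auto
  qed
  moreover have "f differentiable at x" if "x \<in> S" for x
    using Suc.prems[OF that] by auto
  ultimately show ?case
    by simp
qed

lemma Ck_on_const [simp]: "Ck_on k S (\<lambda>x. c)"
proof (induction k arbitrary: c)
  case (Suc k)
  then show ?case by simp
qed simp

lemma Ck_on_bounded_linear:
  assumes "bounded_linear L" "open S" "Ck_on k S f"
  shows "Ck_on k S (\<lambda>x. L (f x))"
  using assms(3)
proof (induction k arbitrary: f)
  case 0
  then show ?case
    using bounded_linear.continuous_on[OF assms(1)] by simp
next
  case (Suc k)
  show ?case
    by (rule Ck_on_SucI[OF assms(2) bounded_linear.has_derivative[OF assms(1)] Suc.IH])
      (fact Ck_on_Suc_has_derivative[OF Suc.prems] Ck_on_Suc_frechet_derivative[OF Suc.prems])+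
qed

lemma Ck_on_id: "open S \<Longrightarrow> Ck_on k S (\<lambda>x. x)"
  by (cases k) (auto intro!: Ck_on_SucI[OF _ has_derivative_ident] simp del: Ck_on.simps(2))

lemma Ck_on_linear:
  assumes "bounded_linear L" "open S"
  shows "Ck_on k S L"
  using Ck_on_bounded_linear[OF assms Ck_on_id[OF assms(2)]] by simp

lemma Ck_on_add:
  assumes "open S" "Ck_on k S f" "Ck_on k S g"
  shows "Ck_on k S (\<lambda>x. f x + g x)"
  using assms(2,3)
proof (induction k arbitrary: f g)
  case 0
  then show ?case by (simp add: continuous_on_add)
next
  case (Suc k)
  note Ck_on_Suc_has_derivative[OF Suc.prems(1)] Ck_on_Suc_frechet_derivative[OF Suc.prems(1)]
    Ck_on_Suc_has_derivative[OF Suc.prems(2)] Ck_on_Suc_frechet_derivative[OF Suc.prems(2)]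
  then show ?case
    by (intro Ck_on_SucI[OF assms(1) has_derivative_add] Suc.IH)
qed

lemma (in bounded_bilinear) Ck_on:
  assumes "open S" "Ck_on k S f" "Ck_on k S g"
  shows "Ck_on k S (\<lambda>x. prod (f x) (g x))"
  using assms(2,3)
proof (induction k arbitrary: f g)
  case 0
  then show ?case by (simp add: continuous_on)
next
  case (Suc k)
  note Ck_on_Suc_has_derivative[OF Suc.prems(1)] Ck_on_Suc_frechet_derivative[OF Suc.prems(1)]
    Ck_on_Suc_has_derivative[OF Suc.prems(2)] Ck_on_Suc_frechet_derivative[OF Suc.prems(2)]
    Ck_on_SucD[OF Suc.prems(1)] Ck_on_SucD[OF Suc.prems(2)]
  then show ?case
    by (intro Ck_on_SucI[OF assms(1) FDERIV] Ck_on_add[OF assms(1)] Suc.IH)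
qed

lemmas Ck_on_mult = bounded_bilinear.Ck_on[OF bounded_bilinear_mult]
lemmas Ck_on_scaleR = bounded_bilinear.Ck_on[OF bounded_bilinear_scaleR]

lemma Ck_on_uminus: "open S \<Longrightarrow> Ck_on k S f \<Longrightarrow> Ck_on k S (\<lambda>x. - f x)"
  by (rule Ck_on_bounded_linear[OF bounded_linear_minus[OF bounded_linear_ident]])

lemma Ck_on_diff:
  "open S \<Longrightarrow> Ck_on k S f \<Longrightarrow> Ck_on k S g \<Longrightarrow> Ck_on k S (\<lambda>x. f x - g x)"
  using Ck_on_add[of S k f "\<lambda>x. - g x"] Ck_on_uminus[of S k g] by simp

lemma Ck_on_sum:
  "open S \<Longrightarrow> (\<And>i. i \<in> I \<Longrightarrow> Ck_on k S (f i)) \<Longrightarrow> Ck_on k S (\<lambda>x. \<Sum>i\<in>I. f i x)"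
  by (induction I rule: infinite_finite_induct) (auto intro: Ck_on_add)

lemma Ck_on_power:
  fixes f :: "'a::real_normed_vector \<Rightarrow> 'b::real_normed_algebra_1"
  shows "open S \<Longrightarrow> Ck_on k S f \<Longrightarrow> Ck_on k S (\<lambda>x. f x ^ n)"
  by (induction n) (auto intro: Ck_on_mult)

lemma Ck_on_Pair:
  assumes "open S" "Ck_on k S f" "Ck_on k S g"
  shows "Ck_on k S (\<lambda>x. (f x, g x))"
  using assms(2,3)
proof (induction k arbitrary: f g)
  case 0
  then show ?case by (simp add: continuous_on_Pair)
next
  case (Suc k)
  note Ck_on_Suc_has_derivative[OF Suc.prems(1)] Ck_on_Suc_frechet_derivative[OF Suc.prems(1)]
    Ck_on_Suc_has_derivative[OF Suc.prems(2)] Ck_on_Suc_frechet_derivative[OF Suc.prems(2)]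
  then show ?case
    by (intro Ck_on_SucI[OF assms(1) has_derivative_Pair] Suc.IH)
qed

lemmas Ck_on_fst = Ck_on_bounded_linear[OF bounded_linear_fst]
lemmas Ck_on_snd = Ck_on_bounded_linear[OF bounded_linear_snd]

text \<open>The chain rule applies the derivative of g to a direction that varies with x, whereas
  \<open>Ck_on\<close> speaks of fixed directions. Expanding the moving direction in a basis reduces
  it to fixed ones; hence the Euclidean codomain of f.\<close>

lemma Ck_on_compose:
  fixes f :: "'a::real_normed_vector \<Rightarrow> 'b::euclidean_space"
  assumes "open S" "open T" "Ck_on k T g" "Ck_on k S f" "f ` S \<subseteq> T"
  shows "Ck_on k S (\<lambda>x. g (f x))"
  using assms(3,4)
proof (induction k arbitrary: g)
  case 0
  then show ?case
    using assms(5) continuous_on_compose2[of T g S f] by simp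
next
  case (Suc k)
  let ?D = "\<lambda>y. frechet_derivative g (at y)" and ?d = "\<lambda>x. frechet_derivative f (at x)"
  have dg: "(g has_derivative ?D y) (at y)" if "y \<in> T" for y
    using Ck_on_Suc_has_derivative[OF Suc.prems(1) that] .
  have df: "(f has_derivative ?d x) (at x)" if "x \<in> S" for x
    using Ck_on_Suc_has_derivative[OF Suc.prems(2) that] .
  have *: "?D (f x) (?d x v) = (\<Sum>b\<in>Basis. (?d x v \<bullet> b) *\<^sub>R ?D (f x) b)" if "x \<in> S" for x v
  proof -
    have "linear (?D (f x))"
      using dg[of "f x"] assms(5) that has_derivative_linear by blast
    then have "?D (f x) (\<Sum>b\<in>Basis. (?d x v \<bullet> b) *\<^sub>R b) = (\<Sum>b\<in>Basis. (?d x v \<bullet> b) *\<^sub>R ?D (f x) b)"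
      by (simp add: linear_sum linear_scale)
    then show ?thesis
      by (simp add: euclidean_representation)
  qed
  have "Ck_on k S (\<lambda>x. \<Sum>b\<in>Basis. (?d x v \<bullet> b) *\<^sub>R ?D (f x) b)" for v
  proof (intro Ck_on_sum Ck_on_scaleR assms(1))
    fix b :: 'b
    show "Ck_on k S (\<lambda>x. ?d x v \<bullet> b)"
      using Ck_on_bounded_linear[OF bounded_linear_inner_left assms(1)]
        Ck_on_Suc_frechet_derivative[OF Suc.prems(2)] by blast
    show "Ck_on k S (\<lambda>x. ?D (f x) b)"
      using Suc.IH[OF Ck_on_Suc_frechet_derivative[OF Suc.prems(1)] Ck_on_SucD[OF Suc.prems(2)]] .
  qed
  then have 1: "Ck_on k S (\<lambda>x. ?D (f x) (?d x v))" for v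
    by (rule Ck_on_transform[OF _ assms(1)]) (rule *)
  show ?case
  proof (rule Ck_on_SucI[OF assms(1) _ 1])
    show "((\<lambda>x. g (f x)) has_derivative (\<lambda>v. ?D (f x) (?d x v))) (at x)" if "x \<in> S" for x
      using diff_chain_at[OF df[OF that] dg] assms(5) that by (auto simp: o_def)
  qed
qed

lemma Ck_on_of_derivs:
  fixes f :: "'a::euclidean_space \<Rightarrow> 'b::real_normed_vector"
  assumes "open S" "\<And>x. x \<in> S \<Longrightarrow> (f has_derivative f' x) (at x)"
    and "\<And>b. b \<in> Basis \<Longrightarrow> Ck_on k S (\<lambda>x. f' x b)"
  shows "Ck_on (Suc k) S f"
proof (rule Ck_on_SucI[OF assms(1,2)])
  show "Ck_on k S (\<lambda>x. f' x v)" for v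
  proof -
    have "f' x v = (\<Sum>b\<in>Basis. (v \<bullet> b) *\<^sub>R f' x b)" if "x \<in> S" for x
    proof -
      have "f' x (\<Sum>b\<in>Basis. (v \<bullet> b) *\<^sub>R b) = (\<Sum>b\<in>Basis. (v \<bullet> b) *\<^sub>R f' x b)"
        using has_derivative_linear[OF assms(2)[OF that]] by (simp add: linear_sum linear_scale)
      then show ?thesis
        by (simp add: euclidean_representation)
    qed
    moreover have "Ck_on k S (\<lambda>x. \<Sum>b\<in>Basis. (v \<bullet> b) *\<^sub>R f' x b)"
      by (intro Ck_on_sum Ck_on_scaleR assms(1,3)) auto
    ultimately show ?thesis
      by (rule Ck_on_transform[OF _ assms(1), rotated])
  qed
qed

lemma Ck_on_real_deriv:
  fixes f :: "real \<Rightarrow> real"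
  assumes "open S" "\<And>x. x \<in> S \<Longrightarrow> (f has_real_derivative f' x) (at x)" "Ck_on k S f'"
  shows "Ck_on (Suc k) S f"
  using assms by (intro Ck_on_of_derivs[of S f "\<lambda>x v. f' x * v"])
    (auto simp: has_field_derivative_def)

lemma Ck_on_sin: "Ck_on k UNIV (sin :: real \<Rightarrow> real)" and Ck_on_cos: "Ck_on k UNIV (cos :: real \<Rightarrow> real)"
proof (induction k)
  case (Suc k)
  { case 1
    show ?case by (rule Ck_on_real_deriv[where f'=cos]) (use Suc in \<open>auto intro: DERIV_sin\<close>)
  next
    case 2
    show ?case by (rule Ck_on_real_deriv[where f'="\<lambda>x. - sin x"])
       (use Suc in \<open>auto intro: DERIV_cos Ck_on_uminus\<close>) }
qed (auto intro: continuous_intros)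

lemma Ck_on_inverse:
  fixes f :: "'a::real_normed_vector \<Rightarrow> 'b::real_normed_div_algebra"
  assumes "open S" "Ck_on k S f" "\<And>x. x \<in> S \<Longrightarrow> f x \<noteq> 0"
  shows "Ck_on k S (\<lambda>x. inverse (f x))"
  using assms(2)
proof (induction k)
  case 0
  then show ?case
    using assms(3) by (auto intro: continuous_on_inverse)
next
  case (Suc k)
  show ?case
  proof (rule Ck_on_SucI[OF assms(1)])
    show "((\<lambda>x. inverse (f x)) has_derivative
        (\<lambda>v. - (inverse (f x) * frechet_derivative f (at x) v * inverse (f x)))) (at x)" if "x \<in> S" for x
      by (rule Deriv.has_derivative_inverse[OF assms(3)[OF that] Ck_on_Suc_has_derivative[OF Suc.prems that]])
    show "Ck_on k S (\<lambda>x. - (inverse (f x) * frechet_derivative f (at x) v * inverse (f x)))" for v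
      by (intro Ck_on_uminus Ck_on_mult assms(1) Suc.IH Ck_on_SucD[OF Suc.prems]
          Ck_on_Suc_frechet_derivative[OF Suc.prems])
  qed
qed

text \<open>The derivative of arcsin is 1 / cos (arcsin x), again an expression in arcsin, so each
  order follows from the one before.\<close>

lemma Ck_on_arcsin: "Ck_on k {-1<..<1} arcsin"
proof (induction k)
  case 0
  show ?case by (auto intro!: continuous_intros)
next
  case (Suc k)
  have "Ck_on k {-1<..<1} (\<lambda>x. cos (arcsin x))"
    by (rule Ck_on_compose[OF _ _ Ck_on_cos Suc]) auto
  then have "Ck_on k {-1<..<1} (\<lambda>x. inverse (cos (arcsin x)))"
    by (rule Ck_on_inverse[rotated]) (auto simp: cos_arcsin_nonzero)
  then show ?case
    by (rule Ck_on_real_deriv[rotated 2]) (auto intro!: derivative_eq_intros simp: cos_arcsin)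
qed

lemma smooth_on_has_derivative:
  "smooth_on S f \<Longrightarrow> x \<in> S \<Longrightarrow> (f has_derivative frechet_derivative f (at x)) (at x)"
  unfolding smooth_on_def using Ck_on_Suc_has_derivative by blast

lemma smooth_on_frechet_derivative:
  "smooth_on S f \<Longrightarrow> smooth_on S (\<lambda>x. frechet_derivative f (at x) v)"
  unfolding smooth_on_def using Ck_on_Suc_frechet_derivative by blast

text \<open>A Leibniz rule whose continuity hypothesis is stated direction by direction, the form in
  which \<open>Ck_on\<close> delivers it; in finite dimension this gives continuity in operator
  norm. The ball in the proof is the convex neighbourhood that \<open>leibniz_rule\<close> asks
  for.\<close>

lemma has_derivative_integral_param:
  fixes f :: "'a::euclidean_space \<Rightarrow> real \<Rightarrow> 'b::euclidean_space"
  assumes "open S" "x \<in> S"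
    and df: "\<And>x t. x \<in> S \<Longrightarrow> t \<in> {a..b} \<Longrightarrow> ((\<lambda>x. f x t) has_derivative f' x t) (at x)"
    and cf: "\<And>x. x \<in> S \<Longrightarrow> continuous_on {a..b} (f x)"
    and cf': "\<And>v. continuous_on (S \<times> {a..b}) (\<lambda>(x, t). f' x t v)"
  shows "((\<lambda>x. integral {a..b} (f x)) has_derivative (\<lambda>v. integral {a..b} (\<lambda>t. f' x t v))) (at x)"
proof -
  define F where "F x t = Blinfun (f' x t)" for x t
  have F: "blinfun_apply (F x t) = f' x t" if "x \<in> S" "t \<in> {a..b}" for x t
    unfolding F_def by (rule bounded_linear_Blinfun_apply[OF has_derivative_bounded_linear[OF df[OF that]]])
  have cF: "continuous_on (S \<times> {a..b}) (\<lambda>(x, t). F x t)"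
  proof (rule continuous_on_blinfun_componentwise)
    show "continuous_on (S \<times> {a..b}) (\<lambda>p. blinfun_apply (case p of (x, t) \<Rightarrow> F x t) i)" for i
      by (rule continuous_on_eq[OF cf'[of i]]) (auto simp: F)
  qed
  obtain e where e: "e > 0" "ball x e \<subseteq> S"
    using assms(1,2) open_contains_ball by blast
  have "((\<lambda>x. integral (cbox a b) (f x)) has_derivative integral (cbox a b) (F x)) (at x within ball x e)"
  proof (rule leibniz_rule)
    show "((\<lambda>x. f x t) has_derivative blinfun_apply (F y t)) (at y within ball x e)"
      if "y \<in> ball x e" "t \<in> cbox a b" for y t
    proof -
      have "y \<in> S" "t \<in> {a..b}"
        using e that by auto
      then show ?thesis
        using df F by (simp add: has_derivative_at_withinI)
    qed
    show "f y integrable_on cbox a b" if "y \<in> ball x e" for y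
      using integrable_continuous_real[OF cf, of y] e that by auto
    show "continuous_on (ball x e \<times> cbox a b) (\<lambda>(x, t). F x t)"
      by (rule continuous_on_subset[OF cF]) (use e in auto)
  qed (use e in auto)
  then have 1: "((\<lambda>x. integral {a..b} (f x)) has_derivative integral {a..b} (F x)) (at x)"
    using e at_within_open[of x "ball x e"] by auto
  have "F x integrable_on {a..b}"
  proof (rule integrable_continuous_real)
    show "continuous_on {a..b} (F x)"
      using continuous_on_compose2[OF cF, of "{a..b}" "\<lambda>t. (x, t)"] assms(2)
      by (simp add: continuous_on_Pair image_subset_iff)
  qed
  then have "blinfun_apply (integral {a..b} (F x)) v = integral {a..b} (\<lambda>t. blinfun_apply (F x t) v)" for v
    using integral_linear[OF _ blinfun.bounded_linear_left, of "F x" "{a..b}" v] by (simp add: o_def)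
  also have "integral {a..b} (\<lambda>t. blinfun_apply (F x t) v) = integral {a..b} (\<lambda>t. f' x t v)" for v
    by (rule integral_cong) (simp add: F assms(2))
  finally show ?thesis
    by (rule has_derivative_eq_rhs[OF 1 ext])
qed

text \<open>The integration variable ranges over the whole line in the hypothesis so that the domain
  stays open, as the meaning of \<open>Ck_on\<close> requires.\<close>

lemma Ck_on_integral:
  fixes f :: "'a::euclidean_space \<times> real \<Rightarrow> 'b::euclidean_space"
  assumes "open S" "Ck_on k (S \<times> UNIV) f"
  shows "Ck_on k S (\<lambda>x. integral {a..b} (\<lambda>t. f (x, t)))"
  using assms(2)
proof (induction k arbitrary: f)
  case 0
  then have "continuous_on (S \<times> cbox a b) (\<lambda>(x, t). f (x, t))"
    by (auto intro: continuous_on_subset)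
  from integral_continuous_on_param[OF this] show ?case
    by simp
next
  case (Suc k)
  let ?f' = "\<lambda>x t v. frechet_derivative f (at (x, t)) (v, 0)"
  show ?case
  proof (rule Ck_on_SucI[OF assms(1)])
    show "((\<lambda>x. integral {a..b} (\<lambda>t. f (x, t))) has_derivative (\<lambda>v. integral {a..b} (\<lambda>t. ?f' x t v))) (at x)"
      if "x \<in> S" for x
    proof (rule has_derivative_integral_param[OF assms(1) that])
      show "((\<lambda>x. f (x, t)) has_derivative ?f' x t) (at x)" if "x \<in> S" for x t
        by (rule has_derivative_compose[where f="\<lambda>x. (x, t)" and g=f,
              OF has_derivative_Pair[OF has_derivative_ident has_derivative_const]
                Ck_on_Suc_has_derivative[OF Suc.prems]]) (simp add: that)
      show "continuous_on {a..b} (\<lambda>t. f (x, t))" if "x \<in> S" for x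
        by (rule continuous_on_compose2[OF Ck_on_imp_continuous_on[OF Suc.prems]])
          (use that in \<open>auto intro!: continuous_intros\<close>)
      show "continuous_on (S \<times> {a..b}) (\<lambda>(x, t). ?f' x t v)" for v
        using continuous_on_subset[OF Ck_on_imp_continuous_on[OF Ck_on_Suc_frechet_derivative[OF Suc.prems]]]
        by (simp add: case_prod_unfold) blast
    qed
    show "Ck_on k S (\<lambda>x. integral {a..b} (\<lambda>t. ?f' x t v))" for v
      by (rule Suc.IH[OF Ck_on_Suc_frechet_derivative[OF Suc.prems]])
  qed
qed

section \<open>Determinants and the inverse function theorem in three dimensions\<close>

definition det3 :: "real \<times> real \<times> real \<Rightarrow> real \<times> real \<times> real \<Rightarrow> real \<times> real \<times> real \<Rightarrow> real" where
  "det3 a b c =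
     fst a * (fst (snd b) * snd (snd c) - snd (snd b) * fst (snd c))
     - fst (snd a) * (fst b * snd (snd c) - snd (snd b) * fst c)
     + snd (snd a) * (fst b * fst (snd c) - fst (snd b) * fst c)"

lemma det3_linear:
  "det3 (a + a') b c = det3 a b c + det3 a' b c" "det3 (r *\<^sub>R a) b c = r * det3 a b c"
  "det3 a (b + b') c = det3 a b c + det3 a b' c" "det3 a (r *\<^sub>R b) c = r * det3 a b c"
  "det3 a b (c + c') = det3 a b c + det3 a b c'" "det3 a b (r *\<^sub>R c) = r * det3 a b c"
  by (simp_all add: det3_def algebra_simps)

lemma cramer3:
  assumes "det3 a b c \<noteq> 0"
  shows "(det3 v b c / det3 a b c) *\<^sub>R a + (det3 a v c / det3 a b c) *\<^sub>R b
    + (det3 a b v / det3 a b c) *\<^sub>R c = v"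
proof -
  have "(det3 v b c) *\<^sub>R a + (det3 a v c) *\<^sub>R b + (det3 a b v) *\<^sub>R c = det3 a b c *\<^sub>R v"
    by (cases a; cases b; cases c; cases v) (simp add: det3_def algebra_simps)
  then have "inverse (det3 a b c) *\<^sub>R ((det3 v b c) *\<^sub>R a + (det3 a v c) *\<^sub>R b + (det3 a b v) *\<^sub>R c) = v"
    using assms by simp
  then show ?thesis
    by (simp add: scaleR_add_right divide_inverse mult.commute)
qed

lemma Ck_on_det3:
  "open S \<Longrightarrow> Ck_on k S a \<Longrightarrow> Ck_on k S b \<Longrightarrow> Ck_on k S c \<Longrightarrow> Ck_on k S (\<lambda>x. det3 (a x) (b x) (c x))"
  unfolding det3_def by (intro Ck_on_add Ck_on_diff Ck_on_mult Ck_on_fst Ck_on_snd)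

lemma linear_R3:
  fixes L :: "real \<times> real \<times> real \<Rightarrow> 'a::real_vector"
  assumes "linear L"
  shows "L v = fst v *\<^sub>R L (1, 0, 0) + fst (snd v) *\<^sub>R L (0, 1, 0) + snd (snd v) *\<^sub>R L (0, 0, 1)"
proof -
  have "v = fst v *\<^sub>R (1, 0, 0) + fst (snd v) *\<^sub>R (0, 1, 0) + snd (snd v) *\<^sub>R (0, 0, 1)"
    by (cases v) simp
  then have "L v = L (fst v *\<^sub>R (1, 0, 0) + fst (snd v) *\<^sub>R (0, 1, 0) + snd (snd v) *\<^sub>R (0, 0, 1))"
    by simp
  then show ?thesis
    by (simp only: linear_add[OF assms] linear_scale[OF assms])
qed

text \<open>\<open>inverse_function_theorem\<close> yields a differentiable inverse g. Its
  derivative at y is, by Cramer's rule, a rational expression in the partial derivatives of f at g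
  y; if g is of class k, so is this expression, and g is of class k + 1.\<close>

lemma smooth_inverse_function_R3:
  fixes f :: "real \<times> real \<times> real \<Rightarrow> real \<times> real \<times> real"
  assumes "open U" "smooth_on U f" "x0 \<in> U"
    and "det3 (frechet_derivative f (at x0) (1, 0, 0)) (frechet_derivative f (at x0) (0, 1, 0))
      (frechet_derivative f (at x0) (0, 0, 1)) \<noteq> 0"
  obtains U' V where "U' \<subseteq> U" "x0 \<in> U'" "smooth_diffeo U' V f"
proof -
  let ?D = "\<lambda>x. frechet_derivative f (at x)"
  define d where "d x = det3 (?D x (1, 0, 0)) (?D x (0, 1, 0)) (?D x (0, 0, 1))" for x
  define J where "J x v = (det3 v (?D x (0, 1, 0)) (?D x (0, 0, 1)) / d x,
    det3 (?D x (1, 0, 0)) v (?D x (0, 0, 1)) / d x, det3 (?D x (1, 0, 0)) (?D x (0, 1, 0)) v / d x)" for x v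
  have D: "(f has_derivative ?D x) (at x)" "bounded_linear (?D x)" if "x \<in> U" for x
  proof -
    show "(f has_derivative ?D x) (at x)"
      using smooth_on_has_derivative[OF assms(2) that] .
    then show "bounded_linear (?D x)"
      by (rule has_derivative_bounded_linear)
  qed
  have D_Ck: "Ck_on k U (\<lambda>x. ?D x v)" for k v
    using assms(2) Ck_on_Suc_frechet_derivative unfolding smooth_on_def by blast
  have d_Ck: "Ck_on k U d" for k
    unfolding d_def by (intro Ck_on_det3 D_Ck assms(1))
  define U1 where "U1 = U \<inter> d -` (- {0})"
  have "open U1"
    unfolding U1_def using continuous_open_preimage[OF Ck_on_imp_continuous_on[OF d_Ck] assms(1)] by blast
  have "x0 \<in> U1"
    using assms(3,4) by (simp add: U1_def d_def)
  have "U1 \<subseteq> U"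
    by (auto simp: U1_def)
  have DJ: "?D x (J x v) = v" if "x \<in> U1" for x v
    using cramer3[of "?D x (1, 0, 0)" "?D x (0, 1, 0)" "?D x (0, 0, 1)" v] that
      linear_R3[OF bounded_linear.linear[OF D(2)], of x "J x v"]
    by (auto simp: U1_def d_def J_def)
  define f' where "f' x = Blinfun (?D x)" for x
  have f': "blinfun_apply (f' x) = ?D x" if "x \<in> U1" for x
    unfolding f'_def by (rule bounded_linear_Blinfun_apply) (use that D(2) \<open>U1 \<subseteq> U\<close> in blast)
  have "linear (J x0)"
    unfolding J_def by (rule linearI) (simp_all add: det3_linear add_divide_distrib)
  then have J0: "blinfun_apply (Blinfun (J x0)) = J x0"
    by (simp add: bounded_linear_Blinfun_apply linear_conv_bounded_linear)
  \<comment> \<open>Cramer's rule gives a right inverse while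
    \<open>inverse_function_theorem\<close> asks for a left inverse; in equal dimensions the
    surjective derivative is injective.\<close>
  have JD0: "J x0 (?D x0 v) = v" for v
  proof -
    have l: "linear (?D x0)"
      using D(2)[OF assms(3)] by (rule bounded_linear.linear)
    have "surj (?D x0)"
      using DJ[OF \<open>x0 \<in> U1\<close>] by (metis surjI)
    then have "inj (?D x0)"
      using l by (simp add: linear_surj_imp_inj)
    then show ?thesis
      using DJ[OF \<open>x0 \<in> U1\<close>] by (metis injD)
  qed
  obtain U' V g g' where ift: "open U'" "U' \<subseteq> U1" "x0 \<in> U'" "open V" "f x0 \<in> V" "homeomorphism U' V f g"
    "\<And>y. y \<in> V \<Longrightarrow> (g has_derivative (g' y)) (at y)"
    "\<And>y. y \<in> V \<Longrightarrow> g' y = inv (blinfun_apply (f' (g y)))"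
    "\<And>y. y \<in> V \<Longrightarrow> bij (blinfun_apply (f' (g y)))"
  proof (rule inverse_function_theorem[OF \<open>open U1\<close>, of f f' x0 "Blinfun (J x0)"])
    show "(f has_derivative blinfun_apply (f' x)) (at x)" if "x \<in> U1" for x
      using D(1)[OF subsetD[OF \<open>U1 \<subseteq> U\<close> that]] f'[OF that] by simp
    show "continuous_on U1 f'"
    proof (rule continuous_on_blinfun_componentwise)
      fix i :: "real \<times> real \<times> real"
      have "continuous_on U1 (\<lambda>x. ?D x i)"
        using Ck_on_imp_continuous_on[OF D_Ck] continuous_on_subset \<open>U1 \<subseteq> U\<close> by blast
      then show "continuous_on U1 (\<lambda>x. blinfun_apply (f' x) i)"
        by (rule continuous_on_eq) (auto simp: f')
    qed
    show "Blinfun (J x0) o\<^sub>L f' x0 = id_blinfun"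
      by (rule blinfun_eqI) (simp add: J0 f' \<open>x0 \<in> U1\<close> JD0)
  qed (use \<open>x0 \<in> U1\<close> in auto)
  have gV: "g y \<in> U'" if "y \<in> V" for y
    using ift(6) that by (auto simp: homeomorphism_def)
  have g': "g' y v = J (g y) v" if "y \<in> V" for y v
  proof -
    have "g y \<in> U1"
      using gV[OF that] ift(2) by blast
    then show ?thesis
      using ift(8,9)[OF that] DJ[of "g y" v] by (metis bij_inv_eq_iff f')
  qed
  have g_Ck: "Ck_on k V g" for k
  proof (induction k)
    case 0
    then show ?case
      using ift(6) by (simp add: homeomorphism_def)
  next
    case (Suc k)
    have gU: "g ` V \<subseteq> U" 
      using gV ift(2) \<open>U1 \<subseteq> U\<close> by blast
    have c: "Ck_on k V (\<lambda>y. ?D (g y) v)" for v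
      by (rule Ck_on_compose[OF ift(4) assms(1) D_Ck Suc gU])
    have "Ck_on k V (\<lambda>y. inverse (d (g y)))"
    proof (rule Ck_on_inverse[OF ift(4)])
      show "Ck_on k V (\<lambda>y. d (g y))"
        by (rule Ck_on_compose[OF ift(4) assms(1) d_Ck Suc gU])
      show "d (g y) \<noteq> 0" if "y \<in> V" for y
        using subsetD[OF ift(2) gV[OF that]] by (simp add: U1_def)
    qed
    then have "Ck_on k V (\<lambda>y. J (g y) v)" for v
      unfolding J_def divide_inverse
      by (intro Ck_on_Pair Ck_on_mult Ck_on_det3 ift(4) c Ck_on_const)
    then have "Ck_on k V (\<lambda>y. g' y v)" for v
      by (rule Ck_on_transform[OF _ ift(4)]) (simp add: g')
    with ift(7) show ?case
      by (rule Ck_on_SucI[OF ift(4)])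
  qed
  have bij: "bij_betw f U' V"
    using ift(6) homeomorphism_def unfolding homeomorphism_def bij_betw_def
    by (metis inj_on_inverseI)
  have "inv_into U' f y = g y" if "y \<in> V" for y
    using ift(6) that bij gV[OF that] 
    by (metis bij_betw_def homeomorphism_apply2 inv_into_f_f)
  then have "smooth_on V (inv_into U' f)"
    unfolding smooth_on_def using Ck_on_transform[OF g_Ck ift(4)] by blast
  moreover have "smooth_on U' f"
    using assms(2) Ck_on_subset[of _ U f U'] ift(2) \<open>U1 \<subseteq> U\<close> unfolding smooth_on_def by blast
  ultimately have "smooth_diffeo U' V f"
    unfolding smooth_diffeo_def using ift(1,4) bij by blast
  with that[of U' V] ift(2,3) \<open>U1 \<subseteq> U\<close> show thesis
    by blast
qed

subsection \<open>Seeley's sequence\<close>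

text \<open>The power series of \<open>\<Prod>j. (1 - z / 2 ^ j)\<close>, which vanishes at the powers of two.\<close>

fun seeley_aux :: "nat \<Rightarrow> real" where
  "seeley_aux 0 = 1"
| "seeley_aux (Suc n) = - seeley_aux n * 2 / (2 ^ Suc n - 1)"

text \<open>The ratio of consecutive terms is 2 c / (2^(n+1) - 1), which tends to 0: the power
  series is entire.\<close>

lemma summable_seeley_aux: "summable (\<lambda>n. \<bar>seeley_aux n\<bar> * c ^ n)" if "c \<ge> 0"
proof -
  obtain N where N: "4 * c + 2 \<le> 2 ^ N"
    using real_arch_pow[of 2 "4 * c + 2"] by (auto intro: less_imp_le)
  show ?thesis
  proof (rule summable_ratio_test[of "1/2" N])
    fix n assume "n \<ge> N"
    then have "(2::real) ^ N \<le> 2 ^ Suc n"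
      by (intro power_increasing) auto
    with N that have "2 ^ Suc n - 1 > (0::real)" "4 * c \<le> 2 ^ Suc n - 1"
      by linarith+
    then have "2 * c / (2 ^ Suc n - 1) \<le> 1 / 2"
      by (simp add: divide_simps)
    moreover have "norm (\<bar>seeley_aux (Suc n)\<bar> * c ^ Suc n)
        = (2 * c / (2 ^ Suc n - 1)) * (\<bar>seeley_aux n\<bar> * c ^ n)"
      using \<open>2 ^ Suc n - 1 > 0\<close> that by (simp add: abs_mult abs_divide)
    ultimately show "norm (\<bar>seeley_aux (Suc n)\<bar> * c ^ Suc n) \<le> 1 / 2 * norm (\<bar>seeley_aux n\<bar> * c ^ n)"
      using that mult_right_mono[OF \<open>2 * c / (2 ^ Suc n - 1) \<le> 1 / 2\<close>, of "\<bar>seeley_aux n\<bar> * c ^ n"]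
      by (simp only: real_norm_def abs_mult abs_abs power_abs[symmetric] abs_of_nonneg zero_le_mult_iff) auto
  qed simp
qed

lemma summable_seeley_aux': "summable (\<lambda>n. seeley_aux n * c ^ n)"
  by (rule summable_rabs_cancel) (use summable_seeley_aux[of "\<bar>c\<bar>"] in \<open>simp add: abs_mult power_abs\<close>)

text \<open>Splitting off the factor j = 0 of the product gives P(z) = (1 - z) P(z/2). Comparing
  coefficients turns this into the recursion of \<open>seeley_aux\<close>, and the proof runs
  through the recursion alone.\<close>

lemma seeley_aux_functional:
  "(\<Sum>n. seeley_aux n * z ^ n) = (1 - z) * (\<Sum>n. seeley_aux n * (z / 2) ^ n)"
proof -
  have "(\<Sum>n. seeley_aux n * z ^ n) - (\<Sum>n. seeley_aux n * (z / 2) ^ n)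
      = (\<Sum>n. seeley_aux n * z ^ n - seeley_aux n * (z / 2) ^ n)"
    by (rule suminf_diff) (rule summable_seeley_aux')+
  also have "\<dots> = (\<Sum>n. seeley_aux (Suc n) * z ^ Suc n - seeley_aux (Suc n) * (z / 2) ^ Suc n)"
    by (subst suminf_split_head) (auto intro: summable_diff summable_seeley_aux')
  also have "\<dots> = (\<Sum>n. - z * (seeley_aux n * (z / 2) ^ n))"
  proof (rule suminf_cong)
    fix n
    have "(2::real) ^ Suc n - 1 \<noteq> 0"
      using one_less_power[of "2::real" "Suc n"] by simp
    then have "seeley_aux (Suc n) * (2 ^ Suc n - 1) = - 2 * seeley_aux n"
      by simp
    moreover have "seeley_aux (Suc n) * z ^ Suc n - seeley_aux (Suc n) * (z / 2) ^ Suc n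
        = seeley_aux (Suc n) * (2 ^ Suc n - 1) * (z ^ Suc n / 2 ^ Suc n)"
      by (simp add: power_divide field_simps del: seeley_aux.simps)
    ultimately show "seeley_aux (Suc n) * z ^ Suc n - seeley_aux (Suc n) * (z / 2) ^ Suc n
        = - z * (seeley_aux n * (z / 2) ^ n)"
      by (simp add: power_divide del: seeley_aux.simps)
  qed
  also have "\<dots> = - z * (\<Sum>n. seeley_aux n * (z / 2) ^ n)"
    by (rule suminf_mult) (rule summable_seeley_aux')
  finally show ?thesis
    by (simp add: algebra_simps)
qed

text \<open>The factor 1 - z produces the zero at 1, and the functional equation passes a zero at
  z/2 on to z.\<close>

lemma seeley_aux_power2: "(\<Sum>n. seeley_aux n * (2 ^ m) ^ n) = 0"
proof (induction m)
  case 0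
  then show ?case
    using seeley_aux_functional[of 1] by simp
next
  case (Suc m)
  then show ?case
    using seeley_aux_functional[of "2 ^ Suc m"] by simp
qed

text \<open>Dividing the coefficients by 1 + 2^n gives a series R with R(z) + R(2z) = P(z), where P
  is the series of \<open>seeley_aux\<close>. As P vanishes at the powers of two, R changes sign at
  each doubling among them.\<close>

definition seeley_raw :: "nat \<Rightarrow> real" where
  "seeley_raw n = seeley_aux n / (1 + 2 ^ n)"

lemma summable_seeley_raw: "summable (\<lambda>n. \<bar>seeley_raw n\<bar> * c ^ n)" if "c \<ge> 0"
proof (rule summable_comparison_test'[OF summable_seeley_aux[OF that]])
  fix n
  have "\<bar>seeley_raw n\<bar> \<le> \<bar>seeley_aux n\<bar>"
  proof -
    have "\<bar>1 + 2 ^ n\<bar> \<ge> (1::real)"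
      by simp
    then show ?thesis
      unfolding seeley_raw_def abs_divide by (rule order_trans[OF divide_left_mono[of 1]]) (auto intro: add_pos_pos)
  qed
  then show "norm (\<bar>seeley_raw n\<bar> * c ^ n) \<le> \<bar>seeley_aux n\<bar> * c ^ n"
    using that by (simp add: abs_mult mult_right_mono)
qed

lemma summable_seeley_raw': "summable (\<lambda>n. seeley_raw n * c ^ n)"
  by (rule summable_rabs_cancel) (use summable_seeley_raw[of "\<bar>c\<bar>"] in \<open>simp add: abs_mult power_abs\<close>)

lemma seeley_raw_power2:
  "(\<Sum>n. seeley_raw n * (2 ^ m) ^ n) = (- 1) ^ m * (\<Sum>n. seeley_raw n)"
proof (induction m)
  case (Suc m)
  have "(\<Sum>n. seeley_raw n * (2 ^ m) ^ n) + (\<Sum>n. seeley_raw n * (2 ^ Suc m) ^ n)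
      = (\<Sum>n. seeley_raw n * (2 ^ m) ^ n + seeley_raw n * (2 ^ Suc m) ^ n)"
    by (rule suminf_add) (rule summable_seeley_raw')+
  also have "\<dots> = (\<Sum>n. seeley_aux n * (2 ^ m) ^ n)"
  proof (rule suminf_cong)
    fix n
    have "1 + (2::real) ^ n \<noteq> 0"
      using zero_less_power[of "2::real" n] by linarith
    then have "seeley_aux n = seeley_raw n * (1 + 2 ^ n)"
      by (simp add: seeley_raw_def)
    then show "seeley_raw n * (2 ^ m) ^ n + seeley_raw n * (2 ^ Suc m) ^ n = seeley_aux n * (2 ^ m) ^ n"
      by (simp add: power_mult_distrib algebra_simps)
  qed
  finally show ?case
    using Suc by (simp add: seeley_aux_power2)
qed simp

lemma seeley_aux_pos: "0 < seeley_aux (2 * j)"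
proof (induction j)
  case (Suc j)
  have "(2::real) ^ Suc n - 1 > 0" for n
    using one_less_power[of "2::real" "Suc n"] by simp
  from this[of "2 * j"] this[of "Suc (2 * j)"] Suc show ?case
    by (simp add: divide_less_0_iff)
qed simp

text \<open>From the third term on, each positive even-indexed term dominates the negative term
  after it. The pair j = 0 is 1/2 - 2/3, hence negative.\<close>

lemma seeley_raw_pair: "0 \<le> seeley_raw (2 * j) + seeley_raw (Suc (2 * j))" if "j \<ge> 1"
proof -
  define t :: real where "t = 2 ^ (2 * j)"
  have "(2::real) ^ 1 \<le> 2 ^ (2 * j)"
    using that by (intro power_increasing) auto
  then have t: "t \<ge> 2"
    by (simp add: t_def)
  have "seeley_raw (2 * j) + seeley_raw (Suc (2 * j))
      = seeley_aux (2 * j) * (1 / (1 + t) - 2 / ((2 * t - 1) * (1 + 2 * t)))"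
    by (simp add: seeley_raw_def t_def algebra_simps)
  moreover have "2 / ((2 * t - 1) * (1 + 2 * t)) \<le> 1 / (1 + t)"
  proof -
    define u where "u = t * t"
    have "2 * t \<le> u"
      unfolding u_def using t by (intro mult_right_mono) auto
    moreover have "(2 * t - 1) * (1 + 2 * t) = 4 * u - 1"
      by (simp add: u_def algebra_simps)
    ultimately have "2 * (1 + t) \<le> (2 * t - 1) * (1 + 2 * t)"
      using t by simp
    then show ?thesis
      using t by (simp add: divide_simps)
  qed
  ultimately show ?thesis
    using seeley_aux_pos[of j] by simp
qed

lemma seeley_raw_sum_pos: "0 < (\<Sum>n. seeley_raw n)"
proof -
  have s: "(\<lambda>N. \<Sum>n<N. seeley_raw n) \<longlonglongrightarrow> (\<Sum>n. seeley_raw n)"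
    using summable_seeley_raw'[of 1] by (simp add: summable_LIMSEQ)
  have "(\<lambda>N. \<Sum>n<2 * N. seeley_raw n) \<longlonglongrightarrow> (\<Sum>n. seeley_raw n)"
    using LIMSEQ_subseq_LIMSEQ[OF s, of "\<lambda>N. 2 * N"] by (simp add: strict_mono_def o_def)
  \<comment> \<open>The first four terms 1/2 - 2/3 + 4/15 - 8/189 already exceed 1/20, in spite of
    the negative first pair; later pairs only add.\<close>
  moreover have "1 / 20 \<le> (\<Sum>n<2 * N. seeley_raw n)" if "N \<ge> 2" for N
    using that
  proof (induction N rule: dec_induct)
    case base
    show ?case
      by (simp add: seeley_raw_def numeral_eq_Suc)
  next
    case (step N)
    then show ?case
      using seeley_raw_pair[of N] by simp
  qed
  ultimately have "1 / 20 \<le> (\<Sum>n. seeley_raw n)"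
    by (intro LIMSEQ_le_const) blast+
  then show ?thesis
    by simp
qed

definition seeley :: "nat \<Rightarrow> real" where
  "seeley n = seeley_raw n / (\<Sum>n. seeley_raw n)"

lemma summable_seeley: "summable (\<lambda>n. \<bar>seeley n * (- (2 ^ n)) ^ m\<bar>)"
proof -
  have "summable (\<lambda>n. \<bar>seeley_raw n\<bar> * (2 ^ m) ^ n / (\<Sum>n. seeley_raw n))"
    by (intro summable_divide summable_seeley_raw) simp
  moreover have "\<bar>seeley n * (- (2 ^ n)) ^ m\<bar> = \<bar>seeley_raw n\<bar> * (2 ^ m) ^ n / (\<Sum>n. seeley_raw n)" for n
    using seeley_raw_sum_pos
    by (simp add: seeley_def abs_mult power_abs abs_divide power_mult[symmetric] mult.commute)
  ultimately show ?thesis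
    by simp
qed

text \<open>These moment conditions make the reflected series fit the original function to every
  order at s = 0. The sign of (-2^n)^m cancels the (-1)^m of
  \<open>seeley_raw_power2\<close>.\<close>

lemma suminf_seeley: "(\<Sum>n. seeley n * (- (2 ^ n)) ^ m) = 1"
proof -
  have "seeley n * (- (2 ^ n)) ^ m = (- 1) ^ m / (\<Sum>n. seeley_raw n) * (seeley_raw n * (2 ^ m) ^ n)" for n
    by (simp add: seeley_def power_mult[symmetric] mult.commute power_minus[of "2 ^ n"])
  then have "(\<Sum>n. seeley n * (- (2 ^ n)) ^ m)
      = (- 1) ^ m / (\<Sum>n. seeley_raw n) * (\<Sum>n. seeley_raw n * (2 ^ m) ^ n)"
    using suminf_mult[OF summable_seeley_raw'[of "2 ^ m"]] by presburger
  then show ?thesis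
    using seeley_raw_sum_pos by (simp add: seeley_raw_power2 power_add[symmetric] mult_2[symmetric])
qed

subsection \<open>Smooth functions with bounded derivatives\<close>

text \<open>Bounds on the whole space are required because the reflection evaluates a function at
  arbitrarily large dilates; they give uniform convergence of the series and of its
  derivatives.\<close>

fun Cb :: "nat \<Rightarrow> ('a::real_normed_vector \<Rightarrow> 'b::real_normed_vector) \<Rightarrow> bool" where
  "Cb 0 f \<longleftrightarrow> continuous_on UNIV f \<and> bounded (range f)"
| "Cb (Suc k) f \<longleftrightarrow> bounded (range f) \<and> (\<forall>x. f differentiable (at x)) \<and>
     (\<forall>v. Cb k (\<lambda>x. frechet_derivative f (at x) v))"

lemma Cb_imp_Ck_on: "Cb k f \<Longrightarrow> Ck_on k UNIV f"
  by (induction k arbitrary: f) auto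

lemma Cb_imp_bounded: "Cb k f \<Longrightarrow> bounded (range f)"
  by (cases k) auto

lemma Cb_Suc_has_derivative:
  "Cb (Suc k) f \<Longrightarrow> (f has_derivative frechet_derivative f (at x)) (at x)"
  by (simp add: frechet_derivative_works)

lemma Cb_Suc_frechet_derivative: "Cb (Suc k) f \<Longrightarrow> Cb k (\<lambda>x. frechet_derivative f (at x) v)"
  by simp

lemma Cb_SucI:
  assumes "bounded (range f)" "\<And>x. (f has_derivative f' x) (at x)" "\<And>v. Cb k (\<lambda>x. f' x v)"
  shows "Cb (Suc k) f"
proof -
  have "frechet_derivative f (at x) = f' x" for x
    using assms(2) frechet_derivative_at by metis
  with assms show ?thesis
    by (auto simp: differentiable_def)
qed

lemma Cb_bounded_linear:
  fixes f :: "'c::real_normed_vector \<Rightarrow> 'a::real_normed_vector" and L :: "'a \<Rightarrow> 'b::real_normed_vector"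
  assumes "bounded_linear L" "Cb k f"
  shows "Cb k (\<lambda>x. L (f x))"
proof -
  have "bounded (range (\<lambda>x. L (f x)))" if "bounded (range f)" for f :: "'c \<Rightarrow> 'a"
    using bounded_linear_image[OF that assms(1)] by (simp add: image_image)
  then show ?thesis
    using assms(2)
  proof (induction k arbitrary: f)
    case 0
    have "continuous_on UNIV f"
      using 0 by simp
    then show ?case
      using bounded_linear.continuous_on[OF assms(1), of UNIV f] 0 by simp
  next
    case (Suc k)
    show ?case
      by (rule Cb_SucI[OF _ bounded_linear.has_derivative[OF assms(1) Cb_Suc_has_derivative[OF Suc.prems(2)]]])
        (use Suc Cb_imp_bounded Cb_Suc_frechet_derivative in blast)+
  qed
qed

lemma Cb_add:
  assumes "Cb k f" "Cb k g"
  shows "Cb k (\<lambda>x. f x + g x)"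
  using assms
proof (induction k arbitrary: f g)
  case 0
  then show ?case
    by (simp add: continuous_on_add bounded_plus_comp)
next
  case (Suc k)
  show ?case
  proof (rule Cb_SucI[OF _ has_derivative_add[OF Cb_Suc_has_derivative Cb_Suc_has_derivative, OF Suc.prems]])
    show "bounded (range (\<lambda>x. f x + g x))"
      using Suc.prems by (intro bounded_plus_comp) (auto dest: Cb_imp_bounded)
    show "Cb k (\<lambda>x. frechet_derivative f (at x) v + frechet_derivative g (at x) v)" for v
      using Suc.IH Suc.prems by simp
  qed
qed

lemma Cb_scaleR: "Cb k f \<Longrightarrow> Cb k (\<lambda>x. c *\<^sub>R f x)"
  by (rule Cb_bounded_linear[OF bounded_linear_scaleR_right])

lemma Cb_compose_linear:
  assumes "bounded_linear L" "Cb k f"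
  shows "Cb k (\<lambda>x. f (L x))"
  using assms(2)
proof (induction k arbitrary: f)
  case 0
  then show ?case
    using continuous_on_compose2[of UNIV f UNIV L] linear_continuous_on[OF assms(1)]
      bounded_subset[of "range f" "range (\<lambda>x. f (L x))"] by auto
next
  case (Suc k)
  show ?case
  proof (rule Cb_SucI)
    show "bounded (range (\<lambda>x. f (L x)))"
      by (rule bounded_subset[OF Cb_imp_bounded[OF Suc.prems]]) auto
    show "((\<lambda>x. f (L x)) has_derivative (\<lambda>v. frechet_derivative f (at (L x)) (L v))) (at x)" for x
      by (rule has_derivative_compose[of L L x UNIV f, OF _ Cb_Suc_has_derivative[OF Suc.prems]])
        (rule bounded_linear_imp_has_derivative[OF assms(1)])
    show "Cb k (\<lambda>x. frechet_derivative f (at (L x)) (L v))" for v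
      using Suc.IH[OF Cb_Suc_frechet_derivative[OF Suc.prems]] .
  qed
qed

section \<open>Averages over dilations of the first variable, the integral form of Hadamard
  quotients\<close>

definition dilation_mean :: "nat \<Rightarrow> (real \<times> real \<Rightarrow> real) \<Rightarrow> real \<times> real \<Rightarrow> real" where
  "dilation_mean j h x = integral {0..1} (\<lambda>t. t ^ j * h (t * fst x, snd x))"

lemma dilation_mean_integrand_Ck:
  fixes h :: "real \<times> real \<Rightarrow> real"
  assumes "Ck_on k UNIV h"
  shows "Ck_on k (UNIV \<times> UNIV) (\<lambda>z. snd z ^ j * h (snd z * fst (fst z), snd (fst z)))"
proof -
  have o: "open (UNIV \<times> UNIV :: ((real \<times> real) \<times> real) set)"
    by (intro open_Times open_UNIV)
  have "Ck_on k (UNIV \<times> UNIV) (\<lambda>z::(real\<times>real)\<times>real. h (snd z * fst (fst z), snd (fst z)))"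
    by (rule Ck_on_compose[OF o open_UNIV assms _ subset_UNIV])
      (intro Ck_on_Pair Ck_on_mult Ck_on_fst Ck_on_snd Ck_on_id o)
  then show ?thesis
    using o by (intro Ck_on_mult Ck_on_power Ck_on_snd Ck_on_id)
qed

lemma dilation_mean_bounded:
  assumes "continuous_on UNIV h" "\<And>x. \<bar>h x\<bar> \<le> B"
  shows "\<bar>dilation_mean j h x\<bar> \<le> B"
proof -
  have "norm (integral {0..1} (\<lambda>t. t ^ j * h (t * fst x, snd x))) \<le> B * (1 - 0)"
  proof (rule integral_bound)
    show "continuous_on {0..1} (\<lambda>t. t ^ j * h (t * fst x, snd x))"
      by (intro continuous_intros continuous_on_compose2[OF assms(1)]) auto
    show "norm (t ^ j * h (t * fst x, snd x)) \<le> B" if "t \<in> {0..1}" for t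
    proof -
      have "\<bar>t ^ j\<bar> \<le> 1"
        using that by (simp add: power_le_one)
      then have "\<bar>t ^ j\<bar> * \<bar>h (t * fst x, snd x)\<bar> \<le> 1 * B"
        using assms(2) by (intro mult_mono) auto
      then show ?thesis
        by (simp add: abs_mult)
    qed
  qed auto
  then show ?thesis
    by (simp add: dilation_mean_def)
qed

text \<open>Each derivative in the first variable brings out one more factor t; the weight t^j is
  there to absorb it.\<close>

lemma dilation_mean_has_derivative:
  assumes "Ck_on (Suc k) UNIV h"
  shows "(dilation_mean j h has_derivative
    (\<lambda>v. fst v * dilation_mean (Suc j) (\<lambda>x. frechet_derivative h (at x) (1, 0)) x
       + snd v * dilation_mean j (\<lambda>x. frechet_derivative h (at x) (0, 1)) x)) (at x)"
proof -
  let ?D = "\<lambda>y. frechet_derivative h (at y)"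
  let ?f' = "\<lambda>x t v. fst v * (t ^ Suc j * ?D (t * fst x, snd x) (1, 0)) + snd v * (t ^ j * ?D (t * fst x, snd x) (0, 1))"
  have dh: "(h has_derivative ?D y) (at y)" for y
    using Ck_on_Suc_has_derivative[OF assms] by simp
  have c: "continuous_on UNIV (\<lambda>x. ?D x v)" for v
    using Ck_on_imp_continuous_on[OF Ck_on_Suc_frechet_derivative[OF assms]] .
  have D: "?D y (a, b) = a * ?D y (1, 0) + b * ?D y (0, 1)" for y a b
  proof -
    have "?D y (a *\<^sub>R (1, 0) + b *\<^sub>R (0, 1)) = a * ?D y (1, 0) + b * ?D y (0, 1)"
      by (simp only: linear_add linear_scale has_derivative_linear[OF dh] real_scaleR_def)
    then show ?thesis
      by simp
  qed
  have "((\<lambda>x. integral {0..1} (\<lambda>t. t ^ j * h (t * fst x, snd x))) has_derivative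
    (\<lambda>v. integral {0..1} (\<lambda>t. ?f' x t v))) (at x)"
  proof (rule has_derivative_integral_param[OF open_UNIV UNIV_I])
    show "((\<lambda>x. t ^ j * h (t * fst x, snd x)) has_derivative ?f' x t) (at x)" for x t
    proof -
      have "((\<lambda>x. (t * fst x, snd x)) has_derivative (\<lambda>v. (t * fst v, snd v))) (at x)"
        by (auto intro!: derivative_eq_intros)
      from has_derivative_mult_right[OF has_derivative_compose[OF this dh], of "t ^ j"] show ?thesis
      proof (rule has_derivative_eq_rhs[OF _ ext])
        show "t ^ j * ?D (t * fst x, snd x) (t * fst v, snd v) = ?f' x t v" for v
          using D[of _ "t * fst v" "snd v"] by (simp add: algebra_simps)
      qed
    qed
    have ch: "continuous_on UNIV h"
      using Ck_on_imp_continuous_on[OF assms] .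
    show "continuous_on {0..1} (\<lambda>t. t ^ j * h (t * fst x, snd x))" for x
      by (intro continuous_intros continuous_on_compose2[OF ch]) auto
    show "continuous_on (UNIV \<times> {0..1}) (\<lambda>(x, t). ?f' x t v)" for v
      unfolding case_prod_unfold
      by (intro continuous_intros continuous_on_compose2[OF c[of "(1, 0)"]] continuous_on_compose2[OF c[of "(0, 1)"]]) auto
  qed
  moreover have "integral {0..1} (\<lambda>t. ?f' x t v)
    = fst v * dilation_mean (Suc j) (\<lambda>x. ?D x (1, 0)) x + snd v * dilation_mean j (\<lambda>x. ?D x (0, 1)) x" for v
  proof -
    have "integral {0..1} (\<lambda>t. ?f' x t v) = integral {0..1} (\<lambda>t. fst v * (t ^ Suc j * ?D (t * fst x, snd x) (1, 0)))
          + integral {0..1} (\<lambda>t. snd v * (t ^ j * ?D (t * fst x, snd x) (0, 1)))"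
      by (intro integral_add integrable_continuous_real continuous_intros
          continuous_on_compose2[OF c[of "(1, 0)"]] continuous_on_compose2[OF c[of "(0, 1)"]]) auto
    then show ?thesis
      by (simp add: dilation_mean_def)
  qed
  ultimately show ?thesis
    by (simp add: dilation_mean_def[abs_def])
qed

lemma Cb_dilation_mean: "Cb k h \<Longrightarrow> Cb k (dilation_mean j h)"
proof (induction k arbitrary: h j)
  case 0
  then obtain B where "\<And>x. \<bar>h x\<bar> \<le> B"
    by (auto simp: bounded_iff)
  then have "bounded (range (dilation_mean j h))"
    using dilation_mean_bounded[of h B j] 0 by (auto simp: bounded_iff)
  moreover have "Ck_on 0 UNIV (\<lambda>x. integral {0..1} (\<lambda>t. t ^ j * h (t * fst x, snd x)))"
    using Ck_on_integral[OF open_UNIV dilation_mean_integrand_Ck[of 0 h j], of 0 1] 0 by simp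
  ultimately show ?case
    by (simp add: dilation_mean_def[abs_def])
next
  case (Suc k)
  show ?case
  proof (rule Cb_SucI[OF _ dilation_mean_has_derivative[OF Cb_imp_Ck_on[OF Suc.prems]]])
    obtain B where "\<And>x. \<bar>h x\<bar> \<le> B"
      using Cb_imp_bounded[OF Suc.prems] by (auto simp: bounded_iff)
    then show "bounded (range (dilation_mean j h))"
      using dilation_mean_bounded[of h B j] Ck_on_imp_continuous_on[OF Cb_imp_Ck_on[OF Suc.prems]]
      by (auto simp: bounded_iff)
    show "Cb k (\<lambda>x. fst v * dilation_mean (Suc j) (\<lambda>x. frechet_derivative h (at x) (1, 0)) x
       + snd v * dilation_mean j (\<lambda>x. frechet_derivative h (at x) (0, 1)) x)" for v
      using Cb_add[OF Cb_scaleR Cb_scaleR, OF Suc.IH Suc.IH,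
          OF Cb_Suc_frechet_derivative Cb_Suc_frechet_derivative, OF Suc.prems Suc.prems]
      by simp
  qed
qed

subsection \<open>Whitney's theorem on even functions\<close>

abbreviation pd1 :: "(real \<times> real \<Rightarrow> 'a::real_normed_vector) \<Rightarrow> real \<times> real \<Rightarrow> 'a" where
  "pd1 h x \<equiv> frechet_derivative h (at x) (1, 0)"

abbreviation pd2 :: "(real \<times> real \<Rightarrow> 'a::real_normed_vector) \<Rightarrow> real \<times> real \<Rightarrow> 'a" where
  "pd2 h x \<equiv> frechet_derivative h (at x) (0, 1)"

lemma Cb_obtain_bound:
  fixes h :: "'a::real_normed_vector \<Rightarrow> real"
  assumes "Cb k h"
  obtains B where "\<And>x. \<bar>h x\<bar> \<le> B"
proof -
  obtain B where "\<forall>y\<in>range h. norm y \<le> B"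
    using Cb_imp_bounded[OF assms] unfolding bounded_iff by blast
  then have "\<bar>h x\<bar> \<le> B" for x
    by simp
  then show thesis
    by (rule that)
qed

lemma has_vector_derivative_pd1:
  assumes "(h has_derivative frechet_derivative h (at (p, q))) (at (p, q))"
  shows "((\<lambda>p. h (p, q)) has_vector_derivative pd1 h (p, q)) (at p)"
proof -
  have "((\<lambda>p. h (p, q)) has_derivative (\<lambda>v. frechet_derivative h (at (p, q)) (v, 0))) (at p)"
    by (rule has_derivative_compose[where f="\<lambda>p. (p, q)" and g=h,
          OF has_derivative_Pair[OF has_derivative_ident has_derivative_const] assms])
  moreover have "frechet_derivative h (at (p, q)) (v, 0) = v *\<^sub>R pd1 h (p, q)" for v
    using linear_scale[OF has_derivative_linear[OF assms], of v "(1, 0)"]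
    unfolding scaleR_Pair real_scaleR_def mult_1_right mult_zero_right .
  ultimately show ?thesis
    unfolding has_vector_derivative_def by (rule has_derivative_eq_rhs[OF _ ext])
qed

lemma has_vector_derivative_pd2:
  assumes "(h has_derivative frechet_derivative h (at (p, q))) (at (p, q))"
  shows "((\<lambda>q. h (p, q)) has_vector_derivative pd2 h (p, q)) (at q)"
proof -
  have "((\<lambda>q. h (p, q)) has_derivative (\<lambda>v. frechet_derivative h (at (p, q)) (0, v))) (at q)"
    by (rule has_derivative_compose[where f="\<lambda>q. (p, q)" and g=h,
          OF has_derivative_Pair[OF has_derivative_const has_derivative_ident] assms])
  moreover have "frechet_derivative h (at (p, q)) (0, v) = v *\<^sub>R pd2 h (p, q)" for v
    using linear_scale[OF has_derivative_linear[OF assms], of v "(0, 1)"]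
    unfolding scaleR_Pair real_scaleR_def mult_1_right mult_zero_right .
  ultimately show ?thesis
    unfolding has_vector_derivative_def by (rule has_derivative_eq_rhs[OF _ ext])
qed

text \<open>Hadamard's lemma: the fundamental theorem of calculus on the segment from (0, q) to (p,
  q).\<close>

lemma dilation_mean_hadamard:
  assumes "Ck_on (Suc 0) UNIV h"
  shows "h x = h (0, snd x) + fst x * dilation_mean 0 (pd1 h) x"
proof -
  have dh: "(h has_derivative frechet_derivative h (at y)) (at y)" for y
    using Ck_on_Suc_has_derivative[OF assms] by simp
  have 1: "((\<lambda>t. h (t * fst x, snd x)) has_vector_derivative fst x * pd1 h (t * fst x, snd x)) (at t)" for t
  proof -
    have "((\<lambda>p. h (p, snd x)) has_real_derivative pd1 h (t * fst x, snd x)) (at (t * fst x))"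
      using has_vector_derivative_pd1[OF dh] by (simp add: has_real_derivative_iff_has_vector_derivative)
    from DERIV_chain2[OF this DERIV_cmult_right[OF DERIV_ident]] show ?thesis
      by (simp add: has_real_derivative_iff_has_vector_derivative mult.commute)
  qed
  have "((\<lambda>t. fst x * pd1 h (t * fst x, snd x)) has_integral
      h (1 * fst x, snd x) - h (0 * fst x, snd x)) {0..1}"
    by (rule fundamental_theorem_of_calculus) (auto intro: has_vector_derivative_at_within[OF 1])
  then have "h x - h (0, snd x) = integral {0..1} (\<lambda>t. fst x * pd1 h (t * fst x, snd x))"
    by (simp add: integral_unique del: integral_mult_right)
  then show ?thesis
    by (simp add: dilation_mean_def)
qed

text \<open>The mean of t^j is 1 / (j + 1); this is the origin of the factors 1/2 and 1/3 in
  \<open>cuspidal_decomposition\<close>.\<close>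

lemma dilation_mean_axis: "dilation_mean j h (0, q) = h (0, q) / real (Suc j)"
proof -
  have "integral {0..1} (\<lambda>t::real. t ^ j) = 1 / real (Suc j)"
  proof (rule integral_unique)
    have "((\<lambda>t::real. t ^ j) has_integral (1 ^ Suc j / real (Suc j) - 0 ^ Suc j / real (Suc j))) {0..1}"
    proof (rule fundamental_theorem_of_calculus)
      fix t :: real
      have "((\<lambda>t. t ^ Suc j / real (Suc j)) has_real_derivative t ^ j) (at t within {0..1})"
        using DERIV_cdivide[OF DERIV_pow[of "Suc j" t "{0..1}"], of "real (Suc j)"]
        by (simp del: of_nat_Suc)
      then show "((\<lambda>t. t ^ Suc j / real (Suc j)) has_vector_derivative t ^ j) (at t within {0..1})"
        by (simp add: has_real_derivative_iff_has_vector_derivative)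
    qed simp
    then show "((\<lambda>t::real. t ^ j) has_integral 1 / real (Suc j)) {0..1}"
      by (simp del: of_nat_Suc)
  qed
  then show ?thesis
    by (simp add: dilation_mean_def)
qed

definition even_fst :: "(real \<times> real \<Rightarrow> real) \<Rightarrow> bool" where
  "even_fst h \<longleftrightarrow> (\<forall>p q. h (- p, q) = h (p, q))"

text \<open>Applied with c = 1 and c = -1: differentiation in the first variable exchanges even and
  odd, differentiation in the second keeps the parity.\<close>

lemma frechet_derivative_reflect:
  fixes h :: "real \<times> real \<Rightarrow> real"
  assumes "\<And>x. (h has_derivative frechet_derivative h (at x)) (at x)"
    and "\<And>p q. h (- p, q) = c * h (p, q)"
  shows "pd1 h (- p, q) = - c * pd1 h (p, q)" "pd2 h (- p, q) = c * pd2 h (p, q :: real)"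
proof -
  let ?D = "frechet_derivative h (at (- p, q))"
  have "((\<lambda>x. h (- fst x, snd x)) has_derivative (\<lambda>v. ?D (- fst v, snd v))) (at (p, q))"
    by (rule has_derivative_compose[of "\<lambda>x. (- fst x, snd x)" "\<lambda>v. (- fst v, snd v)" "(p, q)" UNIV h ?D])
      (auto intro!: derivative_eq_intros assms(1))
  moreover have "(\<lambda>x. h (- fst x, snd x)) = (\<lambda>x. c * h x)"
    using assms(2) by auto
  ultimately have "((\<lambda>x. c * h x) has_derivative (\<lambda>v. ?D (- fst v, snd v))) (at (p, q))"
    by simp
  from has_derivative_unique[OF this has_derivative_mult_right[OF assms(1)]]
  have *: "?D (- fst v, snd v) = c * frechet_derivative h (at (p, q)) v" for v
    by metis
  show "pd2 h (- p, q) = c * pd2 h (p, q)"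
    using *[of "(0, 1)"] by simp
  show "pd1 h (- p, q) = - c * pd1 h (p, q)"
    using *[of "(1, 0)"] linear_neg[OF has_derivative_linear[OF assms(1)], of "(- p, q)" "(1, 0)"]
    by simp
qed

text \<open>For even h this is pd1 h / (2 p), that is, the derivative of h (sqrt s, q) in s at s =
  p^2. Averaging the second derivative makes it smooth across p = 0, where pd1 h vanishes by
  symmetry.\<close>

definition even_quot :: "(real \<times> real \<Rightarrow> real) \<Rightarrow> real \<times> real \<Rightarrow> real" where
  "even_quot h x = dilation_mean 0 (pd1 (pd1 h)) x / 2"

lemma even_quot_props:
  assumes "\<And>k. Cb k h" "even_fst h"
  shows "Cb k (even_quot h)" "even_fst (even_quot h)" "pd1 h x = 2 * fst x * even_quot h x"
    and "Cb k (pd2 h)" "even_fst (pd2 h)"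
proof -
  have pd: "Cb k (pd1 h)" "Cb k (pd2 h)" "Cb k (pd1 (pd1 h))" for k
    using assms(1) Cb_Suc_frechet_derivative by blast+
  then show "Cb k (pd2 h)"
    by blast
  have "Cb k (\<lambda>x. (1 / 2) *\<^sub>R dilation_mean 0 (pd1 (pd1 h)) x)"
    by (intro Cb_scaleR Cb_dilation_mean pd)
  then show "Cb k (even_quot h)"
    by (simp add: even_quot_def[abs_def])
  have dh: "(h has_derivative frechet_derivative h (at y)) (at y)"
    "(pd1 h has_derivative frechet_derivative (pd1 h) (at y)) (at y)" for y
    using Cb_Suc_has_derivative[OF assms(1)] Cb_Suc_has_derivative[OF pd(1)] by blast+
  have r1: "pd1 h (- p, q) = - 1 * pd1 h (p, q)" and r2: "pd2 h (- p, q) = 1 * pd2 h (p, q)" for p q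
    using frechet_derivative_reflect[OF dh(1), of 1 p q] assms(2) by (auto simp: even_fst_def)
  have r3: "pd1 (pd1 h) (- p, q) = pd1 (pd1 h) (p, q)" for p q
    using frechet_derivative_reflect(1)[OF dh(2) r1] by simp
  show "even_fst (pd2 h)"
    using r2 by (simp add: even_fst_def)
  show "even_fst (even_quot h)"
    using r3 by (simp add: even_fst_def even_quot_def dilation_mean_def)
  have "pd1 h (0, snd x) = 0"
    using r1[of 0] by simp
  then show "pd1 h x = 2 * fst x * even_quot h x"
    using dilation_mean_hadamard[OF Cb_imp_Ck_on[OF pd(1)], of x] by (simp add: even_quot_def)
qed

text \<open>L'Hopital's rule, to be applied where a function and its reflection are glued
  together.\<close>

lemma has_real_derivative_extend:
  fixes u v :: "real \<Rightarrow> real"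
  assumes "\<And>s. s \<noteq> 0 \<Longrightarrow> (u has_real_derivative v s) (at s)" "isCont u 0" "isCont v 0"
  shows "(u has_real_derivative v 0) (at 0)"
proof -
  have "((\<lambda>s. (u s - u 0) / s) \<longlongrightarrow> v 0) (at 0)"
  proof (rule lhopital)
    show "((\<lambda>s. u s - u 0) \<longlongrightarrow> 0) (at 0)"
      using assms(2) by (simp add: isCont_def LIM_zero_iff)
    show "\<forall>\<^sub>F s in at 0. ((\<lambda>s. u s - u 0) has_real_derivative v s) (at s)"
    proof -
      have "((\<lambda>s. u s - u 0) has_real_derivative v s) (at s)" if "s \<noteq> 0" for s
        using DERIV_diff[OF assms(1)[OF that] DERIV_const] by simp
      then show ?thesis
        by (auto simp: eventually_at_filter)
    qed
    show "((\<lambda>s. v s / 1) \<longlongrightarrow> v 0) (at 0)"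
      using assms(3) by (simp add: isCont_def)
  qed (auto simp: eventually_at_filter intro!: derivative_eq_intros tendsto_eq_intros)
  then show ?thesis
    by (simp add: has_field_derivative_iff)
qed

lemma has_derivative_of_continuous_partials:
  fixes f :: "real \<times> real \<Rightarrow> real"
  assumes "\<And>s q. ((\<lambda>s. f (s, q)) has_real_derivative f1 (s, q)) (at s)"
    and "\<And>s q. ((\<lambda>q. f (s, q)) has_real_derivative f2 (s, q)) (at q)"
    and "continuous_on UNIV f2"
  shows "(f has_derivative (\<lambda>v. fst v * f1 x + snd v * f2 x)) (at x)"
proof -
  obtain s q where x: "x = (s, q)"
    by (cases x)
  have "((\<lambda>(s, q). f (s, q)) has_derivative (\<lambda>(t1, t2). f1 (s, q) * t1 + blinfun_scaleR_left (f2 (s, q)) t2))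
      (at (s, q) within UNIV \<times> UNIV)"
  proof (rule has_derivative_partialsI)
    show "((\<lambda>s. f (s, q)) has_derivative (*) (f1 (s, q))) (at s)"
      using assms(1) by (simp add: has_field_derivative_def)
    show "((\<lambda>q. f (s, q)) has_derivative blinfun_apply (blinfun_scaleR_left (f2 (s, q)))) (at q)" for s q
      using assms(2)[of s q] by (simp add: has_field_derivative_def mult.commute[of _ "f2 (s, q)"])
    have "continuous_on UNIV (\<lambda>p. blinfun_scaleR_left (f2 p))"
      by (intro continuous_intros assms(3))
    then show "continuous (at (s, q) within UNIV \<times> UNIV) (\<lambda>(x, y). blinfun_scaleR_left (f2 (x, y)))"
      by (simp add: continuous_on_eq_continuous_at case_prod_unfold)
  qed auto
  then show ?thesis
    by (simp add: x case_prod_unfold mult.commute)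
qed

text \<open>The Seeley reflection of \<open>h (sqrt s, q)\<close> to \<open>s < 0\<close>. The weight exponent \<open>m\<close> counts derivatives: the
  \<open>s\<close>-derivative of \<open>whitney_ext m h\<close> is \<open>whitney_ext (Suc m) (even_quot h)\<close>.\<close>

definition whitney_ext :: "nat \<Rightarrow> (real \<times> real \<Rightarrow> real) \<Rightarrow> real \<times> real \<Rightarrow> real" where
  "whitney_ext m h x = (if 0 \<le> fst x then h (sqrt (fst x), snd x)
     else (\<Sum>n. seeley n * (- (2 ^ n)) ^ m * h (sqrt (- (2 ^ n) * fst x), snd x)))"

lemma seeley_series_bound:
  assumes "\<And>x. \<bar>h x\<bar> \<le> B"
  shows "norm (seeley n * (- (2 ^ n)) ^ m * h y) \<le> \<bar>seeley n * (- (2 ^ n)) ^ m\<bar> * B"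
  using assms[of y] by (simp add: abs_mult mult_left_mono)

lemma summable_seeley_bound: "summable (\<lambda>n. \<bar>seeley n * (- (2 ^ n)) ^ m\<bar> * B)"
  by (intro summable_mult2 summable_seeley)

text \<open>At s = 0 every dilate takes the value h (0, q), and the weights sum to 1 by
  \<open>suminf_seeley\<close>, so the two branches agree there.\<close>

lemma whitney_ext_continuous:
  assumes "Cb 0 h"
  shows "continuous_on UNIV (whitney_ext m h)"
proof -
  obtain B where B: "\<And>x. \<bar>h x\<bar> \<le> B"
    using Cb_obtain_bound[OF assms] by blast
  have ch: "continuous_on UNIV h"
    using assms by simp
  let ?P = "{x :: real \<times> real. 0 \<le> fst x}" and ?N = "{x :: real \<times> real. fst x \<le> 0}"
  let ?T = "\<lambda>n x. seeley n * (- (2 ^ n)) ^ m * h (sqrt (- (2 ^ n) * fst x), snd x)"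
  have "uniform_limit ?N (\<lambda>k x. \<Sum>n<k. ?T n x) (\<lambda>x. \<Sum>n. ?T n x) sequentially"
    by (rule Weierstrass_m_test[OF seeley_series_bound[OF B] summable_seeley_bound])
  then have "continuous_on ?N (\<lambda>x. \<Sum>n. ?T n x)"
  proof (rule uniform_limit_theorem[rotated])
    show "\<forall>\<^sub>F k in sequentially. continuous_on ?N (\<lambda>x. \<Sum>n<k. ?T n x)"
      by (intro always_eventually allI continuous_intros continuous_on_compose2[OF ch]) auto
  qed simp
  moreover have "continuous_on ?P (\<lambda>x. h (sqrt (fst x), snd x))"
    by (intro continuous_intros continuous_on_compose2[OF ch]) auto
  moreover have "(\<Sum>n. ?T n x) = h (sqrt (fst x), snd x)" if "fst x = 0" for x
  proof -
    have "summable (\<lambda>n. seeley n * (- (2 ^ n)) ^ m)"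
      by (rule summable_rabs_cancel[OF summable_seeley])
    from suminf_mult2[OF this, of "h (0, snd x)"] show ?thesis
      using that by (simp add: suminf_seeley)
  qed
  ultimately have "continuous_on (?P \<union> ?N) (\<lambda>x. if 0 \<le> fst x then h (sqrt (fst x), snd x) else \<Sum>n. ?T n x)"
    by (intro continuous_on_cases closed_Collect_le continuous_intros) auto
  moreover have "?P \<union> ?N = UNIV"
    by auto
  ultimately show ?thesis
    by (simp add: whitney_ext_def[abs_def])
qed

lemma whitney_ext_deriv2:
  assumes "\<And>k. Cb k h" 
  shows "((\<lambda>q. whitney_ext m h (s, q)) has_real_derivative whitney_ext m (pd2 h) (s, q)) (at q)"
proof -
  have d: "((\<lambda>q. h (p, q)) has_real_derivative pd2 h (p, q)) (at q)" for p q
    using has_vector_derivative_pd2[OF Cb_Suc_has_derivative[OF assms]]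
    by (simp add: has_real_derivative_iff_has_vector_derivative)
  show ?thesis
  proof (cases "0 \<le> s")
    case True
    then show ?thesis
      using d by (simp add: whitney_ext_def)
  next
    case False
    obtain B where B: "\<And>x. \<bar>h x\<bar> \<le> B"
      using Cb_obtain_bound[OF assms] by blast
    obtain B' where B': "\<And>x. \<bar>pd2 h x\<bar> \<le> B'"
      using Cb_obtain_bound[OF Cb_Suc_frechet_derivative[where v="(0, 1)", OF assms]] by blast
    have "((\<lambda>q. \<Sum>n. seeley n * (- (2 ^ n)) ^ m * h (sqrt (- (2 ^ n) * s), q)) has_real_derivative
        (\<Sum>n. seeley n * (- (2 ^ n)) ^ m * pd2 h (sqrt (- (2 ^ n) * s), q))) (at q)"
    proof (rule has_field_derivative_series'(2)[of UNIV _ _ q])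
      show "uniformly_convergent_on UNIV
          (\<lambda>k q. \<Sum>n<k. seeley n * (- (2 ^ n)) ^ m * pd2 h (sqrt (- (2 ^ n) * s), q))"
        by (rule Weierstrass_m_test'[OF seeley_series_bound[where h="pd2 h", OF B'] summable_seeley_bound])
      show "summable (\<lambda>n. seeley n * (- (2 ^ n)) ^ m * h (sqrt (- (2 ^ n) * s), q))"
        by (rule summable_comparison_test'[OF summable_seeley_bound seeley_series_bound[OF B]])
    qed (auto intro!: DERIV_cmult d)
    with False show ?thesis
      by (simp add: whitney_ext_def)
  qed
qed

text \<open>Differentiating the n-th dilate in s brings out the factor -(2^n), which raises the
  exponent m and so preserves the form of the series. At s = 0 the derivative is obtained from
  continuity of the function and of the candidate derivative.\<close>

lemma whitney_ext_deriv1: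
  assumes "\<And>k. Cb k h" "even_fst h"
  shows "((\<lambda>s. whitney_ext m h (s, q)) has_real_derivative whitney_ext (Suc m) (even_quot h) (s, q)) (at s)"
proof -
  note eq = even_quot_props[OF assms]
  have d: "((\<lambda>p. h (p, q)) has_real_derivative 2 * p * even_quot h (p, q)) (at p)" for p q
    using has_vector_derivative_pd1[OF Cb_Suc_has_derivative[OF assms(1)], of q p] eq(3)[of "(p, q)"]
    by (simp add: has_real_derivative_iff_has_vector_derivative)
  \<comment> \<open>The factor 2 p in front of \<open>even_quot\<close>, taken at p = sqrt (c s),
    cancels the denominator of the derivative of the square root, so nothing singular is left at s =
    0.\<close>
  have dsqrt: "((\<lambda>s. h (sqrt (c * s), q)) has_real_derivative c * even_quot h (sqrt (c * s), q)) (at s)"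
    if "c * s > 0" for c s
  proof -
    have "((\<lambda>s. sqrt (c * s)) has_real_derivative c * (inverse (sqrt (c * s)) / 2)) (at s)"
      using that by (auto intro!: derivative_eq_intros)
    note D = DERIV_chain2[OF d this]
    define r where "r = sqrt (c * s)"
    have D: "((\<lambda>s. h (sqrt (c * s), q)) has_real_derivative
        2 * r * even_quot h (r, q) * (c * (inverse r / 2))) (at s)"
      unfolding r_def by (rule D)
    have "r \<noteq> 0"
      using that by (auto simp: r_def)
    then have "2 * r * even_quot h (r, q) * (c * (inverse r / 2)) = c * even_quot h (r, q)"
      by simp
    with D have "((\<lambda>s. h (sqrt (c * s), q)) has_real_derivative c * even_quot h (r, q)) (at s)"
      by (simp only:)
    then show ?thesis
      by (simp only: r_def)
  qed
  have off0: "((\<lambda>s. whitney_ext m h (s, q)) has_real_derivative whitney_ext (Suc m) (even_quot h) (s, q)) (at s)"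
    if "s \<noteq> 0" for s
  proof (cases "0 < s")
    case True
    have "((\<lambda>s. h (sqrt s, q)) has_real_derivative even_quot h (sqrt s, q)) (at s)"
      using dsqrt[of 1 s] True by simp
    then have "((\<lambda>s. whitney_ext m h (s, q)) has_real_derivative even_quot h (sqrt s, q)) (at s)"
      by (rule has_field_derivative_transform_within_open[where S="{0<..}"])
        (use True in \<open>auto simp: whitney_ext_def\<close>)
    with True show ?thesis
      by (simp add: whitney_ext_def)
  next
    case False
    with that have "s < 0"
      by simp
    obtain B where B: "\<And>x. \<bar>h x\<bar> \<le> B"
      using Cb_obtain_bound[OF assms(1)] by blast
    obtain B' where B': "\<And>x. \<bar>even_quot h x\<bar> \<le> B'"
      using Cb_obtain_bound[OF eq(1)] by blast
    have "((\<lambda>s. \<Sum>n. seeley n * (- (2 ^ n)) ^ m * h (sqrt (- (2 ^ n) * s), q)) has_real_derivative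
        (\<Sum>n. seeley n * (- (2 ^ n)) ^ Suc m * even_quot h (sqrt (- (2 ^ n) * s), q))) (at s)"
    proof (rule has_field_derivative_series'(2)[of "{..<0}" _ _ s])
      show "uniformly_convergent_on {..<0}
          (\<lambda>k s. \<Sum>n<k. seeley n * (- (2 ^ n)) ^ Suc m * even_quot h (sqrt (- (2 ^ n) * s), q))"
        by (rule Weierstrass_m_test'[OF seeley_series_bound[where h="even_quot h", OF B'] summable_seeley_bound])
      show "summable (\<lambda>n. seeley n * (- (2 ^ n)) ^ m * h (sqrt (- (2 ^ n) * s), q))"
        by (rule summable_comparison_test'[OF summable_seeley_bound seeley_series_bound[OF B]])
      show "((\<lambda>s. seeley n * (- (2 ^ n)) ^ m * h (sqrt (- (2 ^ n) * s), q)) has_real_derivative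
          seeley n * (- (2 ^ n)) ^ Suc m * even_quot h (sqrt (- (2 ^ n) * s), q)) (at s within {..<0})"
        if "s \<in> {..<0}" for n s
      proof -
        have "- (2 ^ n) * s > 0"
          using that by (simp add: mult_pos_neg)
        from DERIV_cmult[OF dsqrt[OF this], of "seeley n * (- (2 ^ n)) ^ m"]
        have "((\<lambda>s. seeley n * (- (2 ^ n)) ^ m * h (sqrt (- (2 ^ n) * s), q)) has_real_derivative
          seeley n * (- (2 ^ n)) ^ Suc m * even_quot h (sqrt (- (2 ^ n) * s), q)) (at s)"
          by (simp only: power_Suc mult_ac)
        then show ?thesis
          by (rule has_field_derivative_at_within)
      qed
    qed (use \<open>s < 0\<close> in \<open>auto simp: interior_open\<close>)
    then have "((\<lambda>s. whitney_ext m h (s, q)) has_real_derivative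
        (\<Sum>n. seeley n * (- (2 ^ n)) ^ Suc m * even_quot h (sqrt (- (2 ^ n) * s), q))) (at s)"
      by (rule has_field_derivative_transform_within_open[where S="{..<0}"])
        (use \<open>s < 0\<close> in \<open>auto simp: whitney_ext_def\<close>)
    with \<open>s < 0\<close> show ?thesis
      by (simp add: whitney_ext_def)
  qed
  have c: "isCont (\<lambda>s. whitney_ext j g (s, q)) 0" if "Cb 0 g" for j g
    using continuous_on_compose2[OF whitney_ext_continuous[OF that, of j], of UNIV "\<lambda>s. (s, q)"]
    by (auto intro!: continuous_intros simp: continuous_on_eq_continuous_at)
  show ?thesis
  proof (cases "s = 0")
    case True
    show ?thesis
      unfolding True by (rule has_real_derivative_extend[OF off0 c[OF assms(1)] c[OF eq(1)]])
  qed (rule off0)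
qed

text \<open>Even functions with bounded derivatives are closed under \<open>even_quot\<close> and
  \<open>pd2\<close>, the operations that the two partial derivatives of the extension call for; so
  the induction stays in the class.\<close>

lemma whitney_ext_Ck:
  assumes "\<And>k. Cb k h" "even_fst h"
  shows "Ck_on k UNIV (whitney_ext m h)"
  using assms
proof (induction k arbitrary: h m)
  case 0
  then show ?case
    using whitney_ext_continuous[OF 0(1)] by simp
next
  case (Suc k)
  note eq = even_quot_props[OF Suc.prems]
  show ?case
  proof (rule Ck_on_SucI)
    show "(whitney_ext m h has_derivative (\<lambda>v. fst v * whitney_ext (Suc m) (even_quot h) x
        + snd v * whitney_ext m (pd2 h) x)) (at x)" for x
      by (rule has_derivative_of_continuous_partials[OF whitney_ext_deriv1[OF Suc.prems]
            whitney_ext_deriv2[OF Suc.prems(1)] whitney_ext_continuous[OF eq(4)]])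
    show "Ck_on k UNIV (\<lambda>x. fst v * whitney_ext (Suc m) (even_quot h) x
        + snd v * whitney_ext m (pd2 h) x)" for v :: "real \<times> real"
      by (intro Ck_on_add Ck_on_mult Ck_on_const open_UNIV Suc.IH[OF eq(1,2)] Suc.IH[OF eq(4,5)])
  qed simp
qed

lemma whitney_even:
  assumes "\<And>k. Cb k h" "even_fst h"
  obtains K where "smooth_on UNIV K" "\<And>p q. h (p, q) = K (p\<^sup>2, q)"
proof
  show "smooth_on UNIV (whitney_ext 0 h)"
    using whitney_ext_Ck[OF assms] by (simp add: smooth_on_def)
  show "h (p, q) = whitney_ext 0 h (p\<^sup>2, q)" for p q
    using assms(2) by (auto simp: whitney_ext_def even_fst_def abs_if)
qed

text \<open>Split the smooth quotient \<open>(h (p, q) - h (0, q)) / p\<^sup>2\<close> into its even and odd parts.\<close>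

lemma cuspidal_decomposition:
  assumes "\<And>k. Cb k g" "\<And>q. pd1 g (0, q) = 0"
  obtains A B \<eta> where "smooth_on UNIV A" "smooth_on UNIV B" "\<And>k. Cb k \<eta>"
    "\<And>x. pd1 g x = fst x * \<eta> x" "A (0, 0) = \<eta> (0, 0) / 2" "B (0, 0) = pd1 \<eta> (0, 0) / 3"
    "\<And>p q. g (p, q) = g (0, q) + p\<^sup>2 * A (p\<^sup>2, q) + p ^ 3 * B (p\<^sup>2, q)"
proof -
  have pd: "Cb k (pd1 g)" "Cb k (pd1 (pd1 g))" for k
    using assms(1) Cb_Suc_frechet_derivative by blast+
  define \<eta> where "\<eta> = dilation_mean 0 (pd1 (pd1 g))"
  have \<eta>_Cb: "Cb k \<eta>" for k
    unfolding \<eta>_def by (intro Cb_dilation_mean pd)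
  have pd1_g: "pd1 g x = fst x * \<eta> x" for x
    using dilation_mean_hadamard[OF Cb_imp_Ck_on[OF pd(1)], of x] assms(2) by (simp add: \<eta>_def)
  \<comment> \<open>Substituting pd1 g = p \<eta> into Hadamard's formula gives g (p, q) - g (0, q)
    = p^2 r (p, q); the factor t of the dilated p becomes the weight t^1.\<close>
  define r where "r = dilation_mean 1 \<eta>"
  have r_Cb: "Cb k r" for k
    unfolding r_def by (intro Cb_dilation_mean \<eta>_Cb)
  have "(\<lambda>t. t ^ 0 * pd1 g (t * fst x, snd x)) = (\<lambda>t. fst x * (t ^ 1 * \<eta> (t * fst x, snd x)))" for x
    by (simp add: pd1_g mult_ac)
  then have "dilation_mean 0 (pd1 g) x = fst x * r x" for x
    unfolding dilation_mean_def r_def by (simp only: integral_mult_right)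
  then have g_r: "g x = g (0, snd x) + (fst x)\<^sup>2 * r x" for x
    using dilation_mean_hadamard[OF Cb_imp_Ck_on[OF assms(1)], of x]
    by (simp add: power2_eq_square)
  \<comment> \<open>\<open>e\<close> is the even part of r. \<open>o'\<close> is the odd part
    divided by p: it averages Hadamard's quotient \<open>d\<close> over p and -p, since r (p, q) = r
    (0, q) + p d (p, q).\<close>
  define e where "e x = (1 / 2) *\<^sub>R (r x + r (- fst x, snd x))" for x
  define d where "d = dilation_mean 0 (pd1 r)"
  define o' where "o' x = (1 / 2) *\<^sub>R (d x + d (- fst x, snd x))" for x
  have lin: "bounded_linear (\<lambda>x :: real \<times> real. (- fst x, snd x))"
    by (intro bounded_linear_Pair bounded_linear_minus bounded_linear_fst bounded_linear_snd)
  have d_Cb: "Cb k d" for k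
    unfolding d_def by (intro Cb_dilation_mean Cb_Suc_frechet_derivative r_Cb)
  have "Cb k e" "Cb k o'" for k
    unfolding e_def o'_def
    by (intro Cb_scaleR Cb_add r_Cb d_Cb Cb_compose_linear[OF lin])+
  moreover have "even_fst e" "even_fst o'"
    by (simp_all add: even_fst_def e_def o'_def add.commute)
  ultimately obtain A B where A: "smooth_on UNIV A" "\<And>p q. e (p, q) = A (p\<^sup>2, q)"
    and B: "smooth_on UNIV B" "\<And>p q. o' (p, q) = B (p\<^sup>2, q)"
    using whitney_even[of e] whitney_even[of o'] by metis
  have "r (p, q) = e (p, q) + p * o' (p, q)" for p q
    using dilation_mean_hadamard[OF Cb_imp_Ck_on[OF r_Cb], of "(p, q)"]
      dilation_mean_hadamard[OF Cb_imp_Ck_on[OF r_Cb], of "(- p, q)"]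
    by (simp add: e_def o'_def d_def algebra_simps)
  then have "g (p, q) = g (0, q) + p\<^sup>2 * A (p\<^sup>2, q) + p ^ 3 * B (p\<^sup>2, q)" for p q
    using g_r[of "(p, q)"] A(2) B(2) by (simp add: algebra_simps power2_eq_square power3_eq_cube)
  moreover have "A (0, 0) = \<eta> (0, 0) / 2"
    using A(2)[of 0 0] by (simp add: e_def r_def dilation_mean_axis)
  moreover have "B (0, 0) = pd1 \<eta> (0, 0) / 3"
  proof -
    have "frechet_derivative r (at (0, 0)) = (\<lambda>v. fst v * dilation_mean (Suc 1) (pd1 \<eta>) (0, 0)
        + snd v * dilation_mean 1 (pd2 \<eta>) (0, 0))"
      unfolding r_def by (rule frechet_derivative_at[symmetric, OF dilation_mean_has_derivative[OF Cb_imp_Ck_on[OF \<eta>_Cb]]])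
    then show ?thesis
      using B(2)[of 0 0] by (simp add: o'_def d_def dilation_mean_axis)
  qed
  ultimately show thesis
    using that[OF A(1) B(1) \<eta>_Cb pd1_g] by blast
qed

subsection \<open>A criterion for cuspidal edges\<close>

text \<open>A continuous periodic function takes all its values on one compact period square, and
  derivatives inherit the periods.\<close>

lemma Cb_periodic:
  fixes h :: "real \<times> real \<Rightarrow> 'b::real_normed_vector"
  assumes "Ck_on k UNIV h" "\<And>p q. h (p + 2 * pi, q) = h (p, q)" "\<And>p q. h (p, q + 2 * pi) = h (p, q)"
  shows "Cb k h"
proof -
  have bounded: "bounded (range h)"
    if "continuous_on UNIV h" and per: "\<And>p q. h (p + 2 * pi, q) = h (p, q)" "\<And>p q. h (p, q + 2 * pi) = h (p, q)"
    for h :: "real \<times> real \<Rightarrow> 'b"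
  proof -
    let ?K = "cbox (0, 0) (2 * pi, 2 * pi)"
    have red: "\<exists>n::int. x + of_int n * (2 * pi) \<in> {0..2 * pi}" for x
    proof
      have "of_int \<lfloor>x / (2 * pi)\<rfloor> * (2 * pi) \<le> x" "x \<le> (of_int \<lfloor>x / (2 * pi)\<rfloor> + 1) * (2 * pi)"
        using of_int_floor_le[of "x / (2 * pi)"] real_of_int_floor_add_one_ge[of "x / (2 * pi)"]
        by (simp_all only: pos_le_divide_eq pos_divide_le_eq mult_pos_pos[OF zero_less_numeral pi_gt_zero])
      then show "x + of_int (- \<lfloor>x / (2 * pi)\<rfloor>) * (2 * pi) \<in> {0..2 * pi}"
        by (simp add: algebra_simps)
    qed
    have "h (p, q) \<in> h ` ?K" for p q
    proof -
      obtain m n :: int where mn: "p + of_int m * (2 * pi) \<in> {0..2 * pi}" "q + of_int n * (2 * pi) \<in> {0..2 * pi}"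
        using red by blast
      interpret P: periodic_fun_simple "\<lambda>p. h (p, q)" "2 * pi"
        by unfold_locales (rule per)
      interpret Q: periodic_fun_simple "\<lambda>q. h (p + of_int m * (2 * pi), q)" "2 * pi"
        by unfold_locales (rule per)
      have "h (p, q) = h (p + of_int m * (2 * pi), q + of_int n * (2 * pi))"
        using P.plus_of_int[of p m] Q.plus_of_int[of q n] by simp
      moreover have "(p + of_int m * (2 * pi), q + of_int n * (2 * pi)) \<in> ?K"
        using mn by (simp add: mem_box cbox_Pair_eq)
      ultimately show ?thesis
        by blast
    qed
    then have "range h \<subseteq> h ` ?K"
      by auto
    moreover have "compact (h ` ?K)"
      by (intro compact_continuous_image continuous_on_subset[OF that(1)]) auto
    ultimately show ?thesis
      using bounded_subset compact_imp_bounded by blast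
  qed
  show ?thesis
    using assms
  proof (induction k arbitrary: h)
    case 0
    then show ?case
      using bounded[of h] by simp
  next
    case (Suc k)
    let ?D = "\<lambda>x. frechet_derivative h (at x)"
    have d: "(h has_derivative ?D x) (at x)" for x
      using Ck_on_Suc_has_derivative[OF Suc.prems(1)] by simp
    have shift: "?D (x + c) = ?D x" if "\<And>x. h (x + c) = h x" for x c
    proof -
      have "((\<lambda>x. h (x + c)) has_derivative ?D (x + c)) (at x)"
        by (rule has_derivative_compose[where f="\<lambda>x. x + c" and g=h, OF _ d])
          (auto intro!: derivative_eq_intros)
      then have "(h has_derivative ?D (x + c)) (at x)"
        by (simp add: that)
      then show ?thesis
        using d has_derivative_unique by blast
    qed
    have "h (x + (2 * pi, 0)) = h x" "h (x + (0, 2 * pi)) = h x" for x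
      using Suc.prems(2,3)[of "fst x" "snd x"] by (cases x; simp)+
    then have sh: "?D (p + 2 * pi, q) = ?D (p, q)" "?D (p, q + 2 * pi) = ?D (p, q)" for p q
      using shift[of "(2 * pi, 0)" "(p, q)"] shift[of "(0, 2 * pi)" "(p, q)"] by simp_all
    show ?case
    proof (rule Cb_SucI[OF _ d])
      show "bounded (range h)"
        by (rule bounded[OF Ck_on_imp_continuous_on[OF Suc.prems(1)] Suc.prems(2,3)])
      show "Cb k (\<lambda>x. ?D x v)" for v
        by (rule Suc.IH[OF Ck_on_Suc_frechet_derivative[OF Suc.prems(1)]]) (simp_all add: sh)
    qed
  qed
qed

lemma smooth_diffeo_inv:
  assumes "smooth_diffeo U V \<phi>"
  shows "smooth_diffeo V U (inv_into U \<phi>)"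
proof -
  have bij: "bij_betw \<phi> U V" and o: "open U" "open V" and s: "smooth_on U \<phi>" "smooth_on V (inv_into U \<phi>)"
    using assms by (auto simp: smooth_diffeo_def)
  have "inv_into V (inv_into U \<phi>) x = \<phi> x" if "x \<in> U" for x
    using inv_into_inv_into_eq[OF bij that] .
  then have "smooth_on U (inv_into V (inv_into U \<phi>))"
    using s(1) Ck_on_transform[OF _ o(1)] unfolding smooth_on_def by blast
  then show ?thesis
    using bij_betw_inv_into[OF bij] o s by (simp add: smooth_diffeo_def)
qed

lemma smooth_diffeoI:
  assumes "open U" "open V" "smooth_on U \<phi>" "smooth_on V \<psi>"
    and "\<And>x. x \<in> U \<Longrightarrow> \<phi> x \<in> V \<and> \<psi> (\<phi> x) = x" "\<And>y. y \<in> V \<Longrightarrow> \<psi> y \<in> U \<and> \<phi> (\<psi> y) = y"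
  shows "smooth_diffeo U V \<phi>"
proof -
  have bij: "bij_betw \<phi> U V"
    by (rule bij_betw_byWitness[where f'=\<psi>]) (use assms(5,6) in auto)
  have "inv_into U \<phi> y = \<psi> y" if "y \<in> V" for y
    using assms(5,6) that bij by (metis bij_betw_def inv_into_f_f)
  then have "smooth_on V (inv_into U \<phi>)"
    using assms(4) Ck_on_transform[OF _ assms(2)] unfolding smooth_on_def by blast
  with bij assms show ?thesis
    by (simp add: smooth_diffeo_def)
qed

text \<open>Alternation discards the multiple of u in the second slot. Both the Taylor coefficients
  at a cuspidal edge and the moving frame produce vectors of this triangular shape.\<close>

lemma det3_alt:
  "det3 (a *\<^sub>R u) (b *\<^sub>R u + c *\<^sub>R v) (d *\<^sub>R w) = a * c * d * det3 u v w"
proof -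
  have "det3 u u w = 0"
    by (simp add: det3_def algebra_simps)
  then show ?thesis
    by (simp add: det3_linear)
qed

lemma smooth_on_compose:
  fixes f :: "'a::real_normed_vector \<Rightarrow> 'b::euclidean_space"
  shows "open S \<Longrightarrow> open T \<Longrightarrow> smooth_on T g \<Longrightarrow> smooth_on S f \<Longrightarrow> f ` S \<subseteq> T
    \<Longrightarrow> smooth_on S (\<lambda>x. g (f x))"
  unfolding smooth_on_def using Ck_on_compose by blast

text \<open>The map is N (u, v, q) = g (0, q) + u A (u, q) + v B (u, q). Writing b = p \<beta>, its
  derivative at the origin has the columns A, B, g_q with 2 A = \<beta> \<xi> and 3 B = \<beta>
  \<xi>_p + \<beta>_p \<xi>; the determinant is therefore \<beta>^2 / 6 times that of \<xi>,
  \<xi>_p, g_q.\<close>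

lemma cuspidal_edge_normal_form:
  fixes g :: "real \<times> real \<Rightarrow> real \<times> real \<times> real"
  assumes "\<And>k. Cb k g" "\<And>x. pd1 g x = b x *\<^sub>R \<xi> x" "\<And>q. b (0, q) = 0"
    and "\<And>k. Ck_on k UNIV b" "\<And>k. Ck_on k UNIV \<xi>"
    and "pd1 b (0, 0) \<noteq> 0" "det3 (\<xi> (0, 0)) (pd1 \<xi> (0, 0)) (pd2 g (0, 0)) \<noteq> 0"
  obtains U V N where "smooth_diffeo U V N" "(0, 0, 0) \<in> U" "\<And>p q. g (p, q) = N (p\<^sup>2, p ^ 3, q)"
proof -
  have dg: "(g has_derivative frechet_derivative g (at x)) (at x)" for x
    using Cb_Suc_has_derivative[OF assms(1)] .
  have comp: "\<exists>A B \<eta>. smooth_on UNIV A \<and> smooth_on UNIV B \<and> (\<forall>k. Cb k \<eta>)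
     \<and> (\<forall>x. L (pd1 g x) = fst x * \<eta> x) \<and> A (0, 0) = \<eta> (0, 0) / 2 \<and> B (0, 0) = pd1 \<eta> (0, 0) / 3
     \<and> (\<forall>p q. L (g (p, q)) = L (g (0, q)) + p\<^sup>2 * A (p\<^sup>2, q) + p ^ 3 * B (p\<^sup>2, q))"
    if L: "bounded_linear L" for L :: "real \<times> real \<times> real \<Rightarrow> real"
  proof -
    have 1: "Cb k (\<lambda>x. L (g x))" for k
      by (rule Cb_bounded_linear[OF L assms(1)])
    have 2: "pd1 (\<lambda>x. L (g x)) x = L (pd1 g x)" for x
      using frechet_derivative_at[OF bounded_linear.has_derivative[OF L dg]] by metis
    have 3: "pd1 (\<lambda>x. L (g x)) (0, q) = 0" for q
      using assms(2,3) linear_0[OF bounded_linear.linear[OF L]] by (simp add: 2)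
    show ?thesis
      using cuspidal_decomposition[of "\<lambda>x. L (g x)", OF 1 3] unfolding 2 by metis
  qed
  have lin: "bounded_linear (fst :: real \<times> real \<times> real \<Rightarrow> real)"
    "bounded_linear (\<lambda>v :: real \<times> real \<times> real. fst (snd v))"
    "bounded_linear (\<lambda>v :: real \<times> real \<times> real. snd (snd v))"
    by (intro bounded_linear_fst bounded_linear_snd bounded_linear_compose[OF bounded_linear_fst]
        bounded_linear_compose[OF bounded_linear_snd])+
  obtain A1 B1 n1 where 1: "smooth_on UNIV A1" "smooth_on UNIV B1" "\<And>k. Cb k n1"
     "\<And>x. fst (pd1 g x) = fst x * n1 x" "A1 (0, 0) = n1 (0, 0) / 2" "B1 (0, 0) = pd1 n1 (0, 0) / 3"
     "\<And>p q. fst (g (p, q)) = fst (g (0, q)) + p\<^sup>2 * A1 (p\<^sup>2, q) + p ^ 3 * B1 (p\<^sup>2, q)"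
    using comp[OF lin(1)] by blast
  obtain A2 B2 n2 where 2: "smooth_on UNIV A2" "smooth_on UNIV B2" "\<And>k. Cb k n2"
     "\<And>x. fst (snd (pd1 g x)) = fst x * n2 x" "A2 (0, 0) = n2 (0, 0) / 2" "B2 (0, 0) = pd1 n2 (0, 0) / 3"
     "\<And>p q. fst (snd (g (p, q))) = fst (snd (g (0, q))) + p\<^sup>2 * A2 (p\<^sup>2, q) + p ^ 3 * B2 (p\<^sup>2, q)"
    using comp[OF lin(2)] by blast
  obtain A3 B3 n3 where 3: "smooth_on UNIV A3" "smooth_on UNIV B3" "\<And>k. Cb k n3"
     "\<And>x. snd (snd (pd1 g x)) = fst x * n3 x" "A3 (0, 0) = n3 (0, 0) / 2" "B3 (0, 0) = pd1 n3 (0, 0) / 3"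
     "\<And>p q. snd (snd (g (p, q))) = snd (snd (g (0, q))) + p\<^sup>2 * A3 (p\<^sup>2, q) + p ^ 3 * B3 (p\<^sup>2, q)"
    using comp[OF lin(3)] by blast
  define A where "A x = (A1 x, A2 x, A3 x)" for x
  define B where "B x = (B1 x, B2 x, B3 x)" for x
  define \<eta> where "\<eta> x = (n1 x, n2 x, n3 x)" for x
  have AB: "Ck_on k UNIV A" "Ck_on k UNIV B" for k
    unfolding A_def B_def using 1(1,2) 2(1,2) 3(1,2) by (auto simp: smooth_on_def intro!: Ck_on_Pair)
  have g: "g (p, q) = g (0, q) + p\<^sup>2 *\<^sub>R A (p\<^sup>2, q) + p ^ 3 *\<^sub>R B (p\<^sup>2, q)" for p q
    using 1(7)[of p q] 2(7)[of p q] 3(7)[of p q] by (simp add: prod_eq_iff A_def B_def)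
  have pd1_g: "b x *\<^sub>R \<xi> x = fst x *\<^sub>R \<eta> x" for x
    using 1(4)[of x] 2(4)[of x] 3(4)[of x] by (simp add: prod_eq_iff \<eta>_def assms(2))
  define \<beta> where "\<beta> = dilation_mean 0 (pd1 b)"
  have \<beta>_Ck: "Ck_on k UNIV \<beta>" for k
  proof -
    have "Ck_on k UNIV (\<lambda>x. integral {0..1} (\<lambda>t. t ^ 0 * pd1 b (t * fst x, snd x)))"
      using Ck_on_integral[OF open_UNIV dilation_mean_integrand_Ck[OF Ck_on_Suc_frechet_derivative[where v="(1, 0)", OF assms(4)], of k 0], of 0 1]
      unfolding fst_conv snd_conv .
    then show ?thesis
      unfolding \<beta>_def dilation_mean_def[abs_def] .
  qed
  have b: "b x = fst x * \<beta> x" for x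
    using dilation_mean_hadamard[OF assms(4), of x] assms(3) by (simp add: \<beta>_def)
  \<comment> \<open>Away from p = 0 the common factor p cancels; at p = 0 the identity holds as a
    limit.\<close>
  have \<eta>_eq: "\<eta> (p, 0) = \<beta> (p, 0) *\<^sub>R \<xi> (p, 0)" for p
  proof -
    have ax: "continuous_on UNIV (\<lambda>p::real. h (p, 0::real))" if "continuous_on UNIV h" for h :: "real \<times> real \<Rightarrow> 'c::topological_space"
      by (rule continuous_on_compose2[OF that]) (auto intro!: continuous_intros)
    have "continuous_on UNIV \<eta>"
      unfolding \<eta>_def using Ck_on_imp_continuous_on[OF Cb_imp_Ck_on] 1(3) 2(3) 3(3)
      by (intro continuous_on_Pair) blast+
    from ax[OF this] have "isCont (\<lambda>p. \<eta> (p, 0)) 0"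
      by (simp add: continuous_on_eq_continuous_at)
    then have l1: "((\<lambda>p. \<eta> (p, 0)) \<longlongrightarrow> \<eta> (0, 0)) (at 0)"
      by (simp add: isCont_def)
    have "continuous_on UNIV (\<lambda>x. \<beta> x *\<^sub>R \<xi> x)"
      by (intro continuous_intros Ck_on_imp_continuous_on[OF \<beta>_Ck] Ck_on_imp_continuous_on[OF assms(5)])
    from ax[OF this] have "isCont (\<lambda>p. \<beta> (p, 0) *\<^sub>R \<xi> (p, 0)) 0"
      by (simp add: continuous_on_eq_continuous_at)
    then have l2: "((\<lambda>p. \<beta> (p, 0) *\<^sub>R \<xi> (p, 0)) \<longlongrightarrow> \<beta> (0, 0) *\<^sub>R \<xi> (0, 0)) (at 0)"
      by (simp add: isCont_def)
    have off: "\<eta> (p, 0) = \<beta> (p, 0) *\<^sub>R \<xi> (p, 0)" if "p \<noteq> 0" for p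
    proof -
      have "p *\<^sub>R \<eta> (p, 0) = p *\<^sub>R (\<beta> (p, 0) *\<^sub>R \<xi> (p, 0))"
        using pd1_g[of "(p, 0)"] by (simp add: b)
      then show ?thesis
        using that by (metis scaleR_cancel_left)
    qed
    have "((\<lambda>p. \<eta> (p, 0)) \<longlongrightarrow> \<beta> (0, 0) *\<^sub>R \<xi> (0, 0)) (at 0)"
      by (rule Lim_transform_eventually[OF l2]) (auto simp: eventually_at_filter off)
    with l1 have "\<eta> (0, 0) = \<beta> (0, 0) *\<^sub>R \<xi> (0, 0)"
      by (rule LIM_unique)
    with off show ?thesis
      by (cases "p = 0") auto
  qed
  \<comment> \<open>Both sides of \<open>\<eta>_eq\<close> are differentiated along the axis q = 0;
    comparing the results determines B (0, 0).\<close>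
  have "((\<lambda>p. \<eta> (p, 0)) has_vector_derivative (pd1 n1 (0, 0), pd1 n2 (0, 0), pd1 n3 (0, 0))) (at 0)"
    unfolding \<eta>_def by (intro has_vector_derivative_Pair has_vector_derivative_pd1 Cb_Suc_has_derivative[OF 1(3)]
      Cb_Suc_has_derivative[OF 2(3)] Cb_Suc_has_derivative[OF 3(3)])
  then have d1: "((\<lambda>p. \<beta> (p, 0) *\<^sub>R \<xi> (p, 0)) has_vector_derivative 3 *\<^sub>R B (0, 0)) (at 0)"
    unfolding \<eta>_eq by (simp add: B_def 1(6) 2(6) 3(6))
  have "((\<lambda>p. \<beta> (p, 0)) has_real_derivative pd1 \<beta> (0, 0)) (at 0)"
    using has_vector_derivative_pd1[OF Ck_on_Suc_has_derivative[OF \<beta>_Ck UNIV_I]]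
    by (simp add: has_real_derivative_iff_has_vector_derivative)
  then have "((\<lambda>p. \<beta> (p, 0) *\<^sub>R \<xi> (p, 0)) has_vector_derivative
      \<beta> (0, 0) *\<^sub>R pd1 \<xi> (0, 0) + pd1 \<beta> (0, 0) *\<^sub>R \<xi> (0, 0)) (at 0)"
    by (rule has_vector_derivative_scaleR) (rule has_vector_derivative_pd1[OF Ck_on_Suc_has_derivative[OF assms(5) UNIV_I]])
  with d1 have B0: "3 *\<^sub>R B (0, 0) = \<beta> (0, 0) *\<^sub>R pd1 \<xi> (0, 0) + pd1 \<beta> (0, 0) *\<^sub>R \<xi> (0, 0)"
    by (rule vector_derivative_unique_at)
  have A0: "2 *\<^sub>R A (0, 0) = \<beta> (0, 0) *\<^sub>R \<xi> (0, 0)"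
    using \<eta>_eq[of 0] by (simp add: A_def \<eta>_def 1(5) 2(5) 3(5))
  have \<beta>0: "\<beta> (0, 0) \<noteq> 0"
    using assms(6) by (simp add: \<beta>_def dilation_mean_axis)
  define N where "N v = g (0, snd (snd v)) + fst v *\<^sub>R A (fst v, snd (snd v))
    + fst (snd v) *\<^sub>R B (fst v, snd (snd v))" for v :: "real \<times> real \<times> real"
  have c1: "Ck_on k UNIV (\<lambda>v :: real \<times> real \<times> real. (0, snd (snd v)))"
    "Ck_on k UNIV (\<lambda>v :: real \<times> real \<times> real. (fst v, snd (snd v)))"
    "Ck_on k UNIV (\<lambda>v :: real \<times> real \<times> real. fst v)"
    "Ck_on k UNIV (\<lambda>v :: real \<times> real \<times> real. fst (snd v))" for k
    by (intro Ck_on_Pair Ck_on_const Ck_on_snd Ck_on_fst Ck_on_id open_UNIV)+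
  have "Ck_on k UNIV N" for k
    unfolding N_def
    by (intro Ck_on_add Ck_on_scaleR open_UNIV c1
        Ck_on_compose[OF open_UNIV open_UNIV Cb_imp_Ck_on[OF assms(1)] c1(1) subset_UNIV]
        Ck_on_compose[OF open_UNIV open_UNIV AB(1) c1(2) subset_UNIV]
        Ck_on_compose[OF open_UNIV open_UNIV AB(2) c1(2) subset_UNIV])
  then have sN: "smooth_on UNIV N"
    by (simp add: smooth_on_def)
  have dN: "(N has_derivative frechet_derivative N (at 0)) (at (0, 0, 0))"
    using smooth_on_has_derivative[OF sN UNIV_I] by (simp add: zero_prod_def)
  have gen: "frechet_derivative N (at 0) c = w" if "((\<lambda>t. N (t *\<^sub>R c)) has_vector_derivative w) (at 0)" for c w
  proof -
    have "((\<lambda>t. N (t *\<^sub>R c)) has_derivative (\<lambda>t. frechet_derivative N (at 0) (t *\<^sub>R c))) (at 0)"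
      by (rule has_derivative_compose[where f="\<lambda>t. t *\<^sub>R c" and g=N])
        (use dN in \<open>auto intro!: derivative_eq_intros simp: zero_prod_def\<close>)
    from has_derivative_unique[OF this that[unfolded has_vector_derivative_def]]
    have "frechet_derivative N (at 0) (1 *\<^sub>R c) = 1 *\<^sub>R w"
      by (rule fun_cong)
    then show ?thesis
      by simp
  qed
  have N1: "frechet_derivative N (at 0) (1, 0, 0) = A (0, 0)"
  proof (rule gen)
    have "((\<lambda>t. t *\<^sub>R A (t, 0)) has_vector_derivative 0 *\<^sub>R pd1 A (0, 0) + 1 *\<^sub>R A (0, 0)) (at 0)"
      by (rule has_vector_derivative_scaleR[OF DERIV_ident has_vector_derivative_pd1[OF Ck_on_Suc_has_derivative[OF AB(1) UNIV_I]]])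
    from has_vector_derivative_add[OF has_vector_derivative_const this]
    show "((\<lambda>t. N (t *\<^sub>R (1, 0, 0))) has_vector_derivative A (0, 0)) (at 0)"
      by (simp add: N_def)
  qed
  have N2: "frechet_derivative N (at 0) (0, 1, 0) = B (0, 0)"
  proof (rule gen)
    have "((\<lambda>t. t *\<^sub>R B (0, 0)) has_vector_derivative 0 *\<^sub>R 0 + 1 *\<^sub>R B (0, 0)) (at 0)"
      by (rule has_vector_derivative_scaleR[OF DERIV_ident has_vector_derivative_const])
    from has_vector_derivative_add[OF has_vector_derivative_const this]
    show "((\<lambda>t. N (t *\<^sub>R (0, 1, 0))) has_vector_derivative B (0, 0)) (at 0)"
      by (simp add: N_def)
  qed
  have N3: "frechet_derivative N (at 0) (0, 0, 1) = pd2 g (0, 0)"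
  proof (rule gen)
    show "((\<lambda>t. N (t *\<^sub>R (0, 0, 1))) has_vector_derivative pd2 g (0, 0)) (at 0)"
      using has_vector_derivative_pd2[OF dg, of 0 0] by (simp add: N_def)
  qed
  have "det3 (2 *\<^sub>R A (0, 0)) (3 *\<^sub>R B (0, 0)) (1 *\<^sub>R pd2 g (0, 0)) \<noteq> 0"
    unfolding A0 B0 add.commute[of "\<beta> (0, 0) *\<^sub>R pd1 \<xi> (0, 0)"] det3_alt using \<beta>0 assms(7) by simp
  then have "det3 (A (0, 0)) (B (0, 0)) (pd2 g (0, 0)) \<noteq> 0"
    by (simp add: det3_linear)
  then obtain U V where "(0, 0, 0) \<in> U" "smooth_diffeo U V N"
    using smooth_inverse_function_R3[OF open_UNIV sN, of 0] N1 N2 N3 by (auto simp: zero_prod_def)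
  moreover have "g (p, q) = N (p\<^sup>2, p ^ 3, q)" for p q
    using g[of p q] by (simp add: N_def)
  ultimately show thesis
    using that by blast
qed


text \<open>The substitution \<open>x = x0 + r sin p\<close>, \<open>y = y0 + r sin q\<close> makes all functions periodic, so that they are
  defined on the whole plane and bounded together with their derivatives.\<close>

theorem cuspidal_edge_criterion:
  fixes f :: "real \<times> real \<Rightarrow> real \<times> real \<times> real"
  assumes "open S" "(x0, y0) \<in> S" "smooth_on S f" "smooth_on S b" "smooth_on S \<xi>"
    and "\<And>x. x \<in> S \<Longrightarrow> pd1 f x = b x *\<^sub>R \<xi> x"
    and "\<And>y. (x0, y) \<in> S \<Longrightarrow> b (x0, y) = 0" "pd1 b (x0, y0) \<noteq> 0"
    and "det3 (\<xi> (x0, y0)) (pd1 \<xi> (x0, y0)) (pd2 f (x0, y0)) \<noteq> 0"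
  shows "cuspidal_edge_at f (x0, y0)"
proof -
  obtain e where e: "e > 0" "ball (x0, y0) e \<subseteq> S"
    using assms(1,2) open_contains_ball by blast
  \<comment> \<open>Each coordinate moves by at most r, so the substitution stays within distance 2
    r < e of the base point.\<close>
  define r where "r = e / 3"
  have r: "r > 0"
    using e by (simp add: r_def)
  define \<sigma> where "\<sigma> z = (x0 + r * sin (fst z), y0 + r * sin (snd z))" for z :: "real \<times> real"
  have \<sigma>S: "\<sigma> z \<in> S" for z
  proof -
    have "dist (x0, y0) (\<sigma> z) = norm (r * sin (fst z), r * sin (snd z))"
      by (simp add: dist_norm \<sigma>_def norm_Pair)
    also have "\<dots> \<le> norm (r * sin (fst z)) + norm (r * sin (snd z))"
      by (rule norm_Pair_le)
    also have "\<dots> \<le> r * 1 + r * 1"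
      unfolding real_norm_def abs_mult using r by (intro add_mono mult_mono) auto
    also have "\<dots> < e"
      using e by (simp add: r_def)
    finally show ?thesis
      using e by auto
  qed
  have \<sigma>_Ck: "Ck_on k UNIV \<sigma>" for k
    unfolding \<sigma>_def
    by (intro Ck_on_Pair Ck_on_add Ck_on_mult Ck_on_const open_UNIV
        Ck_on_compose[OF open_UNIV open_UNIV Ck_on_sin _ subset_UNIV] Ck_on_fst Ck_on_snd Ck_on_id)
  have \<sigma>0: "\<sigma> (0, 0) = (x0, y0)"
    by (simp add: \<sigma>_def)
  have comp: "Ck_on k UNIV (\<lambda>z. h (\<sigma> z))" if "smooth_on S h" for h :: "real \<times> real \<Rightarrow> 'c::real_normed_vector" and k
    by (rule Ck_on_compose[OF open_UNIV assms(1) _ \<sigma>_Ck]) (use that \<sigma>S in \<open>auto simp: smooth_on_def\<close>)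
  have fd: "frechet_derivative (\<lambda>z. h (\<sigma> z)) (at z)
      = (\<lambda>v. (r * cos (fst z) * fst v) *\<^sub>R pd1 h (\<sigma> z) + (r * cos (snd z) * snd v) *\<^sub>R pd2 h (\<sigma> z))"
    if "smooth_on S h" for h :: "real \<times> real \<Rightarrow> 'c::real_normed_vector" and z
  proof -
    have dh: "(h has_derivative frechet_derivative h (at (\<sigma> z))) (at (\<sigma> z))"
      by (rule smooth_on_has_derivative[OF that \<sigma>S])
    have "(\<sigma> has_derivative (\<lambda>v. (r * cos (fst z) * fst v, r * cos (snd z) * snd v))) (at z)"
      unfolding \<sigma>_def by (auto intro!: derivative_eq_intros)
    from has_derivative_compose[OF this dh]
    have 1: "frechet_derivative (\<lambda>z. h (\<sigma> z)) (at z)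
        = (\<lambda>v. frechet_derivative h (at (\<sigma> z)) (r * cos (fst z) * fst v, r * cos (snd z) * snd v))"
      by (rule frechet_derivative_at[symmetric])
    have 2: "frechet_derivative h (at (\<sigma> z)) (a, c) = a *\<^sub>R pd1 h (\<sigma> z) + c *\<^sub>R pd2 h (\<sigma> z)" for a c
    proof -
      have "frechet_derivative h (at (\<sigma> z)) (a *\<^sub>R (1, 0) + c *\<^sub>R (0, 1)) = a *\<^sub>R pd1 h (\<sigma> z) + c *\<^sub>R pd2 h (\<sigma> z)"
        using has_derivative_linear[OF dh] by (simp only: linear_add linear_scale)
      then show ?thesis
        by simp
    qed
    show ?thesis
      unfolding 1 by (rule ext) (rule 2)
  qed
  define g where "g z = f (\<sigma> z)" for z
  \<comment> \<open>The chain-rule factor r cos p is put into the scalar coefficient, so that \<xi>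
    is merely composed with \<sigma>.\<close>
  define b' where "b' z = (r * cos (fst z)) * b (\<sigma> z)" for z
  define \<xi>' where "\<xi>' z = \<xi> (\<sigma> z)" for z
  have per: "\<sigma> (p + 2 * pi, q) = \<sigma> (p, q)" "\<sigma> (p, q + 2 * pi) = \<sigma> (p, q)" for p q
    by (simp_all add: \<sigma>_def)
  have g_Cb: "Cb k g" for k
    unfolding g_def by (rule Cb_periodic[OF comp[OF assms(3)]]) (simp_all add: per)
  have pd1_g: "pd1 g z = b' z *\<^sub>R \<xi>' z" for z
    unfolding g_def b'_def \<xi>'_def using fd[OF assms(3), of z] assms(6)[OF \<sigma>S, of z] by simp
  have b'0: "b' (0, q) = 0" for q
    using assms(7)[of "y0 + r * sin q"] \<sigma>S[of "(0, q)"] by (simp add: b'_def \<sigma>_def)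
  have cos_Ck: "Ck_on k UNIV (\<lambda>z :: real \<times> real. r * cos (fst z))" for k
    by (intro Ck_on_mult Ck_on_const open_UNIV
        Ck_on_compose[OF open_UNIV open_UNIV Ck_on_cos _ subset_UNIV] Ck_on_fst Ck_on_id)
  have b'_Ck: "Ck_on k UNIV b'" for k
    unfolding b'_def by (rule Ck_on_mult[OF open_UNIV cos_Ck comp[OF assms(4)]])
  have \<xi>'_Ck: "Ck_on k UNIV \<xi>'" for k
    unfolding \<xi>'_def by (rule comp[OF assms(5)])
  have "((\<lambda>z. b (\<sigma> z)) has_derivative frechet_derivative (\<lambda>z. b (\<sigma> z)) (at (0, 0))) (at (0, 0))"
    using Ck_on_Suc_has_derivative[OF comp[OF assms(4)] UNIV_I] .
  \<comment> \<open>The cosine has derivative 0 at 0, so only the derivative of b contributes to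
    that of \<open>b'\<close>.\<close>
  moreover have "((\<lambda>z :: real \<times> real. r * cos (fst z)) has_derivative (\<lambda>v. 0)) (at (0, 0))"
    by (auto intro!: derivative_eq_intros)
  ultimately have "(b' has_derivative (\<lambda>v. r * frechet_derivative (\<lambda>z. b (\<sigma> z)) (at (0, 0)) v)) (at (0, 0))"
    unfolding b'_def by (auto intro!: derivative_eq_intros)
  from fun_cong[OF frechet_derivative_at[OF this], of "(1, 0)", symmetric]
  have "pd1 b' (0, 0) = r * (r * pd1 b (x0, y0))"
    unfolding fd[OF assms(4)] \<sigma>0 by simp
  then have pd1_b': "pd1 b' (0, 0) \<noteq> 0"
    using assms(8) r by simp
  have "pd1 \<xi>' (0, 0) = r *\<^sub>R pd1 \<xi> (x0, y0)" "pd2 g (0, 0) = r *\<^sub>R pd2 f (x0, y0)"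
    unfolding \<xi>'_def g_def fd[OF assms(3)] fd[OF assms(5)] \<sigma>0 by simp_all
  then have det: "det3 (\<xi>' (0, 0)) (pd1 \<xi>' (0, 0)) (pd2 g (0, 0)) \<noteq> 0"
    using assms(9) r by (simp add: \<xi>'_def \<sigma>0 det3_linear)
  obtain U V N where N: "smooth_diffeo U V N" "(0, 0, 0) \<in> U" "\<And>p q. g (p, q) = N (p\<^sup>2, p ^ 3, q)"
    using cuspidal_edge_normal_form[OF g_Cb pd1_g b'0 b'_Ck \<xi>'_Ck pd1_b' det] by blast
  have oU: "open U" and bN: "bij_betw N U V"
    using N(1) by (auto simp: smooth_diffeo_def)
  \<comment> \<open>\<open>O'\<close> keeps p and q where arcsin inverts sin, and keeps (p^2, p^3,
    q) in the set U on which N is invertible.\<close>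
  define O' where "O' = ({-pi/2<..<pi/2} \<times> {-pi/2<..<pi/2}) \<inter> (\<lambda>z. ((fst z)\<^sup>2, fst z ^ 3, snd z)) -` U"
  have "open O'"
    unfolding O'_def
    by (intro open_Int open_Times open_greaterThanLessThan open_vimage[OF oU]) (intro continuous_intros)
  define Box where "Box = {x0 - r<..<x0 + r} \<times> {y0 - r<..<y0 + r}"
  have oBox: "open Box"
    unfolding Box_def by (intro open_Times open_greaterThanLessThan)
  define \<phi> where "\<phi> z = (arcsin ((fst z - x0) * inverse r), arcsin ((snd z - y0) * inverse r))" for z
  have *: "(t - c) * inverse r \<in> {-1<..<1}" if "t \<in> {c - r<..<c + r}" for t c
    using that r by (auto simp: field_simps)
  have arg: "fst z \<in> {x0 - r<..<x0 + r}" "snd z \<in> {y0 - r<..<y0 + r}" if "z \<in> Box" for z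
    using that by (auto simp: Box_def)
  have \<phi>_Ck: "Ck_on k Box \<phi>" for k
    unfolding \<phi>_def
  proof (intro Ck_on_Pair oBox)
    show "Ck_on k Box (\<lambda>z. arcsin ((fst z - x0) * inverse r))"
      by (rule Ck_on_compose[OF oBox open_greaterThanLessThan Ck_on_arcsin])
        (intro Ck_on_mult Ck_on_diff Ck_on_fst Ck_on_id Ck_on_const oBox, use *[OF arg(1)] in blast)
    show "Ck_on k Box (\<lambda>z. arcsin ((snd z - y0) * inverse r))"
      by (rule Ck_on_compose[OF oBox open_greaterThanLessThan Ck_on_arcsin])
        (intro Ck_on_mult Ck_on_diff Ck_on_snd Ck_on_id Ck_on_const oBox, use *[OF arg(2)] in blast)
  qed
  define U1 where "U1 = Box \<inter> \<phi> -` O'"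
  have "open U1"
    unfolding U1_def using continuous_open_preimage[OF Ck_on_imp_continuous_on[OF \<phi>_Ck] oBox \<open>open O'\<close>] .
  have rinv: "c + r * ((t - c) * inverse r) = t" for t c
    using r by (simp add: field_simps)
  have \<sigma>\<phi>: "\<sigma> (\<phi> z) = z" if "z \<in> Box" for z
    using *[OF arg(1)[OF that]] *[OF arg(2)[OF that]] rinv
    by (auto simp: \<sigma>_def \<phi>_def sin_arcsin prod_eq_iff)
  have \<phi>\<sigma>: "\<phi> (\<sigma> z) = z \<and> \<sigma> z \<in> Box" if "z \<in> O'" for z
  proof -
    have t: "fst z \<in> {-pi/2<..<pi/2}" "snd z \<in> {-pi/2<..<pi/2}"
      using that by (auto simp: O'_def)
    have s: "c + r * sin t \<in> {c - r<..<c + r}" if "t \<in> {-pi/2<..<pi/2}" for t c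
    proof -
      have "sin (-(pi/2)) < sin t" "sin t < sin (pi/2)"
        by (rule sin_monotone_2pi; use that in simp)+
      then have "-1 < sin t" "sin t < 1"
        by simp_all
      then have "r * (-1) < r * sin t" "r * sin t < r * 1"
        using r by (simp_all only: mult_strict_left_mono)
      then show ?thesis
        by simp
    qed
    have "r * u * inverse r = u" for u
      using r by simp
    then have "\<phi> (\<sigma> z) = (arcsin (sin (fst z)), arcsin (sin (snd z)))"
      unfolding \<phi>_def \<sigma>_def by (simp only: fst_conv snd_conv add_diff_cancel_left')
    moreover have "\<sigma> z \<in> Box"
      unfolding \<sigma>_def Box_def using s[OF t(1)] s[OF t(2)] by blast
    ultimately show ?thesis
      using t by (simp add: arcsin_sin)
  qed
  have src: "smooth_diffeo U1 O' \<phi>"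
  proof (rule smooth_diffeoI[OF \<open>open U1\<close> \<open>open O'\<close>, where \<psi>=\<sigma>])
    show "smooth_on U1 \<phi>" "smooth_on O' \<sigma>"
      using Ck_on_subset[OF \<phi>_Ck, of U1] Ck_on_subset[OF \<sigma>_Ck, of O'] by (auto simp: smooth_on_def U1_def)
    show "\<phi> z \<in> O' \<and> \<sigma> (\<phi> z) = z" if "z \<in> U1" for z
      using that \<sigma>\<phi>[of z] by (simp add: U1_def)
    show "\<sigma> z \<in> U1 \<and> \<phi> (\<sigma> z) = z" if "z \<in> O'" for z
      using \<phi>\<sigma>[OF that] that by (simp add: U1_def)
  qed
  have \<phi>0: "\<phi> (x0, y0) = (0, 0)"
    by (simp add: \<phi>_def)
  have in_U1: "(x0, y0) \<in> U1"
    using r N(2) by (simp add: U1_def \<phi>0 Box_def O'_def)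
  have f_N: "f z = N (cuspidal_edge_model (\<phi> z)) \<and> cuspidal_edge_model (\<phi> z) \<in> U" if "z \<in> U1" for z
  proof -
    obtain p q where pq: "\<phi> z = (p, q)"
      by (cases "\<phi> z")
    have "f z = g (\<phi> z)"
      using \<sigma>\<phi>[of z] that by (simp add: g_def U1_def)
    moreover have "(p, q) \<in> O'"
      using that pq by (simp add: U1_def)
    ultimately show ?thesis
      using N(3)[of p q] by (simp add: pq cuspidal_edge_model_def O'_def)
  qed
  \<comment> \<open>The inverse of N is the change of coordinates in the target, \<phi> the one in
    the source.\<close>
  have "inv_into U N (f z) = cuspidal_edge_model (\<phi> z)" if "z \<in> U1" for z
    using f_N[OF that] bN by (simp add: bij_betw_def)
  moreover have "f ` U1 \<subseteq> V"
    using f_N bN by (auto simp: bij_betw_def)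
  ultimately show ?thesis
    unfolding cuspidal_edge_at_def germs_equivalent_def
    using src smooth_diffeo_inv[OF N(1)] in_U1 \<phi>0 by metis
qed

subsection \<open>Two by two matrices\<close>

text \<open>The adjugate. For determinant 1 it is the inverse, but it is linear on all matrices, so
  derivatives, smoothness and holomorphy pass through it at once.\<close>

definition adj2 :: "mat2 \<Rightarrow> mat2" where
  "adj2 A = mat22 (A $ 2 $ 2) (- A $ 1 $ 2) (- A $ 2 $ 1) (A $ 1 $ 1)"

text \<open>Scaling of a matrix by a complex number, as opposed to the real scaling
  \<open>*\<^sub>R\<close>; Cauchy kernels are complex.\<close>

definition cscale :: "complex \<Rightarrow> mat2 \<Rightarrow> mat2" where
  "cscale c A = (\<chi> i j. c * A $ i $ j)"

lemma mat22_nth [simp]: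
  "mat22 a b c d $ 1 $ 1 = a" "mat22 a b c d $ 1 $ 2 = b"
  "mat22 a b c d $ 2 $ 1 = c" "mat22 a b c d $ 2 $ 2 = d"
  by (simp_all add: mat22_def)

lemma mat2_eq_iff:
  "A = B \<longleftrightarrow> A $ 1 $ 1 = B $ 1 $ 1 \<and> A $ 1 $ 2 = B $ 1 $ 2 \<and> A $ 2 $ 1 = B $ 2 $ 1 \<and> A $ 2 $ 2 = B $ 2 $ 2"
  for A B :: "'a^2^2"
  by (auto simp: vec_eq_iff forall_2)

lemma mat2_mult_nth: "(A ** B) $ i $ j = A $ i $ 1 * B $ 1 $ j + A $ i $ 2 * B $ 2 $ j"
  for A B :: "'a::semiring_1^2^2"
  by (simp add: matrix_matrix_mult_def sum_2)

lemma cscale_nth [simp]: "cscale c A $ i $ j = c * A $ i $ j"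
  by (simp add: cscale_def)

lemma adj2_nth [simp]:
  "adj2 A $ 1 $ 1 = A $ 2 $ 2" "adj2 A $ 1 $ 2 = - A $ 1 $ 2"
  "adj2 A $ 2 $ 1 = - A $ 2 $ 1" "adj2 A $ 2 $ 2 = A $ 1 $ 1"
  by (simp_all add: adj2_def)

lemma mat_one_nth [simp]:
  "(mat 1 :: mat2) $ 1 $ 1 = 1" "(mat 1 :: mat2) $ 1 $ 2 = 0"
  "(mat 1 :: mat2) $ 2 $ 1 = 0" "(mat 1 :: mat2) $ 2 $ 2 = 1"
  by (simp_all add: mat_def)

lemma adj2_mult:
  assumes "det A = 1"
  shows "A ** adj2 A = mat 1" "adj2 A ** A = mat 1"
  using assms by (simp_all add: mat2_eq_iff mat2_mult_nth det_2 algebra_simps)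

lemma matrix_inv_eqI:
  fixes A B :: mat2
  assumes "A ** B = mat 1" "B ** A = mat 1"
  shows "matrix_inv A = B"
proof -
  have "A ** matrix_inv A = mat 1 \<and> matrix_inv A ** A = mat 1"
    unfolding matrix_inv_def by (rule someI[of _ B]) (simp add: assms)
  then have "B ** (A ** matrix_inv A) = B"
    by simp
  then show ?thesis
    by (simp add: matrix_mul_assoc assms)
qed

lemma matrix_inv_eq_adj2:
  assumes "det A = 1"
  shows "matrix_inv A = adj2 A"
  by (rule matrix_inv_eqI[OF adj2_mult[OF assms]])

lemma det_adj2: "det (adj2 A) = det A"
  by (simp add: det_2 algebra_simps)

lemma cscale_mult_left: "cscale c A ** B = cscale c (A ** B)"
  and cscale_mult_right: "A ** cscale c B = cscale c (A ** B)"
  by (simp_all add: mat2_eq_iff mat2_mult_nth algebra_simps)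

lemma mat_mult_cscale: "mat c ** A = cscale c A"
  by (simp add: mat2_eq_iff mat2_mult_nth mat_def)

lemma bounded_bilinear_mat2_mult: "bounded_bilinear ((**) :: mat2 \<Rightarrow> mat2 \<Rightarrow> mat2)"
  unfolding bilinear_conv_bounded_bilinear[symmetric] bilinear_def linear_iff
  by (auto simp: mat2_eq_iff mat2_mult_nth algebra_simps)

lemma bounded_bilinear_cscale: "bounded_bilinear cscale"
  unfolding bilinear_conv_bounded_bilinear[symmetric] bilinear_def linear_iff
  by (auto simp: vec_eq_iff algebra_simps)

lemma bounded_linear_adj2: "bounded_linear adj2"
  unfolding linear_conv_bounded_linear[symmetric] linear_iff
  by (auto simp: mat2_eq_iff)

lemma bounded_linear_mat2_nth: "bounded_linear (\<lambda>A :: mat2. A $ i $ j)"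
  unfolding linear_conv_bounded_linear[symmetric] linear_iff by simp

lemmas Ck_on_mat2_mult = bounded_bilinear.Ck_on[OF bounded_bilinear_mat2_mult]
lemmas Ck_on_cscale = bounded_bilinear.Ck_on[OF bounded_bilinear_cscale]
lemmas Ck_on_adj2 = Ck_on_bounded_linear[OF bounded_linear_adj2]
lemmas continuous_on_mat2_mult [continuous_intros] = bounded_bilinear.continuous_on[OF bounded_bilinear_mat2_mult]
lemmas continuous_on_cscale [continuous_intros] = bounded_bilinear.continuous_on[OF bounded_bilinear_cscale]
lemmas continuous_on_adj2 [continuous_intros] = bounded_linear.continuous_on[OF bounded_linear_adj2]

lemma norm_cscale: "norm (cscale c A) = cmod c * norm A"
proof -
  have "norm (cscale c A $ i) = cmod c * norm (A $ i)" for i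
    by (simp add: norm_vec_def[of "_ $ _"] norm_mult L2_set_right_distrib)
  then show ?thesis
    by (simp add: norm_vec_def[of A] norm_vec_def[of "cscale c A"] L2_set_right_distrib)
qed

lemma mat_holomorphic_on_mult:
  "mat_holomorphic_on A S \<Longrightarrow> mat_holomorphic_on B S \<Longrightarrow> mat_holomorphic_on (\<lambda>z. A z ** B z) S"
  by (auto simp: mat_holomorphic_on_def mat2_mult_nth intro!: holomorphic_intros)

lemma mat_holomorphic_on_adj2:
  assumes "mat_holomorphic_on A S"
  shows "mat_holomorphic_on (\<lambda>z. adj2 (A z)) S"
proof -
  have "(\<lambda>z. A z $ i $ j) holomorphic_on S" "(\<lambda>z. - A z $ i $ j) holomorphic_on S" for i j
    using assms by (auto simp: mat_holomorphic_on_def intro!: holomorphic_intros)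
  then show ?thesis
    by (simp add: mat_holomorphic_on_def forall_2)
qed

lemma mat_holomorphic_on_diff_const:
  "mat_holomorphic_on A S \<Longrightarrow> mat_holomorphic_on (\<lambda>z. A z - C) S"
  by (auto simp: mat_holomorphic_on_def intro!: holomorphic_intros)

lemma mat_holomorphic_imp_continuous_on:
  "mat_holomorphic_on A S \<Longrightarrow> continuous_on S A"
proof -
  assume "mat_holomorphic_on A S"
  then have "continuous_on S (\<lambda>z. \<chi> i j. A z $ i $ j)"
    by (intro continuous_on_vec_lambda holomorphic_on_imp_continuous_on) (simp add: mat_holomorphic_on_def)
  then show ?thesis
    by simp
qed


subsection \<open>Averages over circles\<close>

text \<open>The measure dt on the circle is dw / (2 pi i w), so Cauchy's kernel takes the form w /
  (w - z).\<close>

definition circle_mean :: "real \<Rightarrow> (complex \<Rightarrow> 'a::euclidean_space) \<Rightarrow> 'a" where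
  "circle_mean R h = integral {0..1} (\<lambda>t. h (circlepath 0 R t))"

lemma circlepath_nonzero: "R \<noteq> 0 \<Longrightarrow> circlepath 0 R t \<noteq> 0"
  by (simp add: circlepath)

lemma norm_circlepath: "R > 0 \<Longrightarrow> norm (circlepath 0 R t) = R"
  by (simp add: circlepath norm_mult norm_exp_eq_Re)

lemma inverse_circlepath:
  assumes "R > 0"
  shows "1 / circlepath 0 R t = circlepath 0 (1 / R) (1 - t)"
proof -
  have "circlepath 0 R t * circlepath 0 (1 / R) (1 - t) = exp (2 * of_real pi * \<i> * of_real t + 2 * of_real pi * \<i> * of_real (1 - t))"
    using assms by (simp add: circlepath exp_add)
  also have "2 * of_real pi * \<i> * of_real t + 2 * of_real pi * \<i> * of_real (1 - t) = 2 * of_real pi * \<i>"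
    by (simp add: algebra_simps)
  finally show ?thesis
    using circlepath_nonzero[of R t] assms by (simp add: field_simps)
qed

lemma cnj_circlepath:
  assumes "R > 0"
  shows "cnj (circlepath 0 R t) = R\<^sup>2 / circlepath 0 R t"
proof -
  have "circlepath 0 R t * cnj (circlepath 0 R t) = R\<^sup>2"
    using assms by (simp add: complex_norm_square[symmetric] norm_circlepath)
  then show ?thesis
    using circlepath_nonzero[of R t] assms by (simp add: field_simps)
qed

lemma continuous_on_circlepath: "continuous_on A (circlepath 0 R)"
  by (auto simp: circlepath intro!: continuous_intros)

lemma Ck_on_circlepath: "Ck_on k UNIV (circlepath 0 R)"
proof -
  have "circlepath 0 R = (\<lambda>t. complex_of_real (R * cos (2 * pi * t)) + \<i> * complex_of_real (R * sin (2 * pi * t)))"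
    by (auto simp: circlepath exp_eq_polar complex_eq_iff cis.sel Re_exp Im_exp)
  moreover have "Ck_on k UNIV (\<lambda>t. complex_of_real (R * cos (2 * pi * t)) + \<i> * complex_of_real (R * sin (2 * pi * t)))"
    by (intro Ck_on_add Ck_on_mult Ck_on_const open_UNIV Ck_on_bounded_linear[OF bounded_linear_of_real]
        Ck_on_compose[OF open_UNIV open_UNIV Ck_on_cos _ subset_UNIV]
        Ck_on_compose[OF open_UNIV open_UNIV Ck_on_sin _ subset_UNIV] Ck_on_id)
  ultimately show ?thesis
    by simp
qed

lemma circle_mean_continuous_integrable:
  fixes h :: "complex \<Rightarrow> 'a::euclidean_space"
  assumes "R > 0" "continuous_on (sphere 0 R) h"
  shows "(\<lambda>t. h (circlepath 0 R t)) integrable_on {0..1}"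
    and "continuous_on {0..1} (\<lambda>t. h (circlepath 0 R t))"
proof -
  show "continuous_on {0..1} (\<lambda>t. h (circlepath 0 R t))"
    by (rule continuous_on_compose2[OF assms(2) continuous_on_circlepath])
      (auto simp: norm_circlepath assms(1))
  then show "(\<lambda>t. h (circlepath 0 R t)) integrable_on {0..1}"
    by (rule integrable_continuous_real)
qed

lemma circle_mean_linear:
  fixes h :: "complex \<Rightarrow> 'a::euclidean_space" and L :: "'a \<Rightarrow> 'b::euclidean_space"
  assumes "R > 0" "continuous_on (sphere 0 R) h" "bounded_linear L"
  shows "circle_mean R (\<lambda>w. L (h w)) = L (circle_mean R h)"
  using integral_linear[OF circle_mean_continuous_integrable(1)[OF assms(1,2)] assms(3)]
  by (simp add: circle_mean_def o_def)

lemma circle_mean_cong: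
  assumes "R > 0" "\<And>w. norm w = R \<Longrightarrow> h w = g w"
  shows "circle_mean R h = circle_mean R g"
  unfolding circle_mean_def by (rule integral_cong) (simp add: assms norm_circlepath)

lemma circle_mean_add:
  assumes "R > 0" "continuous_on (sphere 0 R) h" "continuous_on (sphere 0 R) g"
  shows "circle_mean R (\<lambda>w. h w + g w) = circle_mean R h + circle_mean R g"
  unfolding circle_mean_def by (intro integral_add circle_mean_continuous_integrable assms)

lemma circle_mean_diff:
  assumes "R > 0" "continuous_on (sphere 0 R) h" "continuous_on (sphere 0 R) g"
  shows "circle_mean R (\<lambda>w. h w - g w) = circle_mean R h - circle_mean R g"
  unfolding circle_mean_def by (intro integral_diff circle_mean_continuous_integrable assms)

lemma circle_mean_const [simp]: "circle_mean R (\<lambda>w. c) = c"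
  by (simp add: circle_mean_def)

lemma circle_mean_mono:
  fixes h g :: "complex \<Rightarrow> real"
  assumes "R > 0" "continuous_on (sphere 0 R) h" "continuous_on (sphere 0 R) g"
    and "\<And>w. norm w = R \<Longrightarrow> h w \<le> g w"
  shows "circle_mean R h \<le> circle_mean R g"
  unfolding circle_mean_def
  by (intro integral_le circle_mean_continuous_integrable assms) (simp add: norm_circlepath assms(1))

lemma norm_circle_mean_le:
  assumes "R > 0" "continuous_on (sphere 0 R) h"
  shows "norm (circle_mean R h) \<le> circle_mean R (\<lambda>w. norm (h w))"
  unfolding circle_mean_def
  by (intro integral_norm_bound_integral circle_mean_continuous_integrable assms continuous_on_norm) auto

text \<open>Inversion exchanges the radii R and 1/R and reverses the parametrisation, to which a
  mean is insensitive.\<close>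

lemma circle_mean_inverse:
  assumes "R > 0" "continuous_on (sphere 0 (1 / R)) h"
  shows "circle_mean R (\<lambda>w. h (1 / w)) = circle_mean (1 / R) h"
proof -
  let ?f = "\<lambda>t. h (circlepath 0 (1 / R) t)"
  have "(?f has_integral circle_mean (1 / R) h) {0..1}"
    unfolding circle_mean_def
    by (intro integrable_integral circle_mean_continuous_integrable) (use assms in auto)
  from has_integral_affinity01[OF this, of "-1" 1]
  have "((\<lambda>t. ?f (1 - t)) has_integral circle_mean (1 / R) h) ((\<lambda>x. 1 - x) ` {0..1})"
    by simp
  moreover have "(\<lambda>x::real. 1 - x) ` {0..1} = {0..1}"
    by (auto simp: image_iff intro!: bexI[of _ "1 - _"])
  ultimately show ?thesis
    by (simp add: circle_mean_def[of R] inverse_circlepath assms(1) integral_unique)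
qed

lemma circle_mean_cauchy:
  assumes "h holomorphic_on cball 0 R" "norm z < R"
  shows "circle_mean R (\<lambda>w. w / (w - z) * h w) = h z"
proof -
  have R: "R > 0"
    using assms(2) norm_ge_zero[of z] by linarith
  have "((\<lambda>u. h u / (u - z)) has_contour_integral (2 * of_real pi * \<i> * h z)) (circlepath 0 R)"
    using Cauchy_integral_circlepath_simple[OF assms(1), of z] assms(2) by simp
  then have "((\<lambda>t. h (circlepath 0 R t) / (circlepath 0 R t - z) * (2 * of_real pi * \<i> * R * exp (2 * of_real pi * \<i> * t)))
      has_integral (2 * of_real pi * \<i> * h z)) {0..1}"
    unfolding has_contour_integral_def
    by (rule has_integral_eq[rotated]) (simp add: vector_derivative_circlepath01)
  from has_integral_mult_right[OF this, of "1 / (2 * of_real pi * \<i>)"]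
  have "((\<lambda>t. circlepath 0 R t / (circlepath 0 R t - z) * h (circlepath 0 R t)) has_integral h z) {0..1}"
    by (simp add: circlepath field_simps)
  then show ?thesis
    by (simp add: circle_mean_def integral_unique)
qed

lemma circle_mean_value:
  assumes "h holomorphic_on cball 0 R" "R > 0"
  shows "circle_mean R h = h 0"
proof -
  have "circle_mean R h = circle_mean R (\<lambda>w. w / (w - 0) * h w)"
    by (rule circle_mean_cong[OF assms(2)]) (use assms(2) in auto)
  then show ?thesis
    using circle_mean_cauchy[OF assms(1), of 0] assms(2) by simp
qed

text \<open>In terms of u = 1/w the kernel is 1 / (1 - z u), holomorphic for |u| at most 1/R, and
  the mean value property leaves the value at u = 0. Thus the kernel reduces an outer function to
  its value at infinity.\<close>

lemma circle_mean_cauchy_exterior: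
  assumes "h holomorphic_on UNIV" "norm z < R"
  shows "circle_mean R (\<lambda>w. w / (w - z) * h (1 / w)) = h 0"
proof -
  have R: "R > 0"
    using assms(2) norm_ge_zero[of z] by linarith
  have nz: "1 - z * u \<noteq> 0" if "norm u \<le> 1 / R" for u
  proof -
    have "norm (z * u) \<le> norm z * (1 / R)"
      unfolding norm_mult using that by (intro mult_left_mono) auto
    also have "\<dots> < 1"
      using assms(2) R by simp
    finally show ?thesis
      by auto
  qed
  have hol: "(\<lambda>u. h u / (1 - z * u)) holomorphic_on cball 0 (1 / R)"
    using nz by (auto intro!: holomorphic_intros holomorphic_on_subset[OF assms(1)])
  have "circle_mean R (\<lambda>w. w / (w - z) * h (1 / w)) = circle_mean R (\<lambda>w. h (1 / w) / (1 - z * (1 / w)))"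
    by (rule circle_mean_cong[OF R]) (use R in \<open>auto simp: field_simps\<close>)
  also have "\<dots> = circle_mean (1 / R) (\<lambda>u. h u / (1 - z * u))"
    by (rule circle_mean_inverse[OF R])
      (rule continuous_on_subset[OF holomorphic_on_imp_continuous_on[OF hol]], auto)
  also have "\<dots> = h 0"
    using circle_mean_value[OF hol] R by simp
  finally show ?thesis .
qed

lemma circle_mean_mat2_eqI:
  assumes "R > 0" "continuous_on (sphere 0 R) A"
    and "\<And>i j. circle_mean R (\<lambda>w. A w $ i $ j) = B $ i $ j"
  shows "circle_mean R A = (B :: mat2)"
  using circle_mean_linear[OF assms(1,2) bounded_linear_mat2_nth] assms(3)
  by (simp add: vec_eq_iff)

lemma continuous_on_cauchy_kernel:
  "norm (z :: complex) < R \<Longrightarrow> continuous_on (sphere 0 R) (\<lambda>w. w / (w - z))"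
  by (intro continuous_intros) auto

lemma continuous_on_inverse_sphere:
  assumes "R > 0" "continuous_on UNIV A"
  shows "continuous_on (sphere 0 R) (\<lambda>w :: complex. A (1 / w))"
  by (rule continuous_on_compose2[OF assms(2)]) (use assms(1) in \<open>auto intro!: continuous_intros\<close>)

lemma circle_mean_cauchy_mat2:
  assumes "mat_holomorphic_on A UNIV" "norm z < R"
  shows "circle_mean R (\<lambda>w. cscale (w / (w - z)) (A w)) = A z"
    and "circle_mean R (\<lambda>w. cscale (w / (w - z)) (A (1 / w))) = A 0"
proof -
  have R: "R > 0"
    using assms(2) norm_ge_zero[of z] by linarith
  have c: "continuous_on UNIV A"
    using mat_holomorphic_imp_continuous_on[OF assms(1)] .
  have h: "(\<lambda>z. A z $ i $ j) holomorphic_on UNIV" for i j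
    using assms(1) by (simp add: mat_holomorphic_on_def)
  show "circle_mean R (\<lambda>w. cscale (w / (w - z)) (A w)) = A z"
    by (rule circle_mean_mat2_eqI[OF R continuous_on_cscale[OF continuous_on_cauchy_kernel[OF assms(2)] continuous_on_subset[OF c subset_UNIV]]])
      (simp add: circle_mean_cauchy[OF holomorphic_on_subset[OF h subset_UNIV] assms(2), simplified])
  show "circle_mean R (\<lambda>w. cscale (w / (w - z)) (A (1 / w))) = A 0"
    by (rule circle_mean_mat2_eqI[OF R continuous_on_cscale[OF continuous_on_cauchy_kernel[OF assms(2)] continuous_on_inverse_sphere[OF R c]]])
      (simp add: circle_mean_cauchy_exterior[OF h assms(2), simplified])
qed

text \<open>Hardy space orthogonality: on the circle, \<open>cnj w = R\<^sup>2 / w\<close> turns the conjugate of an entire function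
  of \<open>w\<close> into an entire function of \<open>1 / w\<close>.\<close>

lemma circle_mean_orthogonal:
  assumes "mat_holomorphic_on A UNIV" "mat_holomorphic_on B UNIV" "A 0 = 0" "R > 0"
  shows "circle_mean R (\<lambda>w. A (1 / w) \<bullet> B w) = 0"
proof -
  have c: "continuous_on UNIV A" "continuous_on UNIV B"
    using mat_holomorphic_imp_continuous_on assms(1,2) by blast+
  have h: "(\<lambda>z. A z $ i $ j) holomorphic_on UNIV" "(\<lambda>z. B z $ i $ j) holomorphic_on UNIV" for i j
    using assms(1,2) by (simp_all add: mat_holomorphic_on_def)
  have ce: "continuous_on (sphere 0 R) (\<lambda>w. A (1 / w) $ i $ j * cnj (B w $ i $ j))" for i j
    by (intro continuous_intros continuous_on_inverse_sphere[OF assms(4)] continuous_on_subset[OF c(2)]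
         bounded_linear.continuous_on[OF bounded_linear_mat2_nth] c(1)) auto
  have 0: "circle_mean R (\<lambda>w. A (1 / w) $ i $ j * cnj (B w $ i $ j)) = 0" for i j
  proof -
    let ?b = "\<lambda>u. cnj (B (cnj u) $ i $ j)"
    have b: "?b holomorphic_on UNIV"
      using holomorphic_on_compose_cnj_cnj[of "\<lambda>z. B z $ i $ j" UNIV]
        holomorphic_on_subset[OF h(2) subset_UNIV] by (simp add: o_def)
    have "(\<lambda>u. ?b (R\<^sup>2 * u)) holomorphic_on UNIV"
      using holomorphic_on_compose[OF _ holomorphic_on_subset[OF b subset_UNIV], of "\<lambda>u. R\<^sup>2 * u" UNIV]
      by (simp add: o_def holomorphic_intros)
    then have hol: "(\<lambda>u. A u $ i $ j * ?b (R\<^sup>2 * u)) holomorphic_on UNIV"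
      by (intro holomorphic_on_mult h(1))
    have "circle_mean R (\<lambda>w. A (1 / w) $ i $ j * cnj (B w $ i $ j))
        = circle_mean R (\<lambda>w. A (1 / w) $ i $ j * ?b (R\<^sup>2 * (1 / w)))"
      unfolding circle_mean_def
    proof (rule integral_cong)
      fix t
      have "cnj (R\<^sup>2 * (1 / circlepath 0 R t)) = circlepath 0 R t"
        using cnj_circlepath[OF assms(4), of t] by (simp del: complex_cnj_mult complex_cnj_divide) (metis complex_cnj_cnj)
      then show "A (1 / circlepath 0 R t) $ i $ j * cnj (B (circlepath 0 R t) $ i $ j)
          = A (1 / circlepath 0 R t) $ i $ j * ?b (R\<^sup>2 * (1 / circlepath 0 R t))"
        by simp
    qed
    also have "\<dots> = circle_mean (1 / R) (\<lambda>u. A u $ i $ j * ?b (R\<^sup>2 * u))"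
      by (rule circle_mean_inverse[OF assms(4)])
        (rule continuous_on_subset[OF holomorphic_on_imp_continuous_on[OF hol]], auto)
    also have "\<dots> = 0"
      using circle_mean_value[OF holomorphic_on_subset[OF hol], of "1 / R"] assms(3,4) by simp
    finally show ?thesis .
  qed
  \<comment> \<open>The inner product of complex matrices as real vectors is the real part of the
    Hermitian one.\<close>
  have "circle_mean R (\<lambda>w. A (1 / w) \<bullet> B w)
      = circle_mean R (\<lambda>w. Re (\<Sum>i\<in>UNIV. \<Sum>j\<in>UNIV. A (1 / w) $ i $ j * cnj (B w $ i $ j)))"
    by (rule circle_mean_cong[OF assms(4)]) (simp add: inner_vec_def inner_complex_def sum_2)
  also have "\<dots> = Re (circle_mean R (\<lambda>w. \<Sum>i\<in>UNIV. \<Sum>j\<in>UNIV. A (1 / w) $ i $ j * cnj (B w $ i $ j)))"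
    by (rule circle_mean_linear[OF assms(4) _ bounded_linear_Re]) (intro continuous_on_sum ce)
  also have "\<dots> = Re (\<Sum>i\<in>UNIV. \<Sum>j\<in>UNIV. circle_mean R (\<lambda>w. A (1 / w) $ i $ j * cnj (B w $ i $ j)))"
    by (simp add: sum_2 circle_mean_add[OF assms(4)] ce continuous_on_add)
  finally show ?thesis
    by (simp add: 0)
qed

lemma adj2_one [simp]: "adj2 (mat 1) = mat 1"
  by (simp add: mat2_eq_iff)

lemma mat2_mult_bound:
  obtains K where "K > 0" "\<And>(A :: mat2) (B :: mat2). norm (A ** B) \<le> norm A * norm B * K"
proof -
  have "\<exists>K>0. \<forall>(A :: mat2) (B :: mat2). norm (A ** B) \<le> norm A * norm B * K"
    by (rule bounded_bilinear.pos_bounded[OF bounded_bilinear_mat2_mult])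
  then show thesis
    by (elim exE conjE) (rule that, auto)
qed

subsection \<open>Smooth dependence of the Birkhoff factors\<close>

text \<open>\<open>G\<close> is the inverse of the plus factor, and \<open>M\<close> is the minus factor in the coordinate \<open>1 / z\<close>.\<close>

locale birkhoff_family =
  fixes \<Omega> :: "'p::euclidean_space set" and \<Phi> G M :: "'p \<Rightarrow> loop"
  assumes open_\<Omega>: "open \<Omega>"
    and smooth_\<Phi>: "smooth_on (\<Omega> \<times> (- {0})) (\<lambda>(p, z). \<Phi> p z)"
    and hol_G: "p \<in> \<Omega> \<Longrightarrow> mat_holomorphic_on (G p) UNIV"
    and hol_M: "p \<in> \<Omega> \<Longrightarrow> mat_holomorphic_on (M p) UNIV"
    and det_G: "p \<in> \<Omega> \<Longrightarrow> det (G p z) = 1"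
    and det_M: "p \<in> \<Omega> \<Longrightarrow> det (M p z) = 1"
    and M_0: "p \<in> \<Omega> \<Longrightarrow> M p 0 = mat 1"
    and factorization: "p \<in> \<Omega> \<Longrightarrow> z \<noteq> 0 \<Longrightarrow> \<Phi> p z ** G p z = M p (1 / z)"
begin

lemma cont_G: "p \<in> \<Omega> \<Longrightarrow> continuous_on A (G p)" and cont_M: "p \<in> \<Omega> \<Longrightarrow> continuous_on A (M p)"
  using mat_holomorphic_imp_continuous_on[OF hol_G] mat_holomorphic_imp_continuous_on[OF hol_M]
    continuous_on_subset by blast+

lemma cont_\<Phi>: "continuous_on (\<Omega> \<times> (- {0})) (\<lambda>(p, z). \<Phi> p z)"
proof -
  have "Ck_on 0 (\<Omega> \<times> (- {0})) (\<lambda>(p, z). \<Phi> p z)"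
    using smooth_\<Phi> unfolding smooth_on_def by blast
  then show ?thesis
    by simp
qed

lemma cont_\<Phi>_sphere: "p \<in> \<Omega> \<Longrightarrow> R > 0 \<Longrightarrow> continuous_on (sphere 0 R) (\<Phi> p)"
proof -
  assume "p \<in> \<Omega>" "R > 0"
  then have "(\<lambda>z. (p, z)) ` sphere 0 R \<subseteq> \<Omega> \<times> (- {0})"
    by auto
  from continuous_on_compose2[OF cont_\<Phi> _ this] show ?thesis
    by (simp add: continuous_on_Pair)
qed

text \<open>A splitting of a function on the circle into boundary values of functions holomorphic outside and
  inside.\<close>

lemma splitting:
  assumes "p \<in> \<Omega>" "q \<in> \<Omega>" "w \<noteq> 0"
  shows "adj2 (M p (1 / w)) ** (\<Phi> q w - \<Phi> p w) ** G q w
    = adj2 (M p (1 / w)) ** M q (1 / w) - adj2 (G p w) ** G q w"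
proof -
  have "adj2 (M p (1 / w)) ** \<Phi> p w = adj2 (M p (1 / w)) ** (\<Phi> p w ** G p w) ** adj2 (G p w)"
    by (simp add: matrix_mul_assoc[symmetric] adj2_mult[OF det_G[OF assms(1)]])
  also have "\<dots> = adj2 (G p w)"
    by (simp add: factorization[OF assms(1,3)] adj2_mult[OF det_M[OF assms(1)]])
  finally have 1: "adj2 (M p (1 / w)) ** \<Phi> p w = adj2 (G p w)" .
  have "adj2 (M p (1 / w)) ** (\<Phi> q w - \<Phi> p w) ** G q w
      = adj2 (M p (1 / w)) ** (\<Phi> q w ** G q w) - adj2 (M p (1 / w)) ** \<Phi> p w ** G q w"
    by (simp add: mat2_eq_iff mat2_mult_nth algebra_simps)
  then show ?thesis
    by (simp add: 1 factorization[OF assms(2,3)])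
qed

text \<open>Cauchy's kernel is applied to \<open>splitting\<close>: the outer part contributes only
  its value I at infinity, the inner part is reproduced at z, and the resulting equation is solved
  for G q z.\<close>

lemma difference_formula:
  assumes "p \<in> \<Omega>" "q \<in> \<Omega>" "norm z < R"
  shows "G q z = G p z ** (mat 1 -
    circle_mean R (\<lambda>w. cscale (w / (w - z)) (adj2 (M p (1 / w)) ** (\<Phi> q w - \<Phi> p w) ** G q w)))"
proof -
  have R: "R > 0"
    using assms(3) norm_ge_zero[of z] by linarith
  let ?A = "\<lambda>u. adj2 (M p u) ** M q u" and ?D = "\<lambda>w. adj2 (G p w) ** G q w"
  have hol: "mat_holomorphic_on ?A UNIV" "mat_holomorphic_on ?D UNIV"
    by (intro mat_holomorphic_on_mult mat_holomorphic_on_adj2 hol_G hol_M assms)+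
  have "circle_mean R (\<lambda>w. cscale (w / (w - z)) (adj2 (M p (1 / w)) ** (\<Phi> q w - \<Phi> p w) ** G q w))
      = circle_mean R (\<lambda>w. cscale (w / (w - z)) (?A (1 / w)) - cscale (w / (w - z)) (?D w))"
  proof (rule circle_mean_cong[OF R])
    fix w :: complex assume "norm w = R"
    then have "w \<noteq> 0"
      using R by auto
    then show "cscale (w / (w - z)) (adj2 (M p (1 / w)) ** (\<Phi> q w - \<Phi> p w) ** G q w)
      = cscale (w / (w - z)) (?A (1 / w)) - cscale (w / (w - z)) (?D w)"
      unfolding splitting[OF assms(1,2) \<open>w \<noteq> 0\<close>] by (simp add: mat2_eq_iff algebra_simps)
  qed
  also have "\<dots> = circle_mean R (\<lambda>w. cscale (w / (w - z)) (?A (1 / w))) - circle_mean R (\<lambda>w. cscale (w / (w - z)) (?D w))"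
    by (intro circle_mean_diff R continuous_on_cscale continuous_on_cauchy_kernel assms(3)
        continuous_on_inverse_sphere[where A="?A"] mat_holomorphic_imp_continuous_on hol
        continuous_on_subset[OF mat_holomorphic_imp_continuous_on[OF hol(2)]]) auto
  also have "\<dots> = mat 1 - ?D z"
    using circle_mean_cauchy_mat2[OF hol(1) assms(3)] circle_mean_cauchy_mat2[OF hol(2) assms(3)]
    by (simp add: M_0 assms adj2_mult)
  finally show ?thesis
    by (simp add: matrix_mul_assoc adj2_mult[OF det_G[OF assms(1)]])
qed

text \<open>The outer part minus I vanishes at infinity, hence is orthogonal to the inner part minus
  I. By Pythagoras each is bounded in mean square by their difference, which is small relative to
  the transition \<open>adj2 (G p w) ** G q w\<close>; for \<epsilon>^2 at most 1/4 the multiple of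
  the unknown norm that appears on the right is absorbed on the left.\<close>

lemma L2_estimate:
  assumes "p \<in> \<Omega>" "q \<in> \<Omega>" "R > 0" "0 \<le> \<epsilon>" "\<epsilon>\<^sup>2 \<le> 1 / 4"
    and E: "\<And>w. norm w = R \<Longrightarrow> norm (adj2 (M p (1 / w)) ** (\<Phi> q w - \<Phi> p w) ** G q w) \<le> \<epsilon> * norm (adj2 (G p w) ** G q w)"
  shows "circle_mean R (\<lambda>w. (norm (adj2 (G p w) ** G q w - mat 1))\<^sup>2) \<le> 4 * \<epsilon>\<^sup>2 * (norm (mat 1 :: mat2))\<^sup>2"
proof -
  define a where "a u = adj2 (M p u) ** M q u - mat 1" for u
  define d where "d w = adj2 (G p w) ** G q w - mat 1" for w
  have hol: "mat_holomorphic_on a UNIV" "mat_holomorphic_on d UNIV"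
    unfolding a_def d_def
    by (intro mat_holomorphic_on_diff_const mat_holomorphic_on_mult mat_holomorphic_on_adj2 hol_G hol_M assms)+
  have c: "continuous_on (sphere 0 R) (\<lambda>w. a (1 / w))" "continuous_on (sphere 0 R) d"
    using continuous_on_inverse_sphere[OF assms(3) mat_holomorphic_imp_continuous_on[OF hol(1)]]
      continuous_on_subset[OF mat_holomorphic_imp_continuous_on[OF hol(2)]] by auto
  let ?I = "norm (mat 1 :: mat2)"
  have orth: "circle_mean R (\<lambda>w. a (1 / w) \<bullet> d w) = 0"
    by (rule circle_mean_orthogonal[OF hol]) (simp_all add: a_def M_0 assms adj2_mult)
  have "circle_mean R (\<lambda>w. (norm (a (1 / w)))\<^sup>2 + (norm (d w))\<^sup>2)
      = circle_mean R (\<lambda>w. (norm (a (1 / w) - d w))\<^sup>2 + 2 * (a (1 / w) \<bullet> d w))"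
    by (rule circle_mean_cong[OF assms(3)]) (simp add: power2_norm_eq_inner inner_diff inner_commute)
  also have "\<dots> = circle_mean R (\<lambda>w. (norm (a (1 / w) - d w))\<^sup>2) + circle_mean R (\<lambda>w. 2 * (a (1 / w) \<bullet> d w))"
    by (intro circle_mean_add assms(3) continuous_intros c)
  also have "circle_mean R (\<lambda>w. 2 * (a (1 / w) \<bullet> d w)) = 2 * circle_mean R (\<lambda>w. a (1 / w) \<bullet> d w)"
    by (rule circle_mean_linear[OF assms(3) _ bounded_linear_mult_right]) (intro continuous_intros c)
  finally have 1: "circle_mean R (\<lambda>w. (norm (a (1 / w)))\<^sup>2 + (norm (d w))\<^sup>2)
      = circle_mean R (\<lambda>w. (norm (a (1 / w) - d w))\<^sup>2)"
    by (simp add: orth)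
  have "circle_mean R (\<lambda>w. (norm (d w))\<^sup>2) \<le> circle_mean R (\<lambda>w. (norm (a (1 / w)))\<^sup>2 + (norm (d w))\<^sup>2)"
    by (intro circle_mean_mono assms(3) continuous_intros c) auto
  also have "\<dots> = circle_mean R (\<lambda>w. (norm (a (1 / w) - d w))\<^sup>2)"
    by (rule 1)
  also have "\<dots> \<le> circle_mean R (\<lambda>w. \<epsilon>\<^sup>2 * (2 * ?I\<^sup>2) + (2 * \<epsilon>\<^sup>2) * (norm (d w))\<^sup>2)"
  proof (intro circle_mean_mono assms(3) continuous_intros c)
    fix w :: complex assume w: "norm w = R"
    then have "w \<noteq> 0"
      using assms(3) by auto
    have "norm (a (1 / w) - d w) \<le> \<epsilon> * norm (adj2 (G p w) ** G q w)"
      using E[OF w] unfolding splitting[OF assms(1,2) \<open>w \<noteq> 0\<close>] by (simp add: a_def d_def)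
    also have "\<dots> \<le> \<epsilon> * (?I + norm (d w))"
      using norm_triangle_ineq[of "mat 1" "d w"] assms(4) by (intro mult_left_mono) (auto simp: d_def)
    finally have "(norm (a (1 / w) - d w))\<^sup>2 \<le> (\<epsilon> * (?I + norm (d w)))\<^sup>2"
      by (intro power_mono) auto
    also have "\<dots> = \<epsilon>\<^sup>2 * (?I + norm (d w))\<^sup>2"
      by (simp add: power_mult_distrib)
    also have "\<dots> \<le> \<epsilon>\<^sup>2 * (2 * ?I\<^sup>2 + 2 * (norm (d w))\<^sup>2)"
      using sum_squares_bound[of ?I "norm (d w)"]
      by (intro mult_left_mono) (auto simp: power2_sum)
    finally show "(norm (a (1 / w) - d w))\<^sup>2 \<le> \<epsilon>\<^sup>2 * (2 * ?I\<^sup>2) + (2 * \<epsilon>\<^sup>2) * (norm (d w))\<^sup>2"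
      by (simp add: algebra_simps)
  qed
  also have "\<dots> = \<epsilon>\<^sup>2 * (2 * ?I\<^sup>2) + circle_mean R (\<lambda>w. (2 * \<epsilon>\<^sup>2) * (norm (d w))\<^sup>2)"
    by (subst circle_mean_add) (auto intro!: continuous_intros c assms(3))
  also have "circle_mean R (\<lambda>w. (2 * \<epsilon>\<^sup>2) * (norm (d w))\<^sup>2) = (2 * \<epsilon>\<^sup>2) * circle_mean R (\<lambda>w. (norm (d w))\<^sup>2)"
    by (rule circle_mean_linear[OF assms(3) _ bounded_linear_mult_right]) (intro continuous_intros c)
  finally have fin: "circle_mean R (\<lambda>w. (norm (d w))\<^sup>2)
      \<le> \<epsilon>\<^sup>2 * (2 * ?I\<^sup>2) + (2 * \<epsilon>\<^sup>2) * circle_mean R (\<lambda>w. (norm (d w))\<^sup>2)" .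
  have "circle_mean R (\<lambda>w. 0) \<le> circle_mean R (\<lambda>w. (norm (d w))\<^sup>2)"
    by (intro circle_mean_mono assms(3) continuous_intros c) auto
  then have "(2 * \<epsilon>\<^sup>2) * circle_mean R (\<lambda>w. (norm (d w))\<^sup>2) \<le> 1 / 2 * circle_mean R (\<lambda>w. (norm (d w))\<^sup>2)"
    using assms(5) by (intro mult_right_mono) auto
  with fin have "circle_mean R (\<lambda>w. (norm (d w))\<^sup>2) \<le> 4 * \<epsilon>\<^sup>2 * ?I\<^sup>2"
    by simp
  then show ?thesis
    by (simp add: d_def)
qed

text \<open>For |z| at most R/2 the kernel is bounded by 2. The inequality 2 x \<le> e/2 + 2 x^2 /
  e, in place of Cauchy-Schwarz, turns a bound in mean square into a pointwise one.\<close>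

lemma pointwise_estimate:
  assumes "p \<in> \<Omega>" "q \<in> \<Omega>" "R > 0" "norm z \<le> R / 2" "e > 0"
    and "circle_mean R (\<lambda>w. (norm (adj2 (G p w) ** G q w - mat 1))\<^sup>2) \<le> e\<^sup>2 / 4"
  shows "norm (adj2 (G p z) ** G q z - mat 1) \<le> e"
proof -
  define d where "d w = adj2 (G p w) ** G q w - mat 1" for w
  have hol: "mat_holomorphic_on d UNIV"
    unfolding d_def
    by (intro mat_holomorphic_on_diff_const mat_holomorphic_on_mult mat_holomorphic_on_adj2 hol_G assms)
  have c: "continuous_on (sphere 0 R) d"
    using continuous_on_subset[OF mat_holomorphic_imp_continuous_on[OF hol]] by auto
  have z: "norm z < R"
    using assms(3,4) by simp
  have "norm (d z) = norm (circle_mean R (\<lambda>w. cscale (w / (w - z)) (d w)))"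
    using circle_mean_cauchy_mat2(1)[OF hol z] by simp
  also have "\<dots> \<le> circle_mean R (\<lambda>w. norm (cscale (w / (w - z)) (d w)))"
    by (intro norm_circle_mean_le assms(3) continuous_intros continuous_on_cauchy_kernel z c)
  also have "\<dots> \<le> circle_mean R (\<lambda>w. e / 2 + 2 / e * (norm (d w))\<^sup>2)"
  proof (intro circle_mean_mono assms(3) continuous_intros continuous_on_cauchy_kernel z c)
    fix w :: complex assume w: "norm w = R"
    have "R / 2 \<le> norm (w - z)"
      using norm_triangle_ineq2[of w z] w assms(4) by simp
    moreover from this assms(3) have "norm (w - z) > 0"
      by linarith
    ultimately have "norm (w / (w - z)) \<le> 2"
      using w by (simp add: norm_divide pos_divide_le_eq)
    then have "norm (cscale (w / (w - z)) (d w)) \<le> 2 * norm (d w)"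
      unfolding norm_cscale by (intro mult_right_mono) auto
    also have "\<dots> \<le> e / 2 + 2 / e * (norm (d w))\<^sup>2"
    proof -
      have "0 \<le> (e - 2 * norm (d w))\<^sup>2 / (2 * e)"
        using assms(5) by simp
      also have "\<dots> = e / 2 + 2 / e * (norm (d w))\<^sup>2 - 2 * norm (d w)"
        using assms(5) by (simp add: power2_eq_square field_simps)
      finally show ?thesis
        by simp
    qed
    finally show "norm (cscale (w / (w - z)) (d w)) \<le> e / 2 + 2 / e * (norm (d w))\<^sup>2" .
  qed (use z assms(5) in auto)
  also have "\<dots> = e / 2 + circle_mean R (\<lambda>w. 2 / e * (norm (d w))\<^sup>2)"
    by (subst circle_mean_add) (use assms(5) in \<open>auto intro!: continuous_intros c assms(3)\<close>)
  also have "circle_mean R (\<lambda>w. 2 / e * (norm (d w))\<^sup>2) = 2 / e * circle_mean R (\<lambda>w. (norm (d w))\<^sup>2)"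
    by (rule circle_mean_linear[OF assms(3) _ bounded_linear_mult_right]) (intro continuous_intros c)
  also have "2 / e * circle_mean R (\<lambda>w. (norm (d w))\<^sup>2) \<le> 2 / e * (e\<^sup>2 / 4)"
    using assms(5,6) by (intro mult_left_mono) (auto simp: d_def)
  also have "e / 2 + 2 / e * (e\<^sup>2 / 4) = e"
    using assms(5) by (simp add: power2_eq_square)
  finally show ?thesis
    by (simp add: d_def)
qed

text \<open>\<open>E\<close> contains only the fixed G p. Writing G q as G p times the transition
  gives an error relative to the transition, the form that \<open>L2_estimate\<close> handles. Since
  E p = 0 and the circle is compact, E q is uniformly small for q near p.\<close>

lemma transition_close:
  assumes "p \<in> \<Omega>" "R > 0" "e > 0"
  shows "\<forall>\<^sub>F q in at p within \<Omega>. \<forall>z. norm z \<le> R / 2 \<longrightarrow> norm (adj2 (G p z) ** G q z - mat 1) \<le> e"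
proof -
  obtain K where K: "K > 0" "\<And>(A :: mat2) (B :: mat2). norm (A ** B) \<le> norm A * norm B * K"
    using mat2_mult_bound by blast
  let ?I = "norm (mat 1 :: mat2)"
  have I: "?I > 0"
    by (simp add: mat2_eq_iff)
  \<comment> \<open>The bound 1/2 serves the absorption in \<open>L2_estimate\<close>; e / (4 |I|)
    makes 4 \<epsilon>^2 |I|^2 at most e^2 / 4, as \<open>pointwise_estimate\<close>
    requires.\<close>
  define \<epsilon> where "\<epsilon> = min (1 / 2) (e / (4 * ?I))"
  have \<epsilon>: "\<epsilon> > 0" "\<epsilon>\<^sup>2 \<le> 1 / 4" "4 * \<epsilon>\<^sup>2 * ?I\<^sup>2 \<le> e\<^sup>2 / 4"
  proof -
    show "\<epsilon> > 0"
      using I assms(3) by (simp add: \<epsilon>_def)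
    then have "\<epsilon>\<^sup>2 \<le> (1 / 2)\<^sup>2"
      by (intro power_mono) (auto simp: \<epsilon>_def)
    then show "\<epsilon>\<^sup>2 \<le> 1 / 4"
      by (simp add: power2_eq_square)
    have "(\<epsilon> * (4 * ?I))\<^sup>2 \<le> e\<^sup>2"
      using \<open>\<epsilon> > 0\<close> I by (intro power_mono) (auto simp: \<epsilon>_def min_def field_simps)
    then show "4 * \<epsilon>\<^sup>2 * ?I\<^sup>2 \<le> e\<^sup>2 / 4"
      by (simp add: power_mult_distrib)
  qed
  define E where "E q w = adj2 (M p (1 / w)) ** (\<Phi> q w - \<Phi> p w) ** G p w" for q w
  have "continuous_on (\<Omega> \<times> sphere 0 R) (\<lambda>x. E (fst x) (snd x))"
    unfolding E_def
  proof (intro continuous_intros)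
    show "continuous_on (\<Omega> \<times> sphere 0 R) (\<lambda>x. \<Phi> (fst x) (snd x))"
    proof -
      have "\<Omega> \<times> sphere 0 R \<subseteq> \<Omega> \<times> (- {0})"
        using assms(2) by auto
      from continuous_on_subset[OF cont_\<Phi> this] show ?thesis
        by (simp add: case_prod_unfold)
    qed
    show "continuous_on (\<Omega> \<times> sphere 0 R) (\<lambda>x. \<Phi> p (snd x))"
      by (rule continuous_on_compose2[OF cont_\<Phi>_sphere[OF assms(1,2)]]) (auto intro!: continuous_intros)
    show "continuous_on (\<Omega> \<times> sphere 0 R) (\<lambda>x. G p (snd x))"
      by (rule continuous_on_compose2[OF cont_G[OF assms(1)]]) (auto intro!: continuous_intros)
    show "continuous_on (\<Omega> \<times> sphere 0 R) (\<lambda>x. M p (1 / snd x))"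
      by (rule continuous_on_compose2[OF cont_M[OF assms(1)]]) (use assms(2) in \<open>auto intro!: continuous_intros\<close>)
  qed
  moreover have "0 < \<epsilon> / K"
    using \<epsilon>(1) K(1) by simp
  ultimately obtain X0 where X0: "p \<in> X0" "open X0"
    "\<forall>q\<in>X0 \<inter> \<Omega>. \<forall>w\<in>sphere 0 R. dist (E (fst (q, w)) (snd (q, w))) (E (fst (p, w)) (snd (p, w))) \<le> \<epsilon> / K"
    by (rule continuous_on_prod_compactE[OF _ compact_sphere assms(1)])
  have "norm (adj2 (G p z) ** G q z - mat 1) \<le> e" if q: "q \<in> X0" "q \<in> \<Omega>" and z: "norm z \<le> R / 2" for q z
  proof (rule pointwise_estimate[OF assms(1) q(2) assms(2) z assms(3)])
    have "circle_mean R (\<lambda>w. (norm (adj2 (G p w) ** G q w - mat 1))\<^sup>2) \<le> 4 * \<epsilon>\<^sup>2 * ?I\<^sup>2"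
    proof (rule L2_estimate[OF assms(1) q(2) assms(2) _ \<epsilon>(2)])
      fix w :: complex assume w: "norm w = R"
      have "E p w = 0"
        by (simp add: E_def matrix_matrix_mult_def vec_eq_iff)
      then have "norm (E q w) \<le> \<epsilon> / K"
        using X0(3)[rule_format, of q w] q w by simp
      have "G p w ** (adj2 (G p w) ** G q w) = G q w"
        by (simp add: matrix_mul_assoc adj2_mult[OF det_G[OF assms(1)]])
      then have eq: "adj2 (M p (1 / w)) ** (\<Phi> q w - \<Phi> p w) ** G q w = E q w ** (adj2 (G p w) ** G q w)"
        by (simp add: E_def matrix_mul_assoc[symmetric])
      have "norm (adj2 (M p (1 / w)) ** (\<Phi> q w - \<Phi> p w) ** G q w)
          \<le> norm (E q w) * norm (adj2 (G p w) ** G q w) * K"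
        unfolding eq by (rule K(2))
      also have "\<dots> \<le> \<epsilon> / K * norm (adj2 (G p w) ** G q w) * K"
        using \<open>norm (E q w) \<le> \<epsilon> / K\<close> K(1) by (intro mult_right_mono) auto
      finally show "norm (adj2 (M p (1 / w)) ** (\<Phi> q w - \<Phi> p w) ** G q w) \<le> \<epsilon> * norm (adj2 (G p w) ** G q w)"
        using K(1) by simp
    qed (use \<epsilon> in auto)
    with \<epsilon>(3) show "circle_mean R (\<lambda>w. (norm (adj2 (G p w) ** G q w - mat 1))\<^sup>2) \<le> e\<^sup>2 / 4"
      by simp
  qed
  with X0(1,2) show ?thesis
    by (auto simp: eventually_at_topological)
qed

lemma continuous_G: "continuous_on (\<Omega> \<times> UNIV) (\<lambda>x. G (fst x) (snd x))"
  unfolding continuous_on_def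
proof
  fix x :: "'p \<times> complex" assume "x \<in> \<Omega> \<times> UNIV"
  then obtain p z where x: "x = (p, z)" "p \<in> \<Omega>"
    by auto
  \<comment> \<open>With this radius the unit disc around z lies in the disc of radius R/2, where
    the estimate holds.\<close>
  define R where "R = 2 * (norm z + 1)"
  have R: "R > 0"
    by (simp add: R_def add_nonneg_pos)
  define D where "D y = adj2 (G p (snd y)) ** G (fst y) (snd y) - mat 1" for y :: "'p \<times> complex"
  have "(D \<longlongrightarrow> 0) (at x within \<Omega> \<times> UNIV)"
  proof (rule tendstoI)
    fix e :: real assume "e > 0"
    from transition_close[OF x(2) R, of "e / 2"] \<open>e > 0\<close>
    obtain S where S: "open S" "p \<in> S" "\<And>q z. q \<in> S \<Longrightarrow> q \<in> \<Omega> \<Longrightarrow> q \<noteq> p \<Longrightarrow> norm z \<le> R / 2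
        \<Longrightarrow> norm (adj2 (G p z) ** G q z - mat 1) \<le> e / 2"
      unfolding eventually_at_topological by auto
    have "dist (D y) 0 < e" if "y \<in> S \<times> ball z 1" "y \<in> \<Omega> \<times> UNIV" for y
    proof (cases "fst y = p")
      \<comment> \<open>The filter \<open>at p\<close> leaves out q = p; there the transition is
        exactly I.\<close>
      case True
      then show ?thesis
        using \<open>e > 0\<close> x(2) by (simp add: D_def adj2_mult det_G)
    next
      case False
      have "norm (snd y) \<le> norm z + norm (snd y - z)"
        by (rule norm_triangle_sub)
      also have "\<dots> \<le> R / 2"
        using that by (auto simp: R_def dist_norm norm_minus_commute)
      finally have "norm (D y) \<le> e / 2"
        using S(3)[of "fst y" "snd y"] that False by (auto simp: D_def)
      then show ?thesis
        using \<open>e > 0\<close> by simp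
    qed
    moreover have "open (S \<times> ball z 1)" "x \<in> S \<times> ball z 1"
      using S x by (auto intro: open_Times)
    ultimately show "\<forall>\<^sub>F y in at x within \<Omega> \<times> UNIV. dist (D y) 0 < e"
      unfolding eventually_at_topological by blast
  qed
  moreover have "((\<lambda>y. G p (snd y)) \<longlongrightarrow> G p z) (at x within \<Omega> \<times> UNIV)"
  proof -
    have "continuous_on (\<Omega> \<times> UNIV) (\<lambda>y. G p (snd y))"
      by (rule continuous_on_compose2[OF cont_G[OF x(2)]]) (auto intro!: continuous_intros)
    then show ?thesis
      using x by (auto simp: continuous_on_def)
  qed
  ultimately have "((\<lambda>y. G p (snd y) ** (mat 1 + D y)) \<longlongrightarrow> G p z ** (mat 1 + 0)) (at x within \<Omega> \<times> UNIV)"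
    by (intro bounded_bilinear.tendsto[OF bounded_bilinear_mat2_mult] tendsto_intros)
  moreover have "G p (snd y) ** (mat 1 + D y) = G (fst y) (snd y)" for y
    by (simp add: D_def matrix_mul_assoc adj2_mult[OF det_G[OF x(2)]])
  ultimately show "((\<lambda>x. G (fst x) (snd x)) \<longlongrightarrow> G (fst x) (snd x)) (at x within \<Omega> \<times> UNIV)"
    by (simp add: x)
qed

end

section \<open>Derivatives of the Birkhoff factor and the gain of regularity\<close>

context birkhoff_family
begin

definition d\<Phi> :: "'p \<Rightarrow> complex \<Rightarrow> 'p \<Rightarrow> mat2" where
  "d\<Phi> p w v = frechet_derivative (\<lambda>x. \<Phi> (fst x) (snd x)) (at (p, w)) (v, 0)"

lemma smooth_\<Phi>': "Ck_on k (\<Omega> \<times> (- {0})) (\<lambda>x. \<Phi> (fst x) (snd x))"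
  using smooth_\<Phi> by (simp add: smooth_on_def case_prod_unfold)

lemma has_derivative_\<Phi>:
  assumes "q \<in> \<Omega>" "w \<noteq> 0"
  shows "((\<lambda>q. \<Phi> q w) has_derivative d\<Phi> q w) (at q)"
proof -
  have "((\<lambda>x. \<Phi> (fst x) (snd x)) has_derivative frechet_derivative (\<lambda>x. \<Phi> (fst x) (snd x)) (at (q, w))) (at (q, w))"
    by (rule Ck_on_Suc_has_derivative[OF smooth_\<Phi>']) (use assms in auto)
  from has_derivative_compose[where f="\<lambda>q. (q, w)",
      OF has_derivative_Pair[OF has_derivative_ident has_derivative_const] this]
  show ?thesis
    unfolding d\<Phi>_def by simp
qed

lemma Ck_d\<Phi>: "Ck_on k (\<Omega> \<times> (- {0})) (\<lambda>x. d\<Phi> (fst x) (snd x) v)"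
  unfolding d\<Phi>_def prod.collapse by (rule Ck_on_Suc_frechet_derivative[OF smooth_\<Phi>'])

text \<open>The formal derivative of \<open>difference_formula\<close> at q = p. The minus factor is
  written as \<Phi> G, which leaves G as the only ingredient of unknown regularity and lets the
  induction on the order close.\<close>

definition dG1 :: "real \<Rightarrow> 'p \<Rightarrow> complex \<Rightarrow> 'p \<Rightarrow> mat2" where
  "dG1 R p z v = - (G p z ** circle_mean R (\<lambda>w. cscale (w / (w - z))
     (adj2 (\<Phi> p w ** G p w) ** d\<Phi> p w v ** G p w)))"

text \<open>The difference formula still contains \<open>G q\<close>, which is only known to be continuous. Decoupling the two
  occurrences of \<open>q\<close> helps: \<open>f q' p = 0\<close> for all \<open>q'\<close>, so the diagonal map is differentiable at \<open>p\<close>.\<close>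

lemma has_derivative_G_fst:
  assumes "p \<in> \<Omega>" "norm z < R"
  shows "((\<lambda>q. G q z) has_derivative dG1 R p z) (at p)"
proof -
  have R: "R > 0"
    using assms(2) norm_ge_zero[of z] by linarith
  define \<kappa> where "\<kappa> w = w / (w - z)" for w
  define P where "P w = adj2 (M p (1 / w))" for w
  define f where "f q' q = circle_mean R (\<lambda>w. cscale (\<kappa> w) (P w ** (\<Phi> q w - \<Phi> p w) ** G q' w))" for q' q
  define f' where "f' q' q v = circle_mean R (\<lambda>w. cscale (\<kappa> w) (P w ** d\<Phi> q w v ** G q' w))" for q' q v
  let ?c = "circlepath 0 R"
  have cnz: "?c t \<noteq> 0" for t
    using circlepath_nonzero R by simp
  have cont\<kappa>: "continuous_on A (\<lambda>x. \<kappa> (?c (g x)))" if "continuous_on A g" for A and g :: "'x::topological_space \<Rightarrow> real"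
    unfolding \<kappa>_def
  proof (intro continuous_intros continuous_on_compose2[OF continuous_on_circlepath that, of UNIV] ballI)
    show "?c (g x) - z \<noteq> 0" for x
      using norm_circlepath[OF R, of "g x"] assms(2) by auto
  qed auto
  have contP: "continuous_on A (\<lambda>x. P (?c (g x)))" if "continuous_on A g" for A and g :: "'x::topological_space \<Rightarrow> real"
    unfolding P_def
    by (intro continuous_intros continuous_on_compose2[OF cont_M[OF assms(1), of UNIV]]
        continuous_on_compose2[OF continuous_on_circlepath that, of UNIV]) (auto simp: cnz)
  have cont\<Phi>: "continuous_on A (\<lambda>x. \<Phi> (h x) (?c (g x)))"
    if "continuous_on A g" "continuous_on A h" "h ` A \<subseteq> \<Omega>" for A and g :: "'x::topological_space \<Rightarrow> real" and h
    using continuous_on_compose2[OF Ck_on_imp_continuous_on[OF smooth_\<Phi>'],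
        OF continuous_on_Pair[OF that(2) continuous_on_compose2[OF continuous_on_circlepath that(1) subset_UNIV]]]
      that(3) cnz by (simp add: image_subset_iff)
  have contd\<Phi>: "continuous_on A (\<lambda>x. d\<Phi> (h x) (?c (g x)) v)"
    if "continuous_on A g" "continuous_on A h" "h ` A \<subseteq> \<Omega>" for A v and g :: "'x::topological_space \<Rightarrow> real" and h
    using continuous_on_compose2[OF Ck_on_imp_continuous_on[OF Ck_d\<Phi>],
        OF continuous_on_Pair[OF that(2) continuous_on_compose2[OF continuous_on_circlepath that(1) subset_UNIV]]]
      that(3) cnz by (simp add: image_subset_iff)
  have contG: "continuous_on A (\<lambda>x. G (h x) (?c (g x)))"
    if "continuous_on A g" "continuous_on A h" "h ` A \<subseteq> \<Omega>" for A and g :: "'x::topological_space \<Rightarrow> real" and h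
    using continuous_on_compose2[OF continuous_G,
        OF continuous_on_Pair[OF that(2) continuous_on_compose2[OF continuous_on_circlepath that(1) subset_UNIV]]]
      that(3) by (simp add: image_subset_iff)
  have f_deriv: "(f q' has_derivative f' q' q) (at q)" if q: "q' \<in> \<Omega>" "q \<in> \<Omega>" for q' q
    unfolding f_def f'_def circle_mean_def
  proof (rule has_derivative_integral_param[OF open_\<Omega> q(2)])
    fix r t assume r: "r \<in> \<Omega>"
    have "((\<lambda>q. \<Phi> q (?c t) - \<Phi> p (?c t)) has_derivative (\<lambda>v. d\<Phi> r (?c t) v - 0)) (at r)"
      by (intro has_derivative_diff has_derivative_\<Phi> r cnz has_derivative_const)
    then have 1: "((\<lambda>q. \<Phi> q (?c t) - \<Phi> p (?c t)) has_derivative d\<Phi> r (?c t)) (at r)"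
      by simp
    have 2: "bounded_linear (\<lambda>X. cscale (\<kappa> (?c t)) (P (?c t) ** X ** G q' (?c t)))"
      by (intro bounded_linear_compose[OF bounded_bilinear.bounded_linear_right[OF bounded_bilinear_cscale]]
          bounded_linear_compose[OF bounded_bilinear.bounded_linear_left[OF bounded_bilinear_mat2_mult]]
          bounded_bilinear.bounded_linear_right[OF bounded_bilinear_mat2_mult])
    show "((\<lambda>q. cscale (\<kappa> (?c t)) (P (?c t) ** (\<Phi> q (?c t) - \<Phi> p (?c t)) ** G q' (?c t))) has_derivative
        (\<lambda>v. cscale (\<kappa> (?c t)) (P (?c t) ** d\<Phi> r (?c t) v ** G q' (?c t)))) (at r)"
      by (rule bounded_linear.has_derivative[OF 2 1])
  next
    fix r assume r: "r \<in> \<Omega>"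
    show "continuous_on {0..1} (\<lambda>t. cscale (\<kappa> (?c t)) (P (?c t) ** (\<Phi> r (?c t) - \<Phi> p (?c t)) ** G q' (?c t)))"
      by (intro continuous_on_cscale continuous_on_mat2_mult continuous_on_diff cont\<kappa> contP cont\<Phi> contG
          continuous_on_id continuous_on_const) (use r q assms(1) in auto)
  next
    fix v
    show "continuous_on (\<Omega> \<times> {0..1}) (\<lambda>(q, t). cscale (\<kappa> (?c t)) (P (?c t) ** d\<Phi> q (?c t) v ** G q' (?c t)))"
      unfolding case_prod_unfold
      by (intro continuous_on_cscale continuous_on_mat2_mult cont\<kappa> contP contd\<Phi> contG
          continuous_on_fst continuous_on_snd continuous_on_id continuous_on_const) (use q in auto)
  qed
  have f'_cont: "continuous_on (\<Omega> \<times> \<Omega>) (\<lambda>x. f' (fst x) (snd x) v)" for v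
  proof -
    have "continuous_on ((\<Omega> \<times> \<Omega>) \<times> cbox 0 1) (\<lambda>(x, t). cscale (\<kappa> (?c t)) (P (?c t) ** d\<Phi> (snd x) (?c t) v ** G (fst x) (?c t)))"
      unfolding case_prod_unfold
      by (intro continuous_on_cscale continuous_on_mat2_mult cont\<kappa> contP contd\<Phi> contG
          continuous_on_fst continuous_on_snd continuous_on_id continuous_on_const) auto
    from integral_continuous_on_param[OF this] show ?thesis
      unfolding f'_def circle_mean_def by simp
  qed
  obtain e where e: "e > 0" "ball p e \<subseteq> \<Omega>"
    using open_\<Omega> assms(1) open_contains_ball by blast
  let ?B = "ball p e"
  define F' where "F' q' q = Blinfun (f' q' q)" for q' q
  have F': "blinfun_apply (F' q' q) = f' q' q" if "q' \<in> \<Omega>" "q \<in> \<Omega>" for q' q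
    unfolding F'_def by (rule bounded_linear_Blinfun_apply[OF has_derivative_bounded_linear[OF f_deriv[OF that]]])
  have "((\<lambda>(x, y). f x y) has_derivative (\<lambda>(tx, ty). 0 + F' p p ty)) (at (p, p) within ?B \<times> ?B)"
  proof (rule has_derivative_partialsI[where f=f and fx="\<lambda>_. 0" and fy=F'])
    have "f q' p = 0" for q'
      by (simp add: f_def cscale_def matrix_matrix_mult_def zero_vec_def[symmetric])
    then show "((\<lambda>x. f x p) has_derivative (\<lambda>x. 0)) (at p within ?B)"
      by simp
    show "(f x has_derivative blinfun_apply (F' x y)) (at y within ?B)" if "x \<in> ?B" "y \<in> ?B" for x y
    proof -
      have "x \<in> \<Omega>" "y \<in> \<Omega>"
        using that e by auto
      then show ?thesis
        using has_derivative_at_withinI[OF f_deriv[of x y]] F'[of x y] by simp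
    qed
    have "continuous_on (?B \<times> ?B) (\<lambda>(x, y). F' x y)"
    proof (rule continuous_on_blinfun_componentwise)
      fix i :: 'p
      have "continuous_on (?B \<times> ?B) (\<lambda>x. f' (fst x) (snd x) i)"
        by (rule continuous_on_subset[OF f'_cont]) (use e in auto)
      then show "continuous_on (?B \<times> ?B) (\<lambda>x. blinfun_apply (case x of (x, y) \<Rightarrow> F' x y) i)"
      proof (rule continuous_on_eq)
        fix x assume "x \<in> ?B \<times> ?B"
        then have "fst x \<in> \<Omega>" "snd x \<in> \<Omega>"
          using e by auto
        then show "f' (fst x) (snd x) i = blinfun_apply (case x of (x, y) \<Rightarrow> F' x y) i"
          by (simp add: case_prod_unfold F')
      qed
    qed
    then show "continuous (at (p, p) within ?B \<times> ?B) (\<lambda>(x, y). F' x y)"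
      using e(1) by (simp add: continuous_on_eq_continuous_within)
  qed (use e in auto)
  moreover have "at (p, p) within ?B \<times> ?B = at (p, p)"
    by (rule at_within_open) (use e in \<open>auto intro: open_Times\<close>)
  ultimately have "((\<lambda>x. f (fst x) (snd x)) has_derivative (\<lambda>v. f' p p (snd v))) (at (p, p))"
    by (simp add: case_prod_unfold F' assms(1))
  from has_derivative_compose[where f="\<lambda>q. (q, q)", OF has_derivative_Pair[OF has_derivative_ident has_derivative_ident] this]
  have S: "((\<lambda>q. f q q) has_derivative f' p p) (at p)"
    by simp
  have "((\<lambda>q. mat 1 - f q q) has_derivative (\<lambda>v. 0 - f' p p v)) (at p)"
    by (intro has_derivative_diff S has_derivative_const)
  from bounded_linear.has_derivative[OF bounded_bilinear.bounded_linear_right[OF bounded_bilinear_mat2_mult] this, of "G p z"]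
  have "((\<lambda>q. G p z ** (mat 1 - f q q)) has_derivative (\<lambda>v. G p z ** (0 - f' p p v))) (at p)" .
  then have "((\<lambda>q. G q z) has_derivative (\<lambda>v. G p z ** (0 - f' p p v))) (at p)"
  proof (rule has_derivative_transform_within_open[OF _ open_\<Omega> assms(1)])
    show "G p z ** (mat 1 - f q q) = G q z" if "q \<in> \<Omega>" for q
      using difference_formula[OF assms(1) that assms(2)] by (simp add: f_def \<kappa>_def P_def)
  qed
  then show ?thesis
  proof (rule has_derivative_eq_rhs[OF _ ext])
    fix v
    have "f' p p v = circle_mean R (\<lambda>w. cscale (w / (w - z)) (adj2 (\<Phi> p w ** G p w) ** d\<Phi> p w v ** G p w))"
      unfolding f'_def
    proof (rule circle_mean_cong[OF R])
      fix w :: complex assume "norm w = R"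
      then have "w \<noteq> 0"
        using R by auto
      then show "cscale (\<kappa> w) (P w ** d\<Phi> p w v ** G p w)
        = cscale (w / (w - z)) (adj2 (\<Phi> p w ** G p w) ** d\<Phi> p w v ** G p w)"
        by (simp add: \<kappa>_def P_def factorization[OF assms(1)])
    qed
    moreover have "G p z ** (0 - X) = - (G p z ** X)" for X
      by (simp add: vec_eq_iff matrix_matrix_mult_def sum_negf)
    ultimately show "G p z ** (0 - f' p p v) = dG1 R p z v"
      by (simp add: dG1_def)
  qed
qed

definition dG2 :: "real \<Rightarrow> 'p \<Rightarrow> complex \<Rightarrow> complex \<Rightarrow> mat2" where
  "dG2 R p z \<zeta> = circle_mean R (\<lambda>w. cscale (\<zeta> * (w / (w - z)\<^sup>2)) (G p w))"

text \<open>Differentiating the kernel instead of G expresses the z-derivative as a mean of G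
  itself, so that it is as smooth in (p, z) as G.\<close>

lemma has_derivative_G_snd:
  assumes "p \<in> \<Omega>" "norm z < R"
  shows "(G p has_derivative dG2 R p z) (at z)"
proof -
  have R: "R > 0"
    using assms(2) norm_ge_zero[of z] by linarith
  let ?c = "circlepath 0 R"
  have nz: "?c t - \<zeta> \<noteq> 0" if "\<zeta> \<in> ball 0 R" for t and \<zeta> :: complex
    using norm_circlepath[OF R, of t] that by auto
  have "((\<lambda>\<zeta>. integral {0..1} (\<lambda>t. cscale (?c t / (?c t - \<zeta>)) (G p (?c t)))) has_derivative
      (\<lambda>v. integral {0..1} (\<lambda>t. cscale (v * (?c t / (?c t - z)\<^sup>2)) (G p (?c t))))) (at z)"
  proof (rule has_derivative_integral_param[of "ball 0 R"])
    fix \<zeta> :: complex and t assume \<zeta>: "\<zeta> \<in> ball 0 R"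
    have "((\<lambda>\<zeta> :: complex. ?c t / (?c t - \<zeta>)) has_field_derivative ?c t / (?c t - \<zeta>)\<^sup>2) (at \<zeta>)"
      using nz[OF \<zeta>] by (auto intro!: derivative_eq_intros simp: power2_eq_square)
    then have 1: "((\<lambda>\<zeta>. ?c t / (?c t - \<zeta>)) has_derivative (\<lambda>v. v * (?c t / (?c t - \<zeta>)\<^sup>2))) (at \<zeta>)"
      unfolding has_field_derivative_def by (rule has_derivative_eq_rhs[OF _ ext]) (rule mult.commute)
    show "((\<lambda>\<zeta>. cscale (?c t / (?c t - \<zeta>)) (G p (?c t))) has_derivative
        (\<lambda>v. cscale (v * (?c t / (?c t - \<zeta>)\<^sup>2)) (G p (?c t)))) (at \<zeta>)"
      by (rule bounded_linear.has_derivative[OF bounded_bilinear.bounded_linear_left[OF bounded_bilinear_cscale] 1])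
  next
    fix \<zeta> :: complex assume \<zeta>: "\<zeta> \<in> ball 0 R"
    show "continuous_on {0..1} (\<lambda>t. cscale (?c t / (?c t - \<zeta>)) (G p (?c t)))"
      by (intro continuous_on_cscale continuous_on_divide continuous_on_diff continuous_on_const continuous_on_circlepath
          continuous_on_compose2[OF cont_G[OF assms(1), of UNIV] continuous_on_circlepath]) (use nz[OF \<zeta>] in auto)
  next
    fix v
    have cc: "continuous_on (ball 0 R \<times> {0..1}) (\<lambda>x :: complex \<times> real. ?c (snd x))"
      by (rule continuous_on_compose2[OF continuous_on_circlepath continuous_on_snd[OF continuous_on_id] subset_UNIV])
    show "continuous_on (ball 0 R \<times> {0..1}) (\<lambda>(\<zeta>, t). cscale (v * (?c t / (?c t - \<zeta>)\<^sup>2)) (G p (?c t)))"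
      unfolding case_prod_unfold
      by (intro continuous_on_cscale continuous_on_mult continuous_on_divide continuous_on_power continuous_on_diff continuous_on_const cc
          continuous_on_fst continuous_on_id continuous_on_compose2[OF cont_G[OF assms(1), of UNIV] cc]) (use nz in auto)
  qed (use assms(2) in auto)
  then have "((\<lambda>\<zeta>. circle_mean R (\<lambda>w. cscale (w / (w - \<zeta>)) (G p w))) has_derivative dG2 R p z) (at z)"
    by (simp add: circle_mean_def dG2_def[abs_def])
  then show ?thesis
  proof (rule has_derivative_transform_within_open)
    show "circle_mean R (\<lambda>w. cscale (w / (w - \<zeta>)) (G p w)) = G p \<zeta>" if "\<zeta> \<in> ball 0 R" for \<zeta>
      by (rule circle_mean_cauchy_mat2(1)[OF hol_G[OF assms(1)]]) (use that in auto)
  qed (use assms(2) in auto)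
qed

text \<open>Both derivatives are built from circle means of expressions in G and smooth data, hence
  lose no regularity against G: one order is gained per induction step.\<close>

lemma Ck_dG:
  assumes "Ck_on k (\<Omega> \<times> UNIV) (\<lambda>x. G (fst x) (snd x))" "R > 0"
  shows "Ck_on k (\<Omega> \<times> ball 0 R) (\<lambda>x. dG1 R (fst x) (snd x) v)"
    and "Ck_on k (\<Omega> \<times> ball 0 R) (\<lambda>x. dG2 R (fst x) (snd x) \<zeta>)"
proof -
  let ?c = "circlepath 0 R" and ?S = "\<Omega> \<times> ball (0::complex) R"
  have oS: "open ?S" and oT: "open (?S \<times> (UNIV :: real set))" and oC: "open (- {0 :: complex})"
    and o\<Phi>: "open (\<Omega> \<times> (- {0 :: complex}))" and oG: "open (\<Omega> \<times> (UNIV :: complex set))"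
    by (auto intro!: open_Times open_\<Omega>)
  have c: "Ck_on k (?S \<times> UNIV) (\<lambda>y. ?c (snd y))"
    by (rule Ck_on_compose[OF oT open_UNIV Ck_on_circlepath _ subset_UNIV]) (intro Ck_on_snd Ck_on_id oT)
  have z: "Ck_on k (?S \<times> UNIV) (\<lambda>y :: ('p \<times> complex) \<times> real. snd (fst y))"
    by (rule Ck_on_snd[OF oT Ck_on_fst[OF oT Ck_on_id[OF oT]]])
  have p: "Ck_on k (?S \<times> UNIV) (\<lambda>y :: ('p \<times> complex) \<times> real. fst (fst y))"
    by (rule Ck_on_fst[OF oT Ck_on_fst[OF oT Ck_on_id[OF oT]]])
  have pc: "Ck_on k (?S \<times> UNIV) (\<lambda>y. (fst (fst y), ?c (snd y)))"
    by (intro Ck_on_Pair p c oT)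
  have cnz: "?c t \<noteq> 0" for t
    using circlepath_nonzero assms(2) by simp
  have inv: "Ck_on k (?S \<times> UNIV) (\<lambda>y. inverse (?c (snd y) - snd (fst y)))"
  proof (rule Ck_on_inverse[OF oT Ck_on_diff[OF oT c z]])
    show "?c (snd y) - snd (fst y) \<noteq> 0" if "y \<in> ?S \<times> UNIV" for y
      using norm_circlepath[OF assms(2), of "snd y"] that by auto
  qed
  have s1: "(\<lambda>y. (fst (fst y), ?c (snd y))) ` (?S \<times> UNIV) \<subseteq> \<Omega> \<times> (- {0})"
    and s2: "(\<lambda>y. (fst (fst y), ?c (snd y))) ` (?S \<times> UNIV) \<subseteq> \<Omega> \<times> UNIV"
    using cnz by auto
  have G: "Ck_on k (?S \<times> UNIV) (\<lambda>y. G (fst (fst y)) (?c (snd y)))"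
    using Ck_on_compose[OF oT oG assms(1) pc s2] by simp
  have \<Phi>: "Ck_on k (?S \<times> UNIV) (\<lambda>y. \<Phi> (fst (fst y)) (?c (snd y)))"
    using Ck_on_compose[OF oT o\<Phi> smooth_\<Phi>' pc s1] by simp
  have d\<Phi>: "Ck_on k (?S \<times> UNIV) (\<lambda>y. d\<Phi> (fst (fst y)) (?c (snd y)) v)"
    using Ck_on_compose[OF oT o\<Phi> Ck_d\<Phi> pc s1] by simp
  have "Ck_on k (?S \<times> UNIV) (\<lambda>y. cscale (\<zeta> * (?c (snd y) / (?c (snd y) - snd (fst y))\<^sup>2)) (G (fst (fst y)) (?c (snd y))))"
    unfolding divide_inverse power_inverse[symmetric]
    by (intro Ck_on_cscale Ck_on_mult Ck_on_power Ck_on_const oT c inv G)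
  from Ck_on_integral[OF oS this, of 0 1] show "Ck_on k ?S (\<lambda>x. dG2 R (fst x) (snd x) \<zeta>)"
    by (simp add: dG2_def circle_mean_def)
  have "Ck_on k (?S \<times> UNIV) (\<lambda>y. cscale (?c (snd y) / (?c (snd y) - snd (fst y)))
      (adj2 (\<Phi> (fst (fst y)) (?c (snd y)) ** G (fst (fst y)) (?c (snd y))) ** d\<Phi> (fst (fst y)) (?c (snd y)) v
        ** G (fst (fst y)) (?c (snd y))))"
    unfolding divide_inverse
    by (intro Ck_on_cscale Ck_on_mult Ck_on_mat2_mult Ck_on_adj2 oT c inv G \<Phi> d\<Phi>)
  from Ck_on_integral[OF oS this, of 0 1]
  have "Ck_on k ?S (\<lambda>x. circle_mean R (\<lambda>w. cscale (w / (w - snd x))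
      (adj2 (\<Phi> (fst x) w ** G (fst x) w) ** d\<Phi> (fst x) w v ** G (fst x) w)))"
    by (simp add: circle_mean_def)
  then show "Ck_on k ?S (\<lambda>x. dG1 R (fst x) (snd x) v)"
    unfolding dG1_def
    by (intro Ck_on_uminus Ck_on_mat2_mult oS Ck_on_subset[OF assms(1)]) auto
qed

lemma has_derivative_G:
  assumes "p \<in> \<Omega>" "norm z < R"
  shows "((\<lambda>x. G (fst x) (snd x)) has_derivative (\<lambda>v. dG1 R p z (fst v) + dG2 R p z (snd v))) (at (p, z))"
proof -
  have R: "R > 0"
    using assms(2) norm_ge_zero[of z] by linarith
  obtain e where e: "e > 0" "ball p e \<subseteq> \<Omega>"
    using open_\<Omega> assms(1) open_contains_ball by blast
  let ?X = "ball (0 :: complex) R" and ?Y = "ball p e"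
  define F' where "F' z p = Blinfun (dG1 R p z)" for p z
  have F': "blinfun_apply (F' z p) = dG1 R p z" if "p \<in> \<Omega>" "z \<in> ?X" for p z
    unfolding F'_def
    by (rule bounded_linear_Blinfun_apply[OF has_derivative_bounded_linear[OF has_derivative_G_fst[OF that(1)]]])
      (use that in auto)
  \<comment> \<open>The variables are ordered (z, p) because \<open>has_derivative_partialsI\<close>
    takes the continuity of the second partial derivative, here supplied by \<open>Ck_dG\<close> at
    order 0.\<close>
  have "((\<lambda>(z, p). G p z) has_derivative (\<lambda>(tz, tp). dG2 R p z tz + F' z p tp)) (at (z, p) within ?X \<times> ?Y)"
  proof (rule has_derivative_partialsI[where f="\<lambda>z p. G p z" and fx="dG2 R p z" and fy=F'])
    show "((\<lambda>z. G p z) has_derivative dG2 R p z) (at z within ?X)"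
      by (rule has_derivative_at_withinI[OF has_derivative_G_snd[OF assms]])
    show "((\<lambda>p. G p x) has_derivative blinfun_apply (F' x y)) (at y within ?Y)" if "x \<in> ?X" "y \<in> ?Y" for x y
    proof -
      have "y \<in> \<Omega>" "norm x < R"
        using that e by auto
      then show ?thesis
        using has_derivative_at_withinI[OF has_derivative_G_fst, of y x R] F'[of y x] that by simp
    qed
    have "continuous_on (?X \<times> ?Y) (\<lambda>(z, p). F' z p)"
    proof (rule continuous_on_blinfun_componentwise)
      fix i :: 'p
      have "Ck_on 0 (\<Omega> \<times> UNIV) (\<lambda>x. G (fst x) (snd x))"
        using continuous_G by simp
      from Ck_on_imp_continuous_on[OF Ck_dG(1)[OF this R]]
      have "continuous_on (\<Omega> \<times> ?X) (\<lambda>x. dG1 R (fst x) (snd x) i)" .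
      moreover have "continuous_on (?X \<times> ?Y) (\<lambda>x. (snd x, fst x))"
        by (intro continuous_intros)
      ultimately have "continuous_on (?X \<times> ?Y) (\<lambda>x. dG1 R (fst (snd x, fst x)) (snd (snd x, fst x)) i)"
        by (rule continuous_on_compose2) (use e in auto)
      then show "continuous_on (?X \<times> ?Y) (\<lambda>x. blinfun_apply (case x of (z, p) \<Rightarrow> F' z p) i)"
      proof (rule continuous_on_eq)
        fix x assume "x \<in> ?X \<times> ?Y"
        then have "fst x \<in> ?X" "snd x \<in> \<Omega>"
          using e by auto
        then show "dG1 R (fst (snd x, fst x)) (snd (snd x, fst x)) i = blinfun_apply (case x of (z, p) \<Rightarrow> F' z p) i"
          by (simp add: case_prod_unfold F')
      qed
    qed
    then show "continuous (at (z, p) within ?X \<times> ?Y) (\<lambda>(z, p). F' z p)"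
      using e(1) assms(2) by (simp add: continuous_on_eq_continuous_within)
  qed (use e in auto)
  moreover have "at (z, p) within ?X \<times> ?Y = at (z, p)"
    by (rule at_within_open) (use e assms in \<open>auto intro: open_Times\<close>)
  ultimately have "((\<lambda>x. G (snd x) (fst x)) has_derivative (\<lambda>v. dG2 R p z (fst v) + dG1 R p z (snd v))) (at (z, p))"
    using assms by (simp add: case_prod_unfold F')
  moreover have "((\<lambda>x. (snd x, fst x)) has_derivative (\<lambda>v. (snd v, fst v))) (at (p, z))"
    by (intro has_derivative_Pair has_derivative_fst has_derivative_snd has_derivative_ident)
  ultimately show ?thesis
    using has_derivative_compose[of "\<lambda>x. (snd x, fst x)" "\<lambda>v. (snd v, fst v)" "(p, z)" UNIV "\<lambda>x. G (snd x) (fst x)"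
        "\<lambda>v. dG2 R p z (fst v) + dG1 R p z (snd v)"]
    by (simp add: add.commute)
qed

theorem Ck_G: "Ck_on k (\<Omega> \<times> UNIV) (\<lambda>x. G (fst x) (snd x))"
proof (induction k)
  case 0
  then show ?case
    using continuous_G by simp
next
  case (Suc k)
  show ?case
  proof (rule Ck_on_local)
    fix x :: "'p \<times> complex" assume x: "x \<in> \<Omega> \<times> UNIV"
    define R where "R = norm (snd x) + 1"
    have R: "R > 0"
      by (simp add: R_def add_nonneg_pos)
    have oS: "open (\<Omega> \<times> ball 0 R)"
      by (intro open_Times open_\<Omega> open_ball)
    have "Ck_on (Suc k) (\<Omega> \<times> ball 0 R) (\<lambda>x. G (fst x) (snd x))"
    proof (rule Ck_on_SucI[OF oS])
      show "((\<lambda>x. G (fst x) (snd x)) has_derivative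
          (\<lambda>v. dG1 R (fst y) (snd y) (fst v) + dG2 R (fst y) (snd y) (snd v))) (at y)" if "y \<in> \<Omega> \<times> ball 0 R" for y
        using has_derivative_G[of "fst y" "snd y" R] that by auto
      show "Ck_on k (\<Omega> \<times> ball 0 R) (\<lambda>y. dG1 R (fst y) (snd y) (fst v) + dG2 R (fst y) (snd y) (snd v))" for v
        by (intro Ck_on_add oS Ck_dG Suc.IH R)
    qed
    then show "\<exists>T. open T \<and> x \<in> T \<and> Ck_on (Suc k) T (\<lambda>x. G (fst x) (snd x))"
      using oS x by (intro exI[of _ "\<Omega> \<times> ball 0 R"]) (auto simp: R_def)
  qed
qed

end

subsection \<open>Cuspidal edges from a moving frame\<close>

lemma bounded_linear_L3_coords: "bounded_linear L3_coords"
  unfolding linear_conv_bounded_linear[symmetric] linear_iff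
  by (auto simp: L3_coords_def lorentz_inner_def trace_def sum_2 mat2_mult_nth e0_def e1_def e2_def
      algebra_simps add_divide_distrib diff_divide_distrib)

lemma L3_coords_mat22: "L3_coords A = (Re (A $ 2 $ 1 - A $ 1 $ 2) / 2, Re (A $ 1 $ 2 + A $ 2 $ 1) / 2,
    Re (A $ 2 $ 2 - A $ 1 $ 1) / 2)"
  by (simp add: L3_coords_def lorentz_inner_def trace_def sum_2 mat2_mult_nth e0_def e1_def e2_def field_simps)

text \<open>The three vectors are the images of diag (1, -1), E_12 and E_21 under conjugation by
  F.\<close>

lemma L3_coords_conj:
  fixes a b c d :: real
  assumes "F $ 1 $ 1 = a" "F $ 1 $ 2 = b" "F $ 2 $ 1 = c" "F $ 2 $ 2 = d" "Z $ 2 $ 2 = - Z $ 1 $ 1"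
  shows "L3_coords (F ** Z ** adj2 F) = Re (Z $ 1 $ 1) *\<^sub>R (c * d + a * b, c * d - a * b, - (a * d + b * c))
    + Re (Z $ 1 $ 2) *\<^sub>R (- (c * c + a * a) / 2, (a * a - c * c) / 2, a * c)
    + Re (Z $ 2 $ 1) *\<^sub>R ((d * d + b * b) / 2, (d * d - b * b) / 2, - (b * d))"
  using assms by (simp add: L3_coords_mat22 mat2_mult_nth) (simp add: field_simps)

text \<open>The map sending A to F A adj2 F has determinant (det F)^3 on traceless matrices; 1/2 is
  the determinant of the three basis vectors for F = I.\<close>

lemma det3_frame:
  assumes "a * d - b * c = 1"
  shows "det3 ((d * d + b * b) / 2, (d * d - b * b) / 2, - (b * d)) (c * d + a * b, c * d - a * b, - (a * d + b * c))
    (- (c * c + a * a) / 2, (a * a - c * c) / 2, a * c) = 1 / 2" (is "?D = _")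
proof -
  have "?D = (a * d - b * c) ^ 3 / 2"
    by (simp add: det3_def power3_eq_cube) (simp add: field_simps)
  with assms show ?thesis
    by simp
qed

lemma det3_swap: "det3 w v u = - det3 u v w"
  by (simp add: det3_def algebra_simps)

lemma adj2_mult_rev: "adj2 (A ** B) = adj2 B ** adj2 A"
  by (simp add: mat2_eq_iff mat2_mult_nth algebra_simps)

lemma adj2_traceless: "trace A = 0 \<Longrightarrow> adj2 A = - A"
  by (auto simp: mat2_eq_iff trace_def sum_2 add_eq_0_iff)

lemma smooth_on_bounded_linear:
  "bounded_linear L \<Longrightarrow> open S \<Longrightarrow> smooth_on S f \<Longrightarrow> smooth_on S (\<lambda>x. L (f x))"
  unfolding smooth_on_def using Ck_on_bounded_linear by blast

text \<open>\<xi> = Ad_F E has derivative Ad_F [U, E]. Modulo E this commutator is, up to sign, diag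
  (1, -1) times the off-diagonal entry of U opposite to E. So \<xi>, its derivative and the other
  partial derivative of f are independent, as images of a basis under Ad_F. The two alternatives for
  E belong to the zeros of \<beta> and of \<gamma>.\<close>

theorem cuspidal_edge_of_frame:
  fixes f F :: "real \<times> real \<Rightarrow> mat2" and b :: "real \<times> real \<Rightarrow> real"
  assumes "open S" "(x0, y0) \<in> S" "smooth_on S f" "smooth_on S F" "smooth_on S b"
    and F0: "det (F (x0, y0)) = 1" "\<And>i j. F (x0, y0) $ i $ j \<in> \<real>"
    and U: "pd1 F (x0, y0) = F (x0, y0) ** U" "trace U = 0"
    and f1: "\<And>p. p \<in> S \<Longrightarrow> pd1 f p = b p *\<^sub>R (F p ** E ** adj2 (F p))"
    and f2: "pd2 f (x0, y0) = c *\<^sub>R (F (x0, y0) ** E' ** adj2 (F (x0, y0)))" "c \<noteq> 0"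
    and b: "\<And>y. (x0, y) \<in> S \<Longrightarrow> b (x0, y) = 0" "pd1 b (x0, y0) \<noteq> 0"
    and E: "E = mat22 0 0 1 0 \<and> E' = mat22 0 1 0 0 \<and> Re (U $ 1 $ 2) \<noteq> 0 \<or>
            E = mat22 0 1 0 0 \<and> E' = mat22 0 0 1 0 \<and> Re (U $ 2 $ 1) \<noteq> 0"
  shows "cuspidal_edge_at (\<lambda>p. L3_coords (f p)) (x0, y0)"
proof -
  define \<xi> where "\<xi> p = F p ** E ** adj2 (F p)" for p
  have F_Ck: "Ck_on k S F" for k
    using assms(4) by (simp add: smooth_on_def)
  have \<xi>_smooth: "smooth_on S \<xi>"
    unfolding smooth_on_def \<xi>_def
    by (intro allI Ck_on_mat2_mult Ck_on_adj2 Ck_on_const assms(1) F_Ck)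
  note L = bounded_linear_L3_coords
  have L1: "frechet_derivative (\<lambda>p. L3_coords (h p)) (at p) v = L3_coords (frechet_derivative h (at p) v)"
    if "smooth_on S h" "p \<in> S" for h :: "real \<times> real \<Rightarrow> mat2" and p v
    using fun_cong[OF frechet_derivative_at[OF bounded_linear.has_derivative[OF L smooth_on_has_derivative[OF that]]], of v]
    by simp
  define F0 where "F0 = F (x0, y0)"
  have dF: "((\<lambda>x. F (x, y0)) has_vector_derivative F0 ** U) (at x0)"
    using has_vector_derivative_pd1[OF smooth_on_has_derivative[OF assms(4,2)]] U(1) by (simp add: F0_def)
  have dF': "((\<lambda>x. adj2 (F (x, y0))) has_vector_derivative - (U ** adj2 F0)) (at x0)"
  proof -
    have "adj2 (F0 ** U) = - (U ** adj2 F0)"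
      unfolding adj2_mult_rev adj2_traceless[OF U(2)] by (simp add: mat2_eq_iff mat2_mult_nth)
    then show ?thesis
      using bounded_linear.has_vector_derivative[OF bounded_linear_adj2 dF] by simp
  qed
  have "((\<lambda>x. F (x, y0) ** E) has_vector_derivative F0 ** U ** E) (at x0)"
    using bounded_linear.has_vector_derivative[OF bounded_bilinear.bounded_linear_left[OF bounded_bilinear_mat2_mult] dF] .
  from bounded_bilinear.has_vector_derivative[OF bounded_bilinear_mat2_mult this dF']
  have "((\<lambda>x. \<xi> (x, y0)) has_vector_derivative F0 ** E ** - (U ** adj2 F0) + F0 ** U ** E ** adj2 F0) (at x0)"
    by (simp add: \<xi>_def F0_def)
  moreover have "F0 ** E ** - (U ** adj2 F0) + F0 ** U ** E ** adj2 F0 = F0 ** (U ** E - E ** U) ** adj2 F0"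
    by (simp add: mat2_eq_iff mat2_mult_nth algebra_simps)
  ultimately have pd1_\<xi>: "pd1 \<xi> (x0, y0) = F0 ** (U ** E - E ** U) ** adj2 F0"
    using vector_derivative_unique_at[OF has_vector_derivative_pd1[OF smooth_on_has_derivative[OF \<xi>_smooth assms(2)]]]
    by metis
  define a1 a2 a3 a4 where "a1 = Re (F0 $ 1 $ 1)" "a2 = Re (F0 $ 1 $ 2)" "a3 = Re (F0 $ 2 $ 1)" "a4 = Re (F0 $ 2 $ 2)"
  have a: "F0 $ 1 $ 1 = a1" "F0 $ 1 $ 2 = a2" "F0 $ 2 $ 1 = a3" "F0 $ 2 $ 2 = a4"
    using F0(2) by (simp_all add: F0_def a1_a2_a3_a4_def)
  have "complex_of_real (a1 * a4 - a2 * a3) = 1"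
    using F0(1) a by (simp add: det_2 F0_def)
  then have det: "a1 * a4 - a2 * a3 = 1"
    using of_real_eq_1_iff by blast
  have U22: "U $ 2 $ 2 = - U $ 1 $ 1"
    using U(2) by (simp add: trace_def sum_2 add_eq_0_iff)
  let ?h = "(a3 * a4 + a1 * a2, a3 * a4 - a1 * a2, - (a1 * a4 + a2 * a3))"
    and ?e12 = "(- (a3 * a3 + a1 * a1) / 2, (a1 * a1 - a3 * a3) / 2, a1 * a3)"
    and ?e21 = "((a4 * a4 + a2 * a2) / 2, (a4 * a4 - a2 * a2) / 2, - (a2 * a4))"
  have conj: "L3_coords (F0 ** Z ** adj2 F0) = Re (Z $ 1 $ 1) *\<^sub>R ?h + Re (Z $ 1 $ 2) *\<^sub>R ?e12 + Re (Z $ 2 $ 1) *\<^sub>R ?e21"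
    if "Z $ 2 $ 2 = - Z $ 1 $ 1" for Z
    using L3_coords_conj[OF a that] .
  have l12: "L3_coords (F0 ** mat22 0 1 0 0 ** adj2 F0) = ?e12" and l21: "L3_coords (F0 ** mat22 0 0 1 0 ** adj2 F0) = ?e21"
    by (subst conj; simp)+
  have "det3 (1 *\<^sub>R L3_coords (\<xi> (x0, y0))) (L3_coords (pd1 \<xi> (x0, y0))) (L3_coords (pd2 f (x0, y0))) \<noteq> 0"
    using E
  proof
    assume E: "E = mat22 0 0 1 0 \<and> E' = mat22 0 1 0 0 \<and> Re (U $ 1 $ 2) \<noteq> 0"
    have "L3_coords (pd1 \<xi> (x0, y0)) = (- 2 * Re (U $ 1 $ 1)) *\<^sub>R ?e21 + Re (U $ 1 $ 2) *\<^sub>R ?h"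
      unfolding pd1_\<xi> by (subst conj) (use E U22 in \<open>simp_all add: mat2_mult_nth\<close>)
    moreover have "L3_coords (\<xi> (x0, y0)) = ?e21"
      using E l21 by (simp add: \<xi>_def F0_def)
    moreover have "L3_coords (pd2 f (x0, y0)) = c *\<^sub>R ?e12"
      using E f2(1) l12 linear_scale[OF bounded_linear.linear[OF L]] by (simp add: F0_def)
    ultimately show ?thesis
      using E f2(2) det3_alt[of 1 ?e21 "- 2 * Re (U $ 1 $ 1)" "Re (U $ 1 $ 2)" ?h c ?e12] det3_frame[OF det] by simp
  next
    assume E: "E = mat22 0 1 0 0 \<and> E' = mat22 0 0 1 0 \<and> Re (U $ 2 $ 1) \<noteq> 0"
    have "L3_coords (pd1 \<xi> (x0, y0)) = (2 * Re (U $ 1 $ 1)) *\<^sub>R ?e12 + (- Re (U $ 2 $ 1)) *\<^sub>R ?h"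
      unfolding pd1_\<xi> by (subst conj) (use E U22 in \<open>simp_all add: mat2_mult_nth\<close>)
    moreover have "L3_coords (\<xi> (x0, y0)) = ?e12"
      using E l12 by (simp add: \<xi>_def F0_def)
    moreover have "L3_coords (pd2 f (x0, y0)) = c *\<^sub>R ?e21"
      using E f2(1) l21 linear_scale[OF bounded_linear.linear[OF L]] by (simp add: F0_def)
    ultimately show ?thesis
      using E f2(2) det3_alt[of 1 ?e12 "2 * Re (U $ 1 $ 1)" "- Re (U $ 2 $ 1)" ?h c ?e21] det3_frame[OF det]
        det3_swap[of ?e12 ?h ?e21] by simp
  qed
  then have "det3 (L3_coords (\<xi> (x0, y0))) (pd1 (\<lambda>p. L3_coords (\<xi> p)) (x0, y0)) (pd2 (\<lambda>p. L3_coords (f p)) (x0, y0)) \<noteq> 0"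
    by (simp add: L1 \<xi>_smooth assms(2,3))
  then show ?thesis
  proof (rule cuspidal_edge_criterion[OF assms(1,2) _ assms(5) _ _ b, rotated -1])
    show "smooth_on S (\<lambda>p. L3_coords (f p))" "smooth_on S (\<lambda>p. L3_coords (\<xi> p))"
      by (intro smooth_on_bounded_linear[OF L assms(1)] assms(3) \<xi>_smooth)+
    show "pd1 (\<lambda>p. L3_coords (f p)) p = b p *\<^sub>R L3_coords (\<xi> p)" if "p \<in> S" for p
      using that linear_scale[OF bounded_linear.linear[OF L]] by (simp add: L1 assms(3) f1 \<xi>_def)
  qed
qed

section \<open>Interchanging the two variables\<close>

lemma smooth_diffeo_swap:
  assumes "smooth_diffeo U V \<phi>"
  shows "smooth_diffeo (prod.swap -` U) V (\<lambda>x :: real \<times> real. \<phi> (prod.swap x))"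
proof -
  have o: "open U" "open V" and bij: "bij_betw \<phi> U V" and s: "smooth_on U \<phi>" "smooth_on V (inv_into U \<phi>)"
    using assms by (auto simp: smooth_diffeo_def)
  have bl: "bounded_linear (prod.swap :: real \<times> real \<Rightarrow> _)"
    unfolding prod.swap_def by (intro bounded_linear_Pair bounded_linear_fst bounded_linear_snd)
  have o': "open (prod.swap -` U :: (real \<times> real) set)"
    by (intro open_vimage o linear_continuous_on bl)
  have inv: "inv_into U \<phi> y \<in> U" "\<phi> (inv_into U \<phi> y) = y" if "y \<in> V" for y
    using bij that by (auto simp: bij_betw_def inv_into_into f_inv_into_f)
  show ?thesis
  proof (rule smooth_diffeoI[OF o' o(2), where \<psi>="\<lambda>y. prod.swap (inv_into U \<phi> y)"])
    show "smooth_on (prod.swap -` U) (\<lambda>x. \<phi> (prod.swap x))"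
      unfolding smooth_on_def
      by (intro allI Ck_on_compose[OF o' o(1) _ Ck_on_linear[OF bl o']]) (use s(1) in \<open>auto simp: smooth_on_def\<close>)
    show "smooth_on V (\<lambda>y. prod.swap (inv_into U \<phi> y))"
      by (rule smooth_on_bounded_linear[OF bl o(2) s(2)])
  qed (use inv bij in \<open>auto simp: bij_betw_def\<close>)
qed

lemma cuspidal_edge_at_swap:
  assumes "cuspidal_edge_at (\<lambda>p. f (prod.swap p)) (y0, x0)"
  shows "cuspidal_edge_at f (x0, y0)"
proof -
  obtain U V \<phi> W Z \<Psi> where *: "smooth_diffeo U V \<phi>" "(y0, x0) \<in> U" "\<phi> (y0, x0) = (0, 0)"
    "smooth_diffeo W Z \<Psi>" "(\<lambda>p. f (prod.swap p)) ` U \<subseteq> W" "\<Psi> (f (prod.swap (y0, x0))) = cuspidal_edge_model (0, 0)"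
    "\<forall>p\<in>U. \<Psi> (f (prod.swap p)) = cuspidal_edge_model (\<phi> p)"
    using assms unfolding cuspidal_edge_at_def germs_equivalent_def by blast
  show ?thesis
    unfolding cuspidal_edge_at_def germs_equivalent_def
  proof (intro exI conjI)
    show "smooth_diffeo (prod.swap -` U) V (\<lambda>x. \<phi> (prod.swap x))"
      by (rule smooth_diffeo_swap[OF *(1)])
    show "f ` (prod.swap -` U) \<subseteq> W"
    proof
      fix w assume "w \<in> f ` (prod.swap -` U)"
      then obtain p where "prod.swap p \<in> U" "w = f (prod.swap (prod.swap p))"
        by auto
      then show "w \<in> W"
        using *(5) by blast
    qed
    show "\<forall>p\<in>prod.swap -` U. \<Psi> (f p) = cuspidal_edge_model (\<phi> (prod.swap p))"
    proof
      fix p assume "p \<in> prod.swap -` U"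
      then have "\<Psi> (f (prod.swap (prod.swap p))) = cuspidal_edge_model (\<phi> (prod.swap p))"
        using *(7) by blast
      then show "\<Psi> (f p) = cuspidal_edge_model (\<phi> (prod.swap p))"
        by simp
    qed
  qed (use * in auto)
qed

subsection \<open>Extension of loops\<close>

lemma mat_holomorphic_on_extend:
  assumes "mat_holomorphic_on \<gamma> (- {0})" "mat_holomorphic_on g (ball 0 1)" "\<And>z. z \<in> ball 0 1 - {0} \<Longrightarrow> g z = \<gamma> z"
  shows "mat_holomorphic_on (\<lambda>z. if z = 0 then g 0 else \<gamma> z) UNIV"
  unfolding mat_holomorphic_on_def
proof (intro allI)
  fix i j
  let ?h = "\<lambda>z. (if z = 0 then g 0 else \<gamma> z) $ i $ j"
  have "?h holomorphic_on ball 0 1"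
  proof (rule holomorphic_transform)
    show "(\<lambda>z. g z $ i $ j) holomorphic_on ball 0 1"
      using assms(2) by (simp add: mat_holomorphic_on_def)
    show "g z $ i $ j = ?h z" if "z \<in> ball 0 1" for z
      using assms(3)[of z] that by simp
  qed
  moreover have "?h holomorphic_on - {0}"
  proof (rule holomorphic_transform)
    show "(\<lambda>z. \<gamma> z $ i $ j) holomorphic_on - {0}"
      using assms(1) by (simp add: mat_holomorphic_on_def)
  qed simp
  ultimately have "?h holomorphic_on ball 0 1 \<union> - {0}"
    by (intro holomorphic_on_Un) auto
  moreover have "ball 0 1 \<union> - {0} = (UNIV :: complex set)"
    by auto
  ultimately show "?h holomorphic_on UNIV"
    by simp
qed

text \<open>Loops carry no information at the parameter 0, so identities for their extensions are
  obtained there as limits.\<close>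

lemma continuous_eq_at_0:
  fixes f g :: "complex \<Rightarrow> 'a::t2_space"
  assumes "continuous_on UNIV f" "continuous_on UNIV g" "\<And>z. z \<noteq> 0 \<Longrightarrow> f z = g z"
  shows "f z = g z"
proof (cases "z = 0")
  case True
  have "(f \<longlongrightarrow> f 0) (at 0)" "(g \<longlongrightarrow> g 0) (at 0)"
    using assms(1,2) by (auto simp: continuous_on_def)
  moreover have "(f \<longlongrightarrow> g 0) (at 0)"
    by (rule Lim_transform_eventually[OF \<open>(g \<longlongrightarrow> g 0) (at 0)\<close>]) (auto simp: eventually_at_filter assms(3))
  ultimately show ?thesis
    using True tendsto_unique[of "at (0::complex)"] by auto
qed (rule assms(3))

lemma continuous_on_det2: "continuous_on S A \<Longrightarrow> continuous_on S (\<lambda>x. det (A x :: mat2))"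
  unfolding det_2 by (intro continuous_intros bounded_linear.continuous_on[OF bounded_linear_mat2_nth])

text \<open>A loop is holomorphic off 0, so an extension to the unit disc already makes it entire;
  circles of any radius are then available.\<close>

lemma plus_loop_extension:
  assumes "\<gamma> \<in> loop_group_plus"
  obtains g where "mat_holomorphic_on g UNIV" "\<And>z. z \<noteq> 0 \<Longrightarrow> g z = \<gamma> z" "\<And>z. det (g z) = 1"
proof -
  obtain g where g: "\<gamma> \<in> loop_group" "mat_holomorphic_on g (ball 0 1)" "\<forall>z\<in>ball 0 1 - {0}. g z = \<gamma> z"
    using assms by (auto simp: loop_group_plus_def)
  let ?g = "\<lambda>z. if z = 0 then g 0 else \<gamma> z"
  have hol: "mat_holomorphic_on ?g UNIV"
    by (rule mat_holomorphic_on_extend) (use g in \<open>auto simp: loop_group_def\<close>)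
  have "det (?g z) = 1" for z
    by (rule continuous_eq_at_0[of "\<lambda>z. det (?g z)" "\<lambda>z. 1"])
      (use g(1) in \<open>auto intro!: continuous_on_det2 mat_holomorphic_imp_continuous_on[OF hol] simp: loop_group_def\<close>)
  with hol that[of ?g] show thesis
    by simp
qed

lemma minus_loop_extension:
  assumes "\<gamma> \<in> loop_group_minus_star"
  obtains g where "mat_holomorphic_on g UNIV" "\<And>u. u \<noteq> 0 \<Longrightarrow> g u = \<gamma> (1 / u)" "\<And>z. det (g z) = 1" "g 0 = mat 1"
proof -
  obtain g where g: "\<gamma> \<in> loop_group" "mat_holomorphic_on g (ball 0 1)" "\<forall>w\<in>ball 0 1 - {0}. g w = \<gamma> (inverse w)"
    and lim: "(\<gamma> \<longlongrightarrow> mat 1) at_infinity"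
    using assms by (auto simp: loop_group_minus_star_def loop_group_minus_def)
  let ?g = "\<lambda>u. if u = 0 then g 0 else \<gamma> (1 / u)"
  have hol: "mat_holomorphic_on ?g UNIV"
  proof (rule mat_holomorphic_on_extend)
    show "mat_holomorphic_on (\<lambda>u. \<gamma> (1 / u)) (- {0})"
      unfolding mat_holomorphic_on_def
    proof (intro allI)
      fix i j
      have "((\<lambda>z. \<gamma> z $ i $ j) \<circ> (\<lambda>u. 1 / u)) holomorphic_on - {0}"
        by (rule holomorphic_on_compose_gen[where t="- {0}"])
          (use g(1) in \<open>auto intro!: holomorphic_intros simp: loop_group_def mat_holomorphic_on_def\<close>)
      then show "(\<lambda>u. \<gamma> (1 / u) $ i $ j) holomorphic_on - {0}"
        by (simp add: o_def)
    qed
  qed (use g in \<open>auto simp: inverse_eq_divide\<close>)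
  have c: "continuous_on UNIV ?g"
    using mat_holomorphic_imp_continuous_on[OF hol] .
  have det: "det (?g z) = 1" for z
    by (rule continuous_eq_at_0[of "\<lambda>z. det (?g z)" "\<lambda>z. 1"])
      (use g(1) in \<open>auto intro!: continuous_on_det2 c simp: loop_group_def\<close>)
  have "isCont ?g 0"
    using c by (simp add: continuous_on_eq_continuous_at)
  then have "(?g \<longlongrightarrow> ?g 0) (at 0)"
    by (simp only: isCont_def)
  moreover have "(?g \<longlongrightarrow> mat 1) (at 0)"
  proof (rule Lim_transform_eventually)
    show "((\<lambda>u. \<gamma> (inverse u)) \<longlongrightarrow> mat 1) (at 0)"
      by (rule filterlim_compose[OF lim filterlim_inverse_at_infinity])
    show "\<forall>\<^sub>F u in at 0. \<gamma> (inverse u) = ?g u"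
      by (auto simp: eventually_at_filter inverse_eq_divide)
  qed
  ultimately have "?g 0 = mat 1"
    by (rule tendsto_unique[rotated]) simp
  with hol det that[of ?g] show thesis
    by simp
qed

lemma entire_power_series:
  assumes "\<And>u. u \<noteq> 0 \<Longrightarrow> (\<lambda>n. a n * u ^ n) sums f u"
  shows "(\<lambda>u. if u = 0 then a 0 else f u) holomorphic_on (UNIV :: complex set)"
proof -
  let ?f = "\<lambda>u. if u = 0 then a 0 else f u"
  have "?f holomorphic_on ball 0 r" for r
  proof (rule power_series_holomorphic)
    show "(\<lambda>n. a n * (w - 0) ^ n) sums ?f w" for w
      using assms[of w] powser_sums_zero[of a] by auto
  qed
  then have "?f holomorphic_on (\<Union>r. ball 0 r)"
    by (intro holomorphic_on_UN_open) auto
  moreover have "(\<Union>r. ball 0 r) = (UNIV :: complex set)"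
    using gt_ex by auto
  ultimately show ?thesis
    by simp
qed

text \<open>The index change i = 1 - n turns a series in powers of \<lambda> up to the first into a
  power series in u = 1/\<lambda>; the factor u removes the pole at infinity and leaves c 1 as the
  value at u = 0.\<close>

lemma loop_potential_leading_upper:
  assumes "loop_potential {..1} I \<psi> c" "t \<in> I"
  shows "mat_holomorphic_on (\<lambda>u. if u = 0 then c 1 t else cscale u (\<psi> t (1 / u))) UNIV"
  unfolding mat_holomorphic_on_def
proof (intro allI)
  fix j k
  have "(\<lambda>u. if u = 0 then c (1 - int 0) t $ j $ k else u * \<psi> t (1 / u) $ j $ k) holomorphic_on UNIV"
  proof (rule entire_power_series[where a="\<lambda>n. c (1 - int n) t $ j $ k"])
    fix u :: complex assume u: "u \<noteq> 0"
    have "((\<lambda>i. c i t $ j $ k * (1 / u) powi i) has_sum \<psi> t (1 / u) $ j $ k) {..1}"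
      using assms u by (simp add: loop_potential_def)
    from has_sum_cmult_right[OF this, of u]
    have 1: "((\<lambda>i. u * (c i t $ j $ k * (1 / u) powi i)) has_sum u * \<psi> t (1 / u) $ j $ k) {..1}" .
    have "bij_betw (\<lambda>n. 1 - int n) UNIV {..1}"
      by (rule bij_betwI[where g="\<lambda>i. nat (1 - i)"]) auto
    from has_sum_reindex_bij_betw[OF this, THEN iffD2, OF 1]
    have "((\<lambda>n. u * (c (1 - int n) t $ j $ k * (1 / u) powi (1 - int n))) has_sum u * \<psi> t (1 / u) $ j $ k) UNIV" .
    moreover have "u * (x * (1 / u) powi (1 - int n)) = x * u ^ n" for n x
      using u by (simp add: power_int_diff power_int_divide_distrib field_simps)
    ultimately show "(\<lambda>n. c (1 - int n) t $ j $ k * u ^ n) sums (u * \<psi> t (1 / u) $ j $ k)"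
      by (simp add: has_sum_imp_sums)
  qed
  then show "(\<lambda>u. (if u = 0 then c 1 t else cscale u (\<psi> t (1 / u))) $ j $ k) holomorphic_on UNIV"
    by (rule holomorphic_transform) auto
qed

text \<open>The counterpart at \<lambda> = 0: multiplication by u shifts the lowest index -1 to
  0.\<close>

lemma loop_potential_leading_lower:
  assumes "loop_potential {- 1..} I \<psi> c" "t \<in> I"
  shows "mat_holomorphic_on (\<lambda>u. if u = 0 then c (- 1) t else cscale u (\<psi> t u)) UNIV"
  unfolding mat_holomorphic_on_def
proof (intro allI)
  fix j k
  have "(\<lambda>u. if u = 0 then c (int 0 - 1) t $ j $ k else u * \<psi> t u $ j $ k) holomorphic_on UNIV"
  proof (rule entire_power_series[where a="\<lambda>n. c (int n - 1) t $ j $ k"])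
    fix u :: complex assume u: "u \<noteq> 0"
    have "((\<lambda>i. c i t $ j $ k * u powi i) has_sum \<psi> t u $ j $ k) {- 1..}"
      using assms u by (simp add: loop_potential_def)
    from has_sum_cmult_right[OF this, of u]
    have 1: "((\<lambda>i. u * (c i t $ j $ k * u powi i)) has_sum u * \<psi> t u $ j $ k) {- 1..}" .
    have "bij_betw (\<lambda>n. int n - 1) UNIV {- 1..}"
      by (rule bij_betwI[where g="\<lambda>i. nat (i + 1)"]) auto
    from has_sum_reindex_bij_betw[OF this, THEN iffD2, OF 1]
    have "((\<lambda>n. u * (c (int n - 1) t $ j $ k * u powi (int n - 1))) has_sum u * \<psi> t u $ j $ k) UNIV" .
    moreover have "u * (x * u powi (int n - 1)) = x * u ^ n" for n x
      using u by (simp add: power_int_diff)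
    ultimately show "(\<lambda>n. c (int n - 1) t $ j $ k * u ^ n) sums (u * \<psi> t u $ j $ k)"
      by (simp add: has_sum_imp_sums)
  qed
  then show "(\<lambda>u. (if u = 0 then c (- 1) t else cscale u (\<psi> t u)) $ j $ k) holomorphic_on UNIV"
    by (rule holomorphic_transform) auto
qed

lemma twisted_nth:
  assumes "twisted \<gamma>" "z \<noteq> 0"
  shows "\<gamma> (- z) $ 1 $ 1 = \<gamma> z $ 1 $ 1" "\<gamma> (- z) $ 1 $ 2 = - \<gamma> z $ 1 $ 2"
    "\<gamma> (- z) $ 2 $ 1 = - \<gamma> z $ 2 $ 1" "\<gamma> (- z) $ 2 $ 2 = \<gamma> z $ 2 $ 2"
proof -
  have "matrix_inv P_twist = P_twist"
    by (rule matrix_inv_eqI) (simp_all add: mat2_eq_iff mat2_mult_nth P_twist_def)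
  moreover have "\<gamma> (- z) = P_twist ** \<gamma> (- (- z)) ** matrix_inv P_twist"
    using assms unfolding twisted_def by (metis neg_equal_0_iff_equal)
  ultimately have *: "\<gamma> (- z) = P_twist ** \<gamma> z ** P_twist"
    by simp
  then show "\<gamma> (- z) $ 1 $ 1 = \<gamma> z $ 1 $ 1" "\<gamma> (- z) $ 1 $ 2 = - \<gamma> z $ 1 $ 2"
    "\<gamma> (- z) $ 2 $ 1 = - \<gamma> z $ 2 $ 1" "\<gamma> (- z) $ 2 $ 2 = \<gamma> z $ 2 $ 2"
    unfolding * by (simp_all add: mat2_mult_nth P_twist_def)
qed

lemma real_loop_nth:
  assumes "real_loop \<gamma>" "z \<noteq> 0"
  shows "cnj (\<gamma> (cnj z) $ i $ j) = \<gamma> z $ i $ j"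
proof -
  have "(\<chi> i j. cnj (\<gamma> (cnj z) $ i $ j)) = \<gamma> z"
    using assms by (simp add: real_loop_def)
  then show ?thesis
    by (metis (no_types, lifting) vec_lambda_beta)
qed

text \<open>From w^2 / (w - z) = z w / (w - z) + w: the inner part of a function with a simple pole
  at infinity is affine in z, with the leading coefficient as slope.\<close>

lemma circle_mean_kernel_pole_infinity:
  assumes "mat_holomorphic_on A UNIV" "norm z < R"
  shows "circle_mean R (\<lambda>w. cscale (w / (w - z)) (cscale w (A (1 / w))))
    = cscale z (A 0) + circle_mean R (\<lambda>w. cscale w (A (1 / w)))"
proof -
  have R: "R > 0"
    using assms(2) norm_ge_zero[of z] by linarith
  have c: "continuous_on (sphere 0 R) (\<lambda>w. A (1 / w))"
    by (rule continuous_on_inverse_sphere[OF R mat_holomorphic_imp_continuous_on[OF assms(1)]])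
  note k = continuous_on_cauchy_kernel[OF assms(2)]
  have "circle_mean R (\<lambda>w. cscale (w / (w - z)) (cscale w (A (1 / w))))
      = circle_mean R (\<lambda>w. cscale z (cscale (w / (w - z)) (A (1 / w))) + cscale w (A (1 / w)))"
  proof (rule circle_mean_cong[OF R])
    fix w :: complex assume "norm w = R"
    then have "w - z \<noteq> 0"
      using assms(2) by auto
    then have "w / (w - z) * w = z * (w / (w - z)) + w"
      by (simp add: divide_simps) (simp add: algebra_simps)
    then have "w / (w - z) * (w * a) = z * (w / (w - z) * a) + w * a" for a
      by (metis (no_types, opaque_lifting) distrib_right mult.assoc)
    then show "cscale (w / (w - z)) (cscale w (A (1 / w))) = cscale z (cscale (w / (w - z)) (A (1 / w))) + cscale w (A (1 / w))"
      by (simp add: vec_eq_iff)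
  qed
  also have "\<dots> = circle_mean R (\<lambda>w. cscale z (cscale (w / (w - z)) (A (1 / w)))) + circle_mean R (\<lambda>w. cscale w (A (1 / w)))"
    by (intro circle_mean_add R continuous_on_cscale continuous_on_const continuous_on_id k c)
  also have "circle_mean R (\<lambda>w. cscale z (cscale (w / (w - z)) (A (1 / w)))) = cscale z (circle_mean R (\<lambda>w. cscale (w / (w - z)) (A (1 / w))))"
    by (rule circle_mean_linear[OF R _ bounded_bilinear.bounded_linear_right[OF bounded_bilinear_cscale]])
      (intro continuous_on_cscale k c)
  also have "circle_mean R (\<lambda>w. cscale (w / (w - z)) (A (1 / w))) = A 0"
    by (rule circle_mean_cauchy_mat2(2)[OF assms])
  finally show ?thesis .
qed

text \<open>From 1 / (w - z) = (w / (w - z) - 1) / z: the inner part of A w / w is what remains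
  after removal of its polar part A 0 / w.\<close>

lemma circle_mean_kernel_pole_zero:
  assumes "mat_holomorphic_on A UNIV" "norm z < R" "z \<noteq> 0"
  shows "circle_mean R (\<lambda>w. cscale (w / (w - z)) (cscale (1 / w) (A w))) = cscale (1 / z) (A z - A 0)"
proof -
  have R: "R > 0"
    using assms(2) norm_ge_zero[of z] by linarith
  have c: "continuous_on (sphere 0 R) A"
    using continuous_on_subset[OF mat_holomorphic_imp_continuous_on[OF assms(1)] subset_UNIV] .
  have z0: "norm (0::complex) < R"
    using R by simp
  note k = continuous_on_cauchy_kernel[OF assms(2)] and k0 = continuous_on_cauchy_kernel[OF z0]
  let ?K = "\<lambda>z w. cscale (w / (w - z)) (A w)"
  have "circle_mean R (\<lambda>w. cscale (w / (w - z)) (cscale (1 / w) (A w)))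
      = circle_mean R (\<lambda>w. cscale (1 / z) (?K z w - ?K 0 w))"
  proof (rule circle_mean_cong[OF R])
    fix w :: complex assume "norm w = R"
    then have "w - z \<noteq> 0" "w \<noteq> 0"
      using assms(2) R by auto
    then have "w / (w - z) * (1 / w) = 1 / z * (w / (w - z) - w / (w - 0))"
      using assms(3) by (simp add: divide_simps)
    then have "w / (w - z) * (1 / w * a) = 1 / z * (w / (w - z) * a - w / (w - 0) * a)" for a
      by (metis (no_types, opaque_lifting) left_diff_distrib mult.assoc)
    then show "cscale (w / (w - z)) (cscale (1 / w) (A w)) = cscale (1 / z) (?K z w - ?K 0 w)"
      by (simp only: vec_eq_iff cscale_nth vector_minus_component) simp
  qed
  also have "\<dots> = cscale (1 / z) (circle_mean R (\<lambda>w. ?K z w - ?K 0 w))"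
    by (rule circle_mean_linear[OF R _ bounded_bilinear.bounded_linear_right[OF bounded_bilinear_cscale]])
      (intro continuous_on_diff continuous_on_cscale k k0 c)
  also have "circle_mean R (\<lambda>w. ?K z w - ?K 0 w) = circle_mean R (?K z) - circle_mean R (?K 0)"
    by (intro circle_mean_diff R continuous_on_cscale k k0 c)
  also have "\<dots> = A z - A 0"
    using circle_mean_cauchy_mat2(1)[OF assms(1,2)] circle_mean_cauchy_mat2(1)[OF assms(1) z0] by simp
  finally show ?thesis .
qed

lemma mat_holomorphic_on_uminus: "mat_holomorphic_on A S \<Longrightarrow> mat_holomorphic_on (\<lambda>z. - A z) S"
  by (auto simp: mat_holomorphic_on_def intro!: holomorphic_intros)

lemma has_vector_derivative_fst_line:
  fixes g :: "real \<times> real \<Rightarrow> 'a::real_normed_vector"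
  assumes "(g has_derivative g') (at p)"
  shows "((\<lambda>x. g (x, snd p)) has_vector_derivative g' (1, 0)) (at (fst p))"
proof -
  have "g' = frechet_derivative g (at p)"
    by (rule frechet_derivative_at[OF assms])
  with assms show ?thesis
    using has_vector_derivative_pd1[of g "fst p" "snd p"] by simp
qed

lemma has_vector_derivative_snd_line:
  fixes g :: "real \<times> real \<Rightarrow> 'a::real_normed_vector"
  assumes "(g has_derivative g') (at p)"
  shows "((\<lambda>y. g (fst p, y)) has_vector_derivative g' (0, 1)) (at (snd p))"
proof -
  have "g' = frechet_derivative g (at p)"
    by (rule frechet_derivative_at[OF assms])
  with assms show ?thesis
    using has_vector_derivative_pd2[of g "fst p" "snd p"] by simp
qed

text \<open>Smoothness comes first, since \<open>vector_derivative\<close> is informative only for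
  differentiable curves; determinant 1 then lets the equation be solved for the derivative.\<close>

lemma loop_curve_derivative:
  assumes "open I" "smooth_loop_curve I A" "t \<in> I" "z \<noteq> 0" "det (A t z) = 1"
    and "matrix_inv (A t z) ** vector_derivative (\<lambda>s. A s z) (at t) = C"
  shows "((\<lambda>s. A s z) has_vector_derivative A t z ** C) (at t)"
proof -
  let ?A = "\<lambda>x. A (fst x) (snd x)"
  have "smooth_on (I \<times> (- {0})) ?A"
    using assms(2) by (simp add: smooth_loop_curve_def case_prod_unfold)
  then have "(?A has_derivative frechet_derivative ?A (at (t, z))) (at (t, z))"
    by (rule smooth_on_has_derivative) (use assms in auto)
  from has_derivative_compose[where f="\<lambda>s. (s, z)",
      OF has_derivative_Pair[OF has_derivative_ident has_derivative_const] this]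
  have "(\<lambda>s. A s z) differentiable (at t)"
    by (auto simp: differentiable_def)
  then have d: "((\<lambda>s. A s z) has_vector_derivative vector_derivative (\<lambda>s. A s z) (at t)) (at t)"
    by (simp add: vector_derivative_works)
  have "vector_derivative (\<lambda>s. A s z) (at t) = A t z ** C"
    unfolding assms(6)[symmetric] matrix_inv_eq_adj2[OF assms(5)] matrix_mul_assoc
    by (simp add: adj2_mult[OF assms(5)])
  with d show ?thesis
    by simp
qed

subsection \<open>The extended frame\<close>

locale sym_surface =
  fixes Ix Iy :: "real set" and \<psi>X \<psi>Y X Y :: "real \<Rightarrow> loop" and cX cY :: "int \<Rightarrow> real \<Rightarrow> mat2"
    and xb yb :: real and Hm Hp :: "real \<Rightarrow> real \<Rightarrow> loop"
  assumes open_I: "open Ix" "open Iy"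
    and potentials: "loop_potential {..1} Ix \<psi>X cX" "loop_potential {- 1..} Iy \<psi>Y cY"
    and integrates: "integrates_potential Ix xb \<psi>X X" "integrates_potential Iy yb \<psi>Y Y"
    and birkhoff: "x \<in> Ix \<Longrightarrow> y \<in> Iy \<Longrightarrow>
      left_normalized_birkhoff (loop_mult (loop_inv (X x)) (Y y)) (Hm x y) (Hp x y)"
begin

definition \<Omega> :: "(real \<times> real) set" where "\<Omega> = Ix \<times> Iy"

definition \<Phi> :: "real \<times> real \<Rightarrow> loop" where
  "\<Phi> p z = adj2 (X (fst p) z) ** Y (snd p) z"

text \<open>\<open>Hp\<close> is meaningful only at nonzero parameters, so its inverse is replaced
  by the entire extension, whose value at 0 enters the y-derivative of the frame. \<open>M\<close>
  does the same for \<open>Hm\<close> at infinity.\<close>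

definition G :: "real \<times> real \<Rightarrow> loop" where
  "G p = (SOME g. mat_holomorphic_on g UNIV \<and> (\<forall>z. z \<noteq> 0 \<longrightarrow> g z = adj2 (Hp (fst p) (snd p) z)) \<and> (\<forall>z. det (g z) = 1))"

definition M :: "real \<times> real \<Rightarrow> loop" where
  "M p = (SOME g. mat_holomorphic_on g UNIV \<and> (\<forall>u. u \<noteq> 0 \<longrightarrow> g u = Hm (fst p) (snd p) (1 / u)) \<and> (\<forall>z. det (g z) = 1)
     \<and> g 0 = mat 1)"

lemma X_loop: "x \<in> Ix \<Longrightarrow> X x \<in> loop_group" and Y_loop: "y \<in> Iy \<Longrightarrow> Y y \<in> loop_group"
  using integrates by (auto simp: integrates_potential_def)

lemma det_XY: "x \<in> Ix \<Longrightarrow> z \<noteq> 0 \<Longrightarrow> det (X x z) = 1" "y \<in> Iy \<Longrightarrow> z \<noteq> 0 \<Longrightarrow> det (Y y z) = 1"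
  using X_loop Y_loop by (auto simp: loop_group_def)

lemma birkhoff_factors:
  assumes "p \<in> \<Omega>"
  shows "Hm (fst p) (snd p) \<in> loop_group_minus_star" "Hp (fst p) (snd p) \<in> loop_group_plus"
    "\<And>z. z \<noteq> 0 \<Longrightarrow> \<Phi> p z = Hm (fst p) (snd p) z ** Hp (fst p) (snd p) z"
proof -
  have *: "fst p \<in> Ix" "snd p \<in> Iy"
    using assms by (auto simp: \<Omega>_def)
  show "Hm (fst p) (snd p) \<in> loop_group_minus_star" "Hp (fst p) (snd p) \<in> loop_group_plus"
    using birkhoff[OF *] by (simp_all add: left_normalized_birkhoff_def)
  show "\<Phi> p z = Hm (fst p) (snd p) z ** Hp (fst p) (snd p) z" if "z \<noteq> 0" for z
    using birkhoff[OF *] that det_XY(1)[OF *(1)]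
    by (simp add: left_normalized_birkhoff_def loop_mult_def loop_inv_def \<Phi>_def matrix_inv_eq_adj2)
qed

lemma G_props:
  assumes "p \<in> \<Omega>"
  shows "mat_holomorphic_on (G p) UNIV" "\<And>z. z \<noteq> 0 \<Longrightarrow> G p z = adj2 (Hp (fst p) (snd p) z)" "\<And>z. det (G p z) = 1"
proof -
  obtain g where g: "mat_holomorphic_on g UNIV" "\<And>z. z \<noteq> 0 \<Longrightarrow> g z = Hp (fst p) (snd p) z" "\<And>z. det (g z) = 1"
    using plus_loop_extension[OF birkhoff_factors(2)[OF assms]] by blast
  have "mat_holomorphic_on (G p) UNIV \<and> (\<forall>z. z \<noteq> 0 \<longrightarrow> G p z = adj2 (Hp (fst p) (snd p) z)) \<and> (\<forall>z. det (G p z) = 1)"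
    unfolding G_def by (rule someI[of _ "\<lambda>z. adj2 (g z)"]) (simp add: g mat_holomorphic_on_adj2 det_adj2)
  then show "mat_holomorphic_on (G p) UNIV" "\<And>z. z \<noteq> 0 \<Longrightarrow> G p z = adj2 (Hp (fst p) (snd p) z)" "\<And>z. det (G p z) = 1"
    by auto
qed

lemma M_props:
  assumes "p \<in> \<Omega>"
  shows "mat_holomorphic_on (M p) UNIV" "\<And>u. u \<noteq> 0 \<Longrightarrow> M p u = Hm (fst p) (snd p) (1 / u)" "\<And>z. det (M p z) = 1"
    "M p 0 = mat 1"
proof -
  obtain g where g: "mat_holomorphic_on g UNIV" "\<And>u. u \<noteq> 0 \<Longrightarrow> g u = Hm (fst p) (snd p) (1 / u)" "\<And>z. det (g z) = 1"
      "g 0 = mat 1"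
    using minus_loop_extension[OF birkhoff_factors(1)[OF assms]] by blast
  have "mat_holomorphic_on (M p) UNIV \<and> (\<forall>u. u \<noteq> 0 \<longrightarrow> M p u = Hm (fst p) (snd p) (1 / u)) \<and> (\<forall>z. det (M p z) = 1)
     \<and> M p 0 = mat 1"
    unfolding M_def by (rule someI[of _ g]) (simp add: g)
  then show "mat_holomorphic_on (M p) UNIV" "\<And>u. u \<noteq> 0 \<Longrightarrow> M p u = Hm (fst p) (snd p) (1 / u)" "\<And>z. det (M p z) = 1"
    "M p 0 = mat 1"
    by auto
qed

lemma open_\<Omega>': "open \<Omega>" "open (\<Omega> \<times> (- {0 :: complex}))"
  unfolding \<Omega>_def by (auto intro!: open_Times open_I)

lemma Ck_X: "Ck_on k (\<Omega> \<times> (- {0})) (\<lambda>x. X (fst (fst x)) (snd x))"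
  and Ck_Y: "Ck_on k (\<Omega> \<times> (- {0})) (\<lambda>x. Y (snd (fst x)) (snd x))"
proof -
  have s: "Ck_on k (Ix \<times> (- {0})) (\<lambda>x. X (fst x) (snd x))" "Ck_on k (Iy \<times> (- {0})) (\<lambda>x. Y (fst x) (snd x))"
    using integrates by (auto simp: integrates_potential_def smooth_loop_curve_def smooth_on_def case_prod_unfold)
  note o = open_\<Omega>'(2)
  have oI: "open (Ix \<times> (- {0 :: complex}))" "open (Iy \<times> (- {0 :: complex}))"
    by (auto intro!: open_Times open_I)
  have p: "Ck_on k (\<Omega> \<times> (- {0})) (\<lambda>x :: (real \<times> real) \<times> complex. (fst (fst x), snd x))"
    by (rule Ck_on_Pair[OF o Ck_on_fst[OF o Ck_on_fst[OF o Ck_on_id[OF o]]] Ck_on_snd[OF o Ck_on_id[OF o]]])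
  have q: "Ck_on k (\<Omega> \<times> (- {0})) (\<lambda>x :: (real \<times> real) \<times> complex. (snd (fst x), snd x))"
    by (rule Ck_on_Pair[OF o Ck_on_snd[OF o Ck_on_fst[OF o Ck_on_id[OF o]]] Ck_on_snd[OF o Ck_on_id[OF o]]])
  have i: "(\<lambda>x. (fst (fst x), snd x)) ` (\<Omega> \<times> (- {0})) \<subseteq> Ix \<times> (- {0})"
    "(\<lambda>x. (snd (fst x), snd x)) ` (\<Omega> \<times> (- {0})) \<subseteq> Iy \<times> (- {0})"
    by (auto simp: \<Omega>_def)
  show "Ck_on k (\<Omega> \<times> (- {0})) (\<lambda>x. X (fst (fst x)) (snd x))"
    using Ck_on_compose[OF o oI(1) s(1) p i(1)] by simp
  show "Ck_on k (\<Omega> \<times> (- {0})) (\<lambda>x. Y (snd (fst x)) (snd x))"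
    using Ck_on_compose[OF o oI(2) s(2) q i(2)] by simp
qed

sublocale birkhoff_family \<Omega> \<Phi> G M
proof
  show "smooth_on (\<Omega> \<times> (- {0})) (\<lambda>(p, z). \<Phi> p z)"
    unfolding smooth_on_def \<Phi>_def case_prod_unfold
    by (intro allI Ck_on_mat2_mult Ck_on_adj2 Ck_X Ck_Y open_\<Omega>')
  show "\<Phi> p z ** G p z = M p (1 / z)" if "p \<in> \<Omega>" "z \<noteq> 0" for p z
  proof -
    have "det (Hp (fst p) (snd p) z) = 1"
      using birkhoff_factors(2)[OF that(1)] that(2) by (simp add: loop_group_plus_def loop_group_def)
    then show ?thesis
      using that by (simp add: birkhoff_factors(3) G_props(2) M_props(2) matrix_mul_assoc[symmetric] adj2_mult)
  qed
qed (use open_\<Omega>' G_props M_props in auto)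

definition Fh :: "real \<times> real \<Rightarrow> loop" where
  "Fh p z = Y (snd p) z ** G p z"

lemma Ck_Fh: "Ck_on k (\<Omega> \<times> (- {0})) (\<lambda>x. Fh (fst x) (snd x))"
proof -
  have "Ck_on k (\<Omega> \<times> (- {0})) (\<lambda>x. G (fst x) (snd x))"
    by (rule Ck_on_subset[OF Ck_G]) auto
  then show ?thesis
    unfolding Fh_def by (rule Ck_on_mat2_mult[OF open_\<Omega>'(2) Ck_Y])
qed

lemma det_Fh: "p \<in> \<Omega> \<Longrightarrow> z \<noteq> 0 \<Longrightarrow> det (Fh p z) = 1"
  using det_XY(2)[of "snd p" z] by (auto simp: Fh_def det_mul G_props(3) \<Omega>_def)

lemma X_deriv:
  assumes "p \<in> \<Omega>" "z \<noteq> 0"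
  shows "((\<lambda>s. X s z) has_vector_derivative X (fst p) z ** \<psi>X (fst p) z) (at (fst p))"
  by (rule loop_curve_derivative[OF open_I(1)])
    (use assms integrates(1) det_XY(1) in \<open>auto simp: integrates_potential_def \<Omega>_def\<close>)

lemma Y_deriv:
  assumes "p \<in> \<Omega>" "z \<noteq> 0"
  shows "((\<lambda>s. Y s z) has_vector_derivative Y (snd p) z ** \<psi>Y (snd p) z) (at (snd p))"
  by (rule loop_curve_derivative[OF open_I(2)])
    (use assms integrates(2) det_XY(2) in \<open>auto simp: integrates_potential_def \<Omega>_def\<close>)

lemma trace_\<psi>X: "p \<in> \<Omega> \<Longrightarrow> z \<noteq> 0 \<Longrightarrow> trace (\<psi>X (fst p) z) = 0"
  using potentials(1) by (auto simp: loop_potential_def loop_algebra_def \<Omega>_def)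

text \<open>\<open>adj2\<close> is linear, so it can be differentiated through, and it sends the
  traceless \<psi>X to -\<psi>X; this accounts for the sign.\<close>

lemma d\<Phi>_fst:
  assumes "p \<in> \<Omega>" "w \<noteq> 0"
  shows "d\<Phi> p w (1, 0) = - (\<psi>X (fst p) w ** \<Phi> p w)"
proof -
  have 1: "((\<lambda>x. \<Phi> (x, snd p) w) has_vector_derivative d\<Phi> p w (1, 0)) (at (fst p))"
    using has_vector_derivative_fst_line[OF has_derivative_\<Phi>[OF assms]] .
  have "((\<lambda>x. adj2 (X x w)) has_vector_derivative adj2 (X (fst p) w ** \<psi>X (fst p) w)) (at (fst p))"
    by (rule bounded_linear.has_vector_derivative[OF bounded_linear_adj2 X_deriv[OF assms]])
  from bounded_linear.has_vector_derivative[OF bounded_bilinear.bounded_linear_left[OF bounded_bilinear_mat2_mult] this, of "Y (snd p) w"]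
  have 2: "((\<lambda>x. \<Phi> (x, snd p) w) has_vector_derivative adj2 (X (fst p) w ** \<psi>X (fst p) w) ** Y (snd p) w) (at (fst p))"
    by (simp add: \<Phi>_def)
  have "- A ** B ** C = - (A ** (B ** C))" for A B C :: mat2
    by (simp add: mat2_eq_iff mat2_mult_nth algebra_simps)
  then show ?thesis
    using vector_derivative_unique_at[OF 1 2] by (simp add: adj2_mult_rev adj2_traceless[OF trace_\<psi>X[OF assms]] \<Phi>_def)
qed

lemma d\<Phi>_snd:
  assumes "p \<in> \<Omega>" "w \<noteq> 0"
  shows "d\<Phi> p w (0, 1) = \<Phi> p w ** \<psi>Y (snd p) w"
proof -
  have 1: "((\<lambda>y. \<Phi> (fst p, y) w) has_vector_derivative d\<Phi> p w (0, 1)) (at (snd p))"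
    using has_vector_derivative_snd_line[OF has_derivative_\<Phi>[OF assms]] .
  have 2: "((\<lambda>y. \<Phi> (fst p, y) w) has_vector_derivative adj2 (X (fst p) w) ** (Y (snd p) w ** \<psi>Y (snd p) w)) (at (snd p))"
    using bounded_linear.has_vector_derivative[OF bounded_bilinear.bounded_linear_right[OF bounded_bilinear_mat2_mult] Y_deriv[OF assms]]
    by (simp add: \<Phi>_def)
  show ?thesis
    using vector_derivative_unique_at[OF 1 2] by (simp add: \<Phi>_def matrix_mul_assoc)
qed

text \<open>The conjugated potential has at most a simple pole at infinity, with leading coefficient \<open>cX 1\<close>
  because \<open>M p 0 = I\<close>. Hence its part holomorphic in the disc is affine in \<open>z\<close>.\<close>

lemma Fh_deriv_fst:
  assumes "p \<in> \<Omega>"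
  obtains U0 where "\<And>z. z \<noteq> 0 \<Longrightarrow> norm z < 3 \<Longrightarrow>
    ((\<lambda>x. Fh (x, snd p) z) has_vector_derivative Fh p z ** (cscale z (cX 1 (fst p)) + U0)) (at (fst p))"
proof -
  have x: "fst p \<in> Ix"
    using assms by (auto simp: \<Omega>_def)
  define N where "N u = (if u = 0 then cX 1 (fst p) else cscale u (\<psi>X (fst p) (1 / u)))" for u
  define Q where "Q u = - (adj2 (M p u) ** N u ** M p u)" for u
  have "mat_holomorphic_on N UNIV"
    unfolding N_def by (rule loop_potential_leading_upper[OF potentials(1) x])
  then have Q: "mat_holomorphic_on Q UNIV"
    unfolding Q_def by (intro mat_holomorphic_on_uminus mat_holomorphic_on_mult mat_holomorphic_on_adj2 M_props(1) assms)
  have Q0: "Q 0 = - cX 1 (fst p)"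
    by (simp add: Q_def N_def M_props(4)[OF assms])
  \<comment> \<open>Radius 3 covers all parameters used later: 1, -1 and the circle of radius 1/2
    about 1.\<close>
  define B where "B = circle_mean 3 (\<lambda>w. cscale w (Q (1 / w)))"
  show thesis
  proof (rule that[of "- B"])
    fix z :: complex assume z: "z \<noteq> 0" "norm z < 3"
    have "circle_mean 3 (\<lambda>w. cscale (w / (w - z)) (adj2 (\<Phi> p w ** G p w) ** d\<Phi> p w (1, 0) ** G p w))
        = circle_mean 3 (\<lambda>w. cscale (w / (w - z)) (cscale w (Q (1 / w))))"
    proof (rule circle_mean_cong)
      fix w :: complex assume "norm w = 3"
      then have w: "w \<noteq> 0"
        by auto
      have a: "A ** - (B ** C) ** D = - (A ** B ** (C ** D))" for A B C D :: mat2
      proof -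
        have "A ** - (B ** C) = - (A ** (B ** C))" "- (A ** (B ** C)) ** D = - (A ** (B ** C) ** D)"
          by (simp_all add: vec_eq_iff matrix_matrix_mult_def sum_negf)
        then show ?thesis
          by (simp add: matrix_mul_assoc)
      qed
      have "adj2 (\<Phi> p w ** G p w) ** d\<Phi> p w (1, 0) ** G p w = - (adj2 (M p (1 / w)) ** \<psi>X (fst p) w ** M p (1 / w))"
        unfolding d\<Phi>_fst[OF assms w] a factorization[OF assms w] ..
      also have "\<dots> = cscale w (Q (1 / w))"
        using w by (simp add: Q_def N_def cscale_mult_left cscale_mult_right) (simp add: vec_eq_iff)
      finally show "cscale (w / (w - z)) (adj2 (\<Phi> p w ** G p w) ** d\<Phi> p w (1, 0) ** G p w)
          = cscale (w / (w - z)) (cscale w (Q (1 / w)))"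
        by simp
    qed simp
    also have "\<dots> = cscale z (Q 0) + B"
      unfolding B_def by (rule circle_mean_kernel_pole_infinity[OF Q z(2)])
    finally have "dG1 3 p z (1, 0) = - (G p z ** (cscale z (Q 0) + B))"
      by (simp add: dG1_def)
    also have "\<dots> = G p z ** (cscale z (cX 1 (fst p)) + - B)"
      unfolding Q0 by (simp add: mat2_eq_iff mat2_mult_nth algebra_simps)
    finally have d: "dG1 3 p z (1, 0) = G p z ** (cscale z (cX 1 (fst p)) + - B)" .
    have "((\<lambda>x. G (x, snd p) z) has_vector_derivative dG1 3 p z (1, 0)) (at (fst p))"
      by (rule has_vector_derivative_fst_line[OF has_derivative_G_fst[OF assms z(2)]])
    from bounded_linear.has_vector_derivative[OF bounded_bilinear.bounded_linear_right[OF bounded_bilinear_mat2_mult] this, of "Y (snd p) z"]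
    show "((\<lambda>x. Fh (x, snd p) z) has_vector_derivative Fh p z ** (cscale z (cX 1 (fst p)) + - B)) (at (fst p))"
      by (simp add: Fh_def d matrix_mul_assoc)
  qed
qed

text \<open>The derivative of Y contributes all of the conjugated potential, that of G takes away
  its inner part. What is left is the polar part at 0, whose residue involves G only through its
  value at 0.\<close>

lemma Fh_deriv_snd:
  assumes "p \<in> \<Omega>" "z \<noteq> 0" "norm z < 3"
  shows "((\<lambda>y. Fh (fst p, y) z) has_vector_derivative
    Fh p z ** cscale (1 / z) (adj2 (G p 0) ** cY (- 1) (snd p) ** G p 0)) (at (snd p))"
proof -
  have y: "snd p \<in> Iy"
    using assms by (auto simp: \<Omega>_def)
  define N where "N u = (if u = 0 then cY (- 1) (snd p) else cscale u (\<psi>Y (snd p) u))" for u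
  define Q where "Q u = adj2 (G p u) ** N u ** G p u" for u
  have "mat_holomorphic_on N UNIV"
    unfolding N_def by (rule loop_potential_leading_lower[OF potentials(2) y])
  then have Q: "mat_holomorphic_on Q UNIV"
    unfolding Q_def by (intro mat_holomorphic_on_mult mat_holomorphic_on_adj2 G_props(1) assms)
  have Qw: "adj2 (G p w) ** \<psi>Y (snd p) w ** G p w = cscale (1 / w) (Q w)" if "w \<noteq> 0" for w
    using that by (simp add: Q_def N_def cscale_mult_left cscale_mult_right) (simp add: vec_eq_iff)
  have "circle_mean 3 (\<lambda>w. cscale (w / (w - z)) (adj2 (\<Phi> p w ** G p w) ** d\<Phi> p w (0, 1) ** G p w))
      = circle_mean 3 (\<lambda>w. cscale (w / (w - z)) (cscale (1 / w) (Q w)))"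
  proof (rule circle_mean_cong)
    fix w :: complex assume "norm w = 3"
    then have w: "w \<noteq> 0"
      by auto
    have "det (\<Phi> p w) = 1"
      using assms(1) w by (simp add: \<Phi>_def det_mul det_adj2 det_XY \<Omega>_def mem_Times_iff)
    moreover have "adj2 (\<Phi> p w ** G p w) ** (\<Phi> p w ** \<psi>Y (snd p) w)
        = adj2 (G p w) ** (adj2 (\<Phi> p w) ** \<Phi> p w) ** \<psi>Y (snd p) w"
      by (simp only: adj2_mult_rev matrix_mul_assoc)
    ultimately have "adj2 (\<Phi> p w ** G p w) ** (\<Phi> p w ** \<psi>Y (snd p) w) = adj2 (G p w) ** \<psi>Y (snd p) w"
      by (simp add: adj2_mult)
    then show "cscale (w / (w - z)) (adj2 (\<Phi> p w ** G p w) ** d\<Phi> p w (0, 1) ** G p w)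
        = cscale (w / (w - z)) (cscale (1 / w) (Q w))"
      by (simp add: d\<Phi>_snd[OF assms(1) w] Qw[OF w])
  qed simp
  also have "\<dots> = cscale (1 / z) (Q z - Q 0)"
    by (rule circle_mean_kernel_pole_zero[OF Q assms(3,2)])
  finally have "dG1 3 p z (0, 1) = - (G p z ** cscale (1 / z) (Q z - Q 0))"
    by (simp add: dG1_def)
  also have "\<dots> = G p z ** cscale (1 / z) (Q 0) - G p z ** cscale (1 / z) (Q z)"
    by (simp add: mat2_eq_iff mat2_mult_nth algebra_simps)
  also have "G p z ** cscale (1 / z) (Q z) = \<psi>Y (snd p) z ** G p z"
    unfolding Qw[OF assms(2), symmetric] by (simp add: matrix_mul_assoc adj2_mult[OF G_props(3)[OF assms(1)]])
  finally have d: "dG1 3 p z (0, 1) = G p z ** cscale (1 / z) (Q 0) - \<psi>Y (snd p) z ** G p z" .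
  have "((\<lambda>y. G (fst p, y) z) has_vector_derivative dG1 3 p z (0, 1)) (at (snd p))"
    by (rule has_vector_derivative_snd_line[OF has_derivative_G_fst[OF assms(1,3)]])
  from bounded_bilinear.has_vector_derivative[OF bounded_bilinear_mat2_mult Y_deriv[OF assms(1,2)] this]
  have "((\<lambda>y. Fh (fst p, y) z) has_vector_derivative
      Y (snd p) z ** dG1 3 p z (0, 1) + Y (snd p) z ** \<psi>Y (snd p) z ** G p z) (at (snd p))"
    by (simp add: Fh_def)
  moreover have "Y (snd p) z ** dG1 3 p z (0, 1) + Y (snd p) z ** \<psi>Y (snd p) z ** G p z = Fh p z ** cscale (1 / z) (Q 0)"
  proof -
    have "A ** (B ** C - D ** B) + A ** D ** B = A ** B ** C" for A B C D :: mat2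
      by (simp add: mat2_eq_iff mat2_mult_nth algebra_simps)
    then show ?thesis
      unfolding d Fh_def .
  qed
  ultimately show ?thesis
    by (simp add: Q_def N_def)
qed

end

subsection \<open>The derivative of the Sym formula\<close>

text \<open>The \<open>\<lambda>\<close>-derivative at \<open>1\<close> as a Cauchy integral, which commutes with derivatives in the parameters.\<close>

definition deriv_mean :: "loop \<Rightarrow> mat2" where
  "deriv_mean A = circle_mean (1 / 2) (\<lambda>w. cscale (1 / w) (A (1 + w)))"

lemma circle_mean_deriv:
  assumes "h holomorphic_on ball 1 1"
  shows "(h has_field_derivative circle_mean (1 / 2) (\<lambda>w. 1 / w * h (1 + w))) (at 1)"
proof -
  have c: "continuous_on (cball 1 (1 / 2)) h" "h holomorphic_on ball 1 (1 / 2)"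
    using holomorphic_on_subset[OF assms] holomorphic_on_imp_continuous_on[OF holomorphic_on_subset[OF assms]]
    by (auto simp: subset_iff)
  have d: "(\<lambda>u. h u / (u - 1)\<^sup>2) contour_integrable_on circlepath 1 (1 / 2)"
    "(h has_field_derivative 1 / (2 * of_real pi * \<i>) * contour_integral (circlepath 1 (1 / 2)) (\<lambda>u. h u / (u - 1)\<^sup>2)) (at 1)"
    using Cauchy_derivative_integral_circlepath[OF c, of 1] by auto
  have "((\<lambda>u. h u / (u - 1)\<^sup>2) has_contour_integral contour_integral (circlepath 1 (1 / 2)) (\<lambda>u. h u / (u - 1)\<^sup>2)) (circlepath 1 (1 / 2))"
    by (rule has_contour_integral_integral[OF d(1)])
  then have "((\<lambda>t. h (circlepath 1 (1/2) t) / (circlepath 1 (1/2) t - 1)\<^sup>2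
      * (2 * of_real pi * \<i> * (1/2) * exp (2 * of_real pi * \<i> * t)))
      has_integral contour_integral (circlepath 1 (1 / 2)) (\<lambda>u. h u / (u - 1)\<^sup>2)) {0..1}"
    unfolding has_contour_integral_def
    by (rule has_integral_eq[rotated]) (simp add: vector_derivative_circlepath01)
  from has_integral_mult_right[OF this, of "1 / (2 * of_real pi * \<i>)"]
  have "((\<lambda>t. 1 / circlepath 0 (1/2) t * h (1 + circlepath 0 (1/2) t)) has_integral
      1 / (2 * of_real pi * \<i>) * contour_integral (circlepath 1 (1 / 2)) (\<lambda>u. h u / (u - 1)\<^sup>2)) {0..1}"
    by (rule has_integral_eq[rotated]) (simp add: circlepath field_simps power2_eq_square)
  then have "circle_mean (1 / 2) (\<lambda>w. 1 / w * h (1 + w))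
      = 1 / (2 * of_real pi * \<i>) * contour_integral (circlepath 1 (1 / 2)) (\<lambda>u. h u / (u - 1)\<^sup>2)"
    unfolding circle_mean_def by (rule integral_unique)
  with d(2) show ?thesis
    by simp
qed

lemma deriv_mean_has_field_derivative:
  assumes "mat_holomorphic_on A (ball 1 1)"
  shows "((\<lambda>z. A z $ i $ j) has_field_derivative deriv_mean A $ i $ j) (at 1)"
proof -
  have c: "continuous_on (sphere 0 (1 / 2)) (\<lambda>w. A (1 + w))"
    by (rule continuous_on_compose2[OF mat_holomorphic_imp_continuous_on[OF assms]])
      (auto intro!: continuous_intros simp: dist_norm)
  have "deriv_mean A $ i $ j = circle_mean (1 / 2) (\<lambda>w. cscale (1 / w) (A (1 + w)) $ i $ j)"
    unfolding deriv_mean_def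
    by (rule circle_mean_linear[OF _ _ bounded_linear_mat2_nth, symmetric])
      (auto intro!: continuous_on_cscale c continuous_intros)
  then show ?thesis
    using circle_mean_deriv[of "\<lambda>z. A z $ i $ j"] assms by (simp add: mat_holomorphic_on_def)
qed

lemma deriv_mean_mult:
  assumes "mat_holomorphic_on A (ball 1 1)" "mat_holomorphic_on B (ball 1 1)"
    and "\<And>i j. ((\<lambda>z. B z $ i $ j) has_field_derivative W $ i $ j) (at 1)"
  shows "deriv_mean (\<lambda>z. A z ** B z) = deriv_mean A ** B 1 + A 1 ** W"
proof -
  have 1: "((\<lambda>z. (A z ** B z) $ i $ j) has_field_derivative (deriv_mean A ** B 1 + A 1 ** W) $ i $ j) (at 1)" for i j
    unfolding mat2_mult_nth
    by (rule derivative_eq_intros deriv_mean_has_field_derivative[OF assms(1)] assms(3) refl)+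
      (simp add: mat2_mult_nth algebra_simps)
  have 2: "((\<lambda>z. (A z ** B z) $ i $ j) has_field_derivative deriv_mean (\<lambda>z. A z ** B z) $ i $ j) (at 1)" for i j
    by (rule deriv_mean_has_field_derivative[OF mat_holomorphic_on_mult[OF assms(1,2)]])
  have "deriv_mean (\<lambda>z. A z ** B z) $ i $ j = (deriv_mean A ** B 1 + A 1 ** W) $ i $ j" for i j
    by (rule DERIV_unique[OF 2 1])
  then show ?thesis
    by (simp only: vec_eq_iff) blast
qed

text \<open>A stands for the frame and B for its \<lambda>-derivative at 1, so W is the
  \<lambda>-derivative of the connection U. The terms with B cancel because \<open>adj2\<close>
  turns U into -U; Ad_A of 2 W - [U, e2] remains.\<close>

lemma sym_frame_derivative:
  fixes A B :: "real \<Rightarrow> mat2"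
  assumes "(A has_vector_derivative A t ** U) (at t)" "(B has_vector_derivative B t ** U + A t ** W) (at t)" "trace U = 0"
  shows "((\<lambda>t. cscale 2 (B t) ** adj2 (A t) - A t ** e2 ** adj2 (A t)) has_vector_derivative
    A t ** (cscale 2 W - (U ** e2 - e2 ** U)) ** adj2 (A t)) (at t)"
proof -
  note mult = bounded_bilinear.has_vector_derivative[OF bounded_bilinear_mat2_mult]
  have A': "((\<lambda>t. adj2 (A t)) has_vector_derivative adj2 (A t ** U)) (at t)"
    by (rule bounded_linear.has_vector_derivative[OF bounded_linear_adj2 assms(1)])
  have B': "((\<lambda>t. cscale 2 (B t)) has_vector_derivative cscale 2 (B t ** U + A t ** W)) (at t)"
    by (rule bounded_linear.has_vector_derivative[OF bounded_bilinear.bounded_linear_right[OF bounded_bilinear_cscale] assms(2)])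
  have E: "((\<lambda>t. A t ** e2) has_vector_derivative A t ** U ** e2) (at t)"
    by (rule bounded_linear.has_vector_derivative[OF bounded_bilinear.bounded_linear_left[OF bounded_bilinear_mat2_mult] assms(1)])
  have "U $ 2 $ 2 = - U $ 1 $ 1"
    using assms(3) by (simp add: trace_def sum_2 add_eq_0_iff)
  then have "cscale 2 (B t) ** adj2 (A t ** U) + cscale 2 (B t ** U + A t ** W) ** adj2 (A t)
      - (A t ** e2 ** adj2 (A t ** U) + A t ** U ** e2 ** adj2 (A t))
    = A t ** (cscale 2 W - (U ** e2 - e2 ** U)) ** adj2 (A t)"
    by (simp add: mat2_eq_iff mat2_mult_nth e2_def algebra_simps)
  with has_vector_derivative_diff[OF mult[OF B' A'] mult[OF E A']] show ?thesis
    by simp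
qed

section \<open>Symmetry, smoothness and derivatives of the frame at the loop parameter 1\<close>

context sym_surface
begin

lemma Hp_loop: "p \<in> \<Omega> \<Longrightarrow> Hp (fst p) (snd p) \<in> loop_group"
  using birkhoff_factors(2) by (simp add: loop_group_plus_def)

lemma G_twisted:
  assumes "p \<in> \<Omega>" "z \<noteq> 0"
  shows "G p (- z) $ 1 $ 1 = G p z $ 1 $ 1" "G p (- z) $ 1 $ 2 = - G p z $ 1 $ 2"
    "G p (- z) $ 2 $ 1 = - G p z $ 2 $ 1" "G p (- z) $ 2 $ 2 = G p z $ 2 $ 2"
  using twisted_nth[of "Hp (fst p) (snd p)" z] Hp_loop[OF assms(1)] assms
  by (simp_all add: G_props(2) loop_group_def)

lemma G_real:
  assumes "p \<in> \<Omega>" "z \<noteq> 0"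
  shows "cnj (G p (cnj z) $ i $ j) = G p z $ i $ j"
proof -
  have *: "cnj (Hp (fst p) (snd p) (cnj z) $ i $ j) = Hp (fst p) (snd p) z $ i $ j" for i j
    using real_loop_nth Hp_loop[OF assms(1)] assms(2) by (simp add: loop_group_def)
  have "\<forall>i j. cnj (G p (cnj z) $ i $ j) = G p z $ i $ j"
    using assms by (simp add: G_props(2) forall_2 *)
  then show ?thesis
    by blast
qed

lemma continuous_G_nth: "p \<in> \<Omega> \<Longrightarrow> continuous_on UNIV g \<Longrightarrow> continuous_on UNIV (\<lambda>z. G p (g z) $ i $ j)"
  by (rule bounded_linear.continuous_on[OF bounded_linear_mat2_nth], rule continuous_on_compose2[OF cont_G]) auto

text \<open>The off-diagonal entries are odd and continuous in the parameter, hence vanish at 0;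
  reality likewise passes to the limit.\<close>

lemma G0:
  assumes "p \<in> \<Omega>"
  shows "G p 0 $ 1 $ 2 = 0" "G p 0 $ 2 $ 1 = 0" "G p 0 $ i $ j \<in> \<real>" "G p 0 $ 1 $ 1 * G p 0 $ 2 $ 2 = 1"
proof -
  have c: "continuous_on UNIV (\<lambda>z. G p (- z) $ i $ j)" "continuous_on UNIV (\<lambda>z. - G p z $ i $ j)"
    "continuous_on UNIV (\<lambda>z. G p z $ i $ j)" "continuous_on UNIV (\<lambda>z. cnj (G p (cnj z) $ i $ j))" for i j
    by (intro continuous_on_minus continuous_on_cnj continuous_on_id continuous_G_nth[OF assms])+
  have "G p (- 0) $ 1 $ 2 = - G p 0 $ 1 $ 2"
    by (rule continuous_eq_at_0[OF c(1,2)]) (rule G_twisted[OF assms])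
  then show "G p 0 $ 1 $ 2 = 0"
    by simp
  have "G p (- 0) $ 2 $ 1 = - G p 0 $ 2 $ 1"
    by (rule continuous_eq_at_0[OF c(1,2)]) (rule G_twisted[OF assms])
  then show "G p 0 $ 2 $ 1 = 0"
    by simp
  have "cnj (G p (cnj 0) $ i $ j) = G p 0 $ i $ j"
    by (rule continuous_eq_at_0[OF c(4,3)]) (rule G_real[OF assms])
  then show "G p 0 $ i $ j \<in> \<real>"
    by (simp add: Reals_cnj_iff)
  show "G p 0 $ 1 $ 1 * G p 0 $ 2 $ 2 = 1"
    using G_props(3)[OF assms, of 0] \<open>G p 0 $ 1 $ 2 = 0\<close> by (simp add: det_2)
qed

lemma Fh_twisted:
  assumes "p \<in> \<Omega>"
  shows "Fh p (- 1) $ 1 $ 1 = Fh p 1 $ 1 $ 1" "Fh p (- 1) $ 1 $ 2 = - Fh p 1 $ 1 $ 2"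
    "Fh p (- 1) $ 2 $ 1 = - Fh p 1 $ 2 $ 1" "Fh p (- 1) $ 2 $ 2 = Fh p 1 $ 2 $ 2"
proof -
  have "twisted (Y (snd p))"
    using Y_loop assms by (auto simp: loop_group_def \<Omega>_def)
  from twisted_nth[OF this, of 1] G_twisted[OF assms, of 1]
  show "Fh p (- 1) $ 1 $ 1 = Fh p 1 $ 1 $ 1" "Fh p (- 1) $ 1 $ 2 = - Fh p 1 $ 1 $ 2"
    "Fh p (- 1) $ 2 $ 1 = - Fh p 1 $ 2 $ 1" "Fh p (- 1) $ 2 $ 2 = Fh p 1 $ 2 $ 2"
    by (simp_all add: Fh_def mat2_mult_nth)
qed

lemma Fh_real:
  assumes "p \<in> \<Omega>"
  shows "Fh p 1 $ i $ j \<in> \<real>"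
proof -
  have "real_loop (Y (snd p))"
    using Y_loop assms by (auto simp: loop_group_def \<Omega>_def)
  from real_loop_nth[OF this, of 1] G_real[OF assms, of 1]
  have "Y (snd p) 1 $ k $ l \<in> \<real>" "G p 1 $ k $ l \<in> \<real>" for k l
    by (simp_all add: Reals_cnj_iff)
  then show ?thesis
    by (simp add: Fh_def mat2_mult_nth)
qed

lemma hol_Fh: "p \<in> \<Omega> \<Longrightarrow> mat_holomorphic_on (Fh p) (ball 1 1)"
proof -
  assume p: "p \<in> \<Omega>"
  then have "mat_holomorphic_on (Y (snd p)) (- {0})"
    using Y_loop by (auto simp: loop_group_def \<Omega>_def)
  then have "mat_holomorphic_on (Y (snd p)) (ball 1 1)"
    unfolding mat_holomorphic_on_def using holomorphic_on_subset[of _ "- {0}" "ball 1 1"] by (auto simp: dist_norm)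
  moreover have "mat_holomorphic_on (G p) (ball 1 1)"
    using G_props(1)[OF p] unfolding mat_holomorphic_on_def using holomorphic_on_subset by blast
  ultimately show ?thesis
    unfolding Fh_def by (rule mat_holomorphic_on_mult)
qed

definition F1 :: "real \<times> real \<Rightarrow> mat2" where "F1 p = Fh p 1"

definition Fz :: "real \<times> real \<Rightarrow> mat2" where "Fz p = deriv_mean (Fh p)"

lemma smooth_F1: "smooth_on \<Omega> F1"
proof -
  have "(\<lambda>p. (p, 1)) ` \<Omega> \<subseteq> \<Omega> \<times> (- {0 :: complex})"
    by auto
  from Ck_on_compose[OF open_\<Omega>'(1) open_\<Omega>'(2) Ck_Fh
        Ck_on_Pair[OF open_\<Omega>'(1) Ck_on_id[OF open_\<Omega>'(1)] Ck_on_const] this]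
  have "Ck_on k \<Omega> F1" for k
    by (simp add: F1_def[abs_def])
  then show ?thesis
    by (simp add: smooth_on_def)
qed

definition dFh :: "real \<times> real \<Rightarrow> complex \<Rightarrow> real \<times> real \<Rightarrow> mat2" where
  "dFh p z v = frechet_derivative (\<lambda>x. Fh (fst x) (snd x)) (at (p, z)) (v, 0)"

lemma has_derivative_Fh:
  assumes "p \<in> \<Omega>" "z \<noteq> 0"
  shows "((\<lambda>q. Fh q z) has_derivative dFh p z) (at p)"
proof -
  have "((\<lambda>x. Fh (fst x) (snd x)) has_derivative frechet_derivative (\<lambda>x. Fh (fst x) (snd x)) (at (p, z))) (at (p, z))"
    by (rule Ck_on_Suc_has_derivative[OF Ck_Fh]) (use assms in auto)
  from has_derivative_compose[where f="\<lambda>q. (q, z)",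
      OF has_derivative_Pair[OF has_derivative_ident has_derivative_const] this]
  show ?thesis
    unfolding dFh_def by simp
qed

text \<open>The circle of radius 1/2 about 1 avoids the singular parameter 0 and stays in the disc
  of radius 3 where the derivatives of \<open>Fh\<close> are known.\<close>

lemma one_plus_circlepath: "1 + circlepath 0 (1 / 2) t \<noteq> 0" "norm (1 + circlepath 0 (1 / 2) t) < 3"
proof -
  have n: "norm (circlepath 0 (1 / 2) t) = 1 / 2"
    by (rule norm_circlepath) simp
  show "norm (1 + circlepath 0 (1 / 2) t) < 3"
    using norm_triangle_ineq[of 1 "circlepath 0 (1 / 2) t"] n by simp
  show "1 + circlepath 0 (1 / 2) t \<noteq> 0"
  proof
    assume "1 + circlepath 0 (1 / 2) t = 0"
    then have "circlepath 0 (1 / 2) t = - 1"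
      by (simp add: eq_neg_iff_add_eq_0 add.commute)
    with n show False
      by simp
  qed
qed

lemma Ck_Fz_integrand:
  assumes "Ck_on k (\<Omega> \<times> (- {0})) (\<lambda>x. h (fst x) (snd x))"
  shows "Ck_on k (\<Omega> \<times> UNIV) (\<lambda>y. cscale (1 / circlepath 0 (1 / 2) (snd y)) (h (fst y) (1 + circlepath 0 (1 / 2) (snd y))))"
proof -
  let ?c = "circlepath 0 (1 / 2)"
  have o: "open (\<Omega> \<times> (UNIV :: real set))"
    by (intro open_Times open_\<Omega>' open_UNIV)
  have c: "Ck_on k (\<Omega> \<times> UNIV) (\<lambda>y. ?c (snd y))"
    by (rule Ck_on_compose[OF o open_UNIV Ck_on_circlepath Ck_on_snd[OF o Ck_on_id[OF o]] subset_UNIV])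
  have p: "Ck_on k (\<Omega> \<times> UNIV) (\<lambda>y. (fst y, 1 + ?c (snd y)))"
    by (rule Ck_on_Pair[OF o Ck_on_fst[OF o Ck_on_id[OF o]] Ck_on_add[OF o Ck_on_const c]])
  have "(\<lambda>y. (fst y, 1 + ?c (snd y))) ` (\<Omega> \<times> UNIV) \<subseteq> \<Omega> \<times> (- {0})"
    using one_plus_circlepath by auto
  from Ck_on_compose[OF o open_\<Omega>'(2) assms p this]
  have h: "Ck_on k (\<Omega> \<times> UNIV) (\<lambda>y. h (fst y) (1 + ?c (snd y)))"
    by simp
  have "Ck_on k (\<Omega> \<times> UNIV) (\<lambda>y. inverse (?c (snd y)))"
    by (rule Ck_on_inverse[OF o c]) (simp add: circlepath_nonzero)
  then show ?thesis
    unfolding inverse_eq_divide by (rule Ck_on_cscale[OF o _ h])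
qed

lemma smooth_Fz: "smooth_on \<Omega> Fz"
proof -
  have "Ck_on k \<Omega> Fz" for k
    using Ck_on_integral[OF open_\<Omega>'(1) Ck_Fz_integrand[OF Ck_Fh], of k 0 1]
    by (simp add: Fz_def[abs_def] deriv_mean_def circle_mean_def)
  then show ?thesis
    by (simp add: smooth_on_def)
qed

lemma has_derivative_Fz:
  assumes "p \<in> \<Omega>"
  shows "(Fz has_derivative (\<lambda>v. deriv_mean (\<lambda>z. dFh p z v))) (at p)"
proof -
  let ?c = "circlepath 0 (1 / 2)"
  have "((\<lambda>p. integral {0..1} (\<lambda>t. cscale (1 / ?c t) (Fh p (1 + ?c t)))) has_derivative
      (\<lambda>v. integral {0..1} (\<lambda>t. cscale (1 / ?c t) (dFh p (1 + ?c t) v)))) (at p)"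
  proof (rule has_derivative_integral_param[OF open_\<Omega>'(1) assms])
    fix q t assume q: "q \<in> \<Omega>"
    show "((\<lambda>p. cscale (1 / ?c t) (Fh p (1 + ?c t))) has_derivative (\<lambda>v. cscale (1 / ?c t) (dFh q (1 + ?c t) v))) (at q)"
      by (rule bounded_linear.has_derivative[OF bounded_bilinear.bounded_linear_right[OF bounded_bilinear_cscale]
            has_derivative_Fh[OF q one_plus_circlepath(1)]])
  next
    fix q assume q: "q \<in> \<Omega>"
    have "continuous_on (\<Omega> \<times> UNIV) (\<lambda>y. cscale (1 / ?c (snd y)) (Fh (fst y) (1 + ?c (snd y))))"
      by (rule Ck_on_imp_continuous_on[OF Ck_Fz_integrand[OF Ck_Fh]])
    from continuous_on_compose2[OF this, of "{0..1}" "\<lambda>t. (q, t)"] q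
    show "continuous_on {0..1} (\<lambda>t. cscale (1 / ?c t) (Fh q (1 + ?c t)))"
      by (simp add: continuous_on_Pair image_subset_iff)
  next
    fix v
    have "Ck_on 0 (\<Omega> \<times> (- {0})) (\<lambda>x. dFh (fst x) (snd x) v)"
      unfolding dFh_def prod.collapse by (rule Ck_on_Suc_frechet_derivative[OF Ck_Fh])
    from continuous_on_subset[OF Ck_on_imp_continuous_on[OF Ck_Fz_integrand[OF this]], of "\<Omega> \<times> {0..1}"]
    show "continuous_on (\<Omega> \<times> {0..1}) (\<lambda>(q, t). cscale (1 / ?c t) (dFh q (1 + ?c t) v))"
      by (auto simp: case_prod_unfold)
  qed
  then show ?thesis
    by (simp add: Fz_def[abs_def] deriv_mean_def circle_mean_def)
qed

lemma deriv_mean_cong: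
  assumes "\<And>z. z \<noteq> 0 \<Longrightarrow> norm z < 3 \<Longrightarrow> A z = B z"
  shows "deriv_mean A = deriv_mean B"
  unfolding deriv_mean_def circle_mean_def by (rule integral_cong) (simp add: assms one_plus_circlepath)

definition fS :: "real \<times> real \<Rightarrow> mat2" where
  "fS p = cscale 2 (Fz p) ** adj2 (F1 p) - F1 p ** e2 ** adj2 (F1 p)"

lemma smooth_fS: "smooth_on \<Omega> fS"
  using smooth_F1 smooth_Fz unfolding smooth_on_def fS_def
  by (auto intro!: Ck_on_diff Ck_on_mat2_mult Ck_on_cscale Ck_on_adj2 Ck_on_const open_\<Omega>'(1) simp del: Ck_on.simps)

lemma sym_map_eq:
  assumes "p \<in> \<Omega>"
  shows "sym_map 1 (loop_mult (Y (snd p)) (loop_inv (Hp (fst p) (snd p)))) = fS p"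
proof -
  let ?F = "loop_mult (Y (snd p)) (loop_inv (Hp (fst p) (snd p)))"
  have F: "?F z = Fh p z" if "z \<noteq> 0" for z
    using Hp_loop[OF assms] that assms
    by (simp add: loop_mult_def loop_inv_def Fh_def G_props(2) matrix_inv_eq_adj2 loop_group_def)
  have "loop_deriv ?F 1 $ i $ j = Fz p $ i $ j" for i j
  proof -
    have "((\<lambda>z. Fh p z $ i $ j) has_field_derivative Fz p $ i $ j) (at 1)"
      unfolding Fz_def by (rule deriv_mean_has_field_derivative[OF hol_Fh[OF assms]])
    then have "((\<lambda>z. ?F z $ i $ j) has_field_derivative Fz p $ i $ j) (at 1)"
      by (rule has_field_derivative_transform_within_open[where S="- {0}"]) (auto simp: F)
    then show ?thesis
      by (simp add: loop_deriv_def DERIV_imp_deriv)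
  qed
  then have "loop_deriv ?F 1 = Fz p"
    by (simp add: vec_eq_iff)
  then show ?thesis
    by (simp add: sym_map_def Ad_mat_def fS_def F F1_def mat_mult_cscale matrix_inv_eq_adj2 det_Fh assms)
qed

lemma frame_fst:
  assumes "p \<in> \<Omega>" "cX 1 (fst p) = mat22 0 a b 0"
  obtains U where "pd1 F1 p = F1 p ** U" "trace U = 0" "U $ 1 $ 2 = a" "U $ 2 $ 1 = b"
    "pd1 fS p = F1 p ** mat22 0 0 (4 * b) 0 ** adj2 (F1 p)"
proof -
  obtain U0 where U0: "\<And>z. z \<noteq> 0 \<Longrightarrow> norm z < 3 \<Longrightarrow>
    ((\<lambda>x. Fh (x, snd p) z) has_vector_derivative Fh p z ** (cscale z (cX 1 (fst p)) + U0)) (at (fst p))"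
    using Fh_deriv_fst[OF assms(1)] by blast
  let ?U = "\<lambda>z. cscale z (cX 1 (fst p)) + U0"
  have p: "fst p \<in> Ix" "\<And>x. x \<in> Ix \<Longrightarrow> (x, snd p) \<in> \<Omega>"
    using assms(1) by (auto simp: \<Omega>_def)
  note dp = U0[of 1, simplified] and dm = U0[of "- 1", simplified]
  have ent: "((\<lambda>x. A x $ i $ j) has_vector_derivative A' $ i $ j) (at t)"
    if "(A has_vector_derivative A') (at t)" for A :: "real \<Rightarrow> mat2" and A' t i j
    by (rule bounded_linear.has_vector_derivative[OF bounded_linear_mat2_nth that])
  \<comment> \<open>The twist relates the derivatives at -1 and 1. The term with \<open>cX 1\<close>
    is odd in z by itself while U0 is independent of z, so the off-diagonal entries of U0 must
    vanish.\<close>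
  have tw: "(Fh p (- 1) ** ?U (- 1)) $ i $ j = s * (Fh p 1 ** ?U 1) $ i $ j"
    if "\<And>q. q \<in> \<Omega> \<Longrightarrow> Fh q (- 1) $ i $ j = s * Fh q 1 $ i $ j" for i j s
  proof -
    have 1: "((\<lambda>x. s * Fh (x, snd p) 1 $ i $ j) has_vector_derivative s * (Fh p 1 ** ?U 1) $ i $ j) (at (fst p))"
      by (rule bounded_linear.has_vector_derivative[OF bounded_linear_mult_right ent[OF U0]]) auto
    have "((\<lambda>x. s * Fh (x, snd p) 1 $ i $ j) has_vector_derivative (Fh p (- 1) ** ?U (- 1)) $ i $ j) (at (fst p))"
      by (rule has_vector_derivative_transform_within_open[OF ent[OF U0] open_I(1) p(1)]) (simp_all add: that p(2))
    with 1 show ?thesis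
      using vector_derivative_unique_at by blast
  qed
  have D: "(Fh p (- 1) ** ?U (- 1)) $ 1 $ 1 = (Fh p 1 ** ?U 1) $ 1 $ 1" "(Fh p (- 1) ** ?U (- 1)) $ 1 $ 2 = - (Fh p 1 ** ?U 1) $ 1 $ 2"
     "(Fh p (- 1) ** ?U (- 1)) $ 2 $ 1 = - (Fh p 1 ** ?U 1) $ 2 $ 1" "(Fh p (- 1) ** ?U (- 1)) $ 2 $ 2 = (Fh p 1 ** ?U 1) $ 2 $ 2"
    using tw[of 1 1 1] tw[of 1 2 "- 1"] tw[of 2 1 "- 1"] tw[of 2 2 1] Fh_twisted by simp_all
  have inv: "?U z = adj2 (Fh p z) ** (Fh p z ** ?U z)" if "z \<noteq> 0" for z
    by (simp add: matrix_mul_assoc adj2_mult det_Fh[OF assms(1) that])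
  have "?U (- 1) $ 1 $ 2 = - ?U 1 $ 1 $ 2" "?U (- 1) $ 2 $ 1 = - ?U 1 $ 2 $ 1"
    by (subst (1 2) inv, simp, simp, simp only: mat2_mult_nth[of "adj2 _"] D adj2_nth Fh_twisted[OF assms(1)], simp)+
  then have U0_off: "U0 $ 1 $ 2 = 0" "U0 $ 2 $ 1 = 0"
    by (simp_all add: assms(2) eq_neg_iff_add_eq_0 add_eq_0_iff)
  have F1_line: "((\<lambda>x. F1 (x, snd p)) has_vector_derivative F1 p ** ?U 1) (at (fst p))"
    unfolding F1_def by (rule U0) auto
  have dF1: "(F1 has_derivative frechet_derivative F1 (at p)) (at p)"
    by (rule smooth_on_has_derivative[OF smooth_F1 assms(1)])
  have pd1_F1: "pd1 F1 p = F1 p ** ?U 1"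
    using vector_derivative_unique_at[OF has_vector_derivative_fst_line[OF dF1] F1_line] .
  \<comment> \<open>Jacobi's formula for the constant determinant 1.\<close>
  have tr: "trace (?U 1) = 0"
  proof -
    let ?A = "F1 p" and ?D = "F1 p ** ?U 1"
    note e = ent[OF F1_line]
    have "((\<lambda>x. F1 (x, snd p) $ 1 $ 1 * F1 (x, snd p) $ 2 $ 2 - F1 (x, snd p) $ 1 $ 2 * F1 (x, snd p) $ 2 $ 1)
      has_vector_derivative (?A $ 1 $ 1 * ?D $ 2 $ 2 + ?D $ 1 $ 1 * ?A $ 2 $ 2)
        - (?A $ 1 $ 2 * ?D $ 2 $ 1 + ?D $ 1 $ 2 * ?A $ 2 $ 1)) (at (fst p))"
      using has_vector_derivative_diff[OF has_vector_derivative_mult[OF e[of 1 1] e[of 2 2]]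
          has_vector_derivative_mult[OF e[of 1 2] e[of 2 1]]] by simp
    moreover have "((\<lambda>x. F1 (x, snd p) $ 1 $ 1 * F1 (x, snd p) $ 2 $ 2 - F1 (x, snd p) $ 1 $ 2 * F1 (x, snd p) $ 2 $ 1)
      has_vector_derivative 0) (at (fst p))"
      by (rule has_vector_derivative_transform_within_open[OF has_vector_derivative_const[of 1] open_I(1) p(1)])
        (use det_Fh[OF p(2), of _ 1] in \<open>simp add: F1_def det_2\<close>)
    ultimately have "(?A $ 1 $ 1 * ?D $ 2 $ 2 + ?D $ 1 $ 1 * ?A $ 2 $ 2) - (?A $ 1 $ 2 * ?D $ 2 $ 1 + ?D $ 1 $ 2 * ?A $ 2 $ 1) = 0"
      by (rule vector_derivative_unique_at)
    moreover have "(A $ 1 $ 1 * (A ** V) $ 2 $ 2 + (A ** V) $ 1 $ 1 * A $ 2 $ 2) - (A $ 1 $ 2 * (A ** V) $ 2 $ 1 + (A ** V) $ 1 $ 2 * A $ 2 $ 1)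
        = det A * trace V" for A V :: mat2
      by (simp add: mat2_mult_nth det_2 trace_def sum_2 algebra_simps)
    ultimately show ?thesis
      using det_Fh[OF assms(1), of 1] by (simp add: F1_def)
  qed
  have dFh: "dFh p z (1, 0) = Fh p z ** ?U z" if "z \<noteq> 0" "norm z < 3" for z
    using vector_derivative_unique_at[OF has_vector_derivative_fst_line[OF has_derivative_Fh[OF assms(1) that(1)]] U0[OF that]] .
  have "deriv_mean (\<lambda>z. dFh p z (1, 0)) = deriv_mean (\<lambda>z. Fh p z ** ?U z)"
    by (rule deriv_mean_cong) (rule dFh)
  also have "\<dots> = deriv_mean (Fh p) ** ?U 1 + Fh p 1 ** cX 1 (fst p)"
  proof (rule deriv_mean_mult[OF hol_Fh[OF assms(1)]])
    show "mat_holomorphic_on ?U (ball 1 1)"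
      by (auto simp: mat_holomorphic_on_def intro!: holomorphic_intros)
    show "((\<lambda>z. ?U z $ i $ j) has_field_derivative cX 1 (fst p) $ i $ j) (at 1)" for i j
      by (auto intro!: derivative_eq_intros)
  qed
  finally have Fz_line: "((\<lambda>x. Fz (x, snd p)) has_vector_derivative Fz p ** ?U 1 + F1 p ** cX 1 (fst p)) (at (fst p))"
    using has_vector_derivative_fst_line[OF has_derivative_Fz[OF assms(1)]] by (simp add: Fz_def F1_def)
  have "((\<lambda>x. fS (x, snd p)) has_vector_derivative
      F1 p ** (cscale 2 (cX 1 (fst p)) - (?U 1 ** e2 - e2 ** ?U 1)) ** adj2 (F1 p)) (at (fst p))"
    using sym_frame_derivative[of "\<lambda>x. F1 (x, snd p)" "fst p" "?U 1" "\<lambda>x. Fz (x, snd p)" "cX 1 (fst p)"]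
      F1_line Fz_line tr by (simp add: fS_def)
  \<comment> \<open>2 W and [U, e2] agree in the upper off-diagonal entry and are opposite in the
    lower one.\<close>
  moreover have "cscale 2 (cX 1 (fst p)) - (?U 1 ** e2 - e2 ** ?U 1) = mat22 0 0 (4 * b) 0"
    by (simp add: mat2_eq_iff mat2_mult_nth e2_def assms(2) U0_off)
  ultimately have "pd1 fS p = F1 p ** mat22 0 0 (4 * b) 0 ** adj2 (F1 p)"
    using vector_derivative_unique_at[OF has_vector_derivative_fst_line[OF smooth_on_has_derivative[OF smooth_fS assms(1)]]]
    by simp
  with pd1_F1 tr show thesis
    using U0_off by (intro that[of "?U 1"]) (simp_all add: assms(2))
qed

text \<open>G p 0 is diagonal with determinant 1, so conjugation rescales the off-diagonal entries
  by nonzero squares. Since 1/\<lambda> has derivative -1 at 1, here W = -V, and the upper instead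
  of the lower entry survives the Sym formula.\<close>

lemma frame_snd:
  assumes "p \<in> \<Omega>" "cY (- 1) (snd p) = mat22 0 c d 0"
  defines "a \<equiv> c * (G p 0 $ 2 $ 2)\<^sup>2" and "b \<equiv> d * (G p 0 $ 1 $ 1)\<^sup>2"
  shows "pd2 F1 p = F1 p ** mat22 0 a b 0" "pd2 fS p = F1 p ** mat22 0 (- 4 * a) 0 0 ** adj2 (F1 p)"
proof -
  let ?V = "mat22 0 a b 0 :: mat2"
  have V: "adj2 (G p 0) ** cY (- 1) (snd p) ** G p 0 = ?V"
    by (simp add: mat2_eq_iff mat2_mult_nth assms(2) G0[OF assms(1)] a_def b_def power2_eq_square)
  have line: "((\<lambda>y. Fh (fst p, y) z) has_vector_derivative Fh p z ** cscale (1 / z) ?V) (at (snd p))"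
    if "z \<noteq> 0" "norm z < 3" for z
    using Fh_deriv_snd[OF assms(1) that] by (simp add: V)
  have "cscale (1 / 1) ?V = ?V"
    by (simp add: vec_eq_iff)
  then have F1_line: "((\<lambda>y. F1 (fst p, y)) has_vector_derivative F1 p ** ?V) (at (snd p))"
    using line[of 1] by (simp add: F1_def)
  show "pd2 F1 p = F1 p ** ?V"
    using vector_derivative_unique_at[OF has_vector_derivative_snd_line[OF smooth_on_has_derivative[OF smooth_F1 assms(1)]] F1_line] .
  have dFh: "dFh p z (0, 1) = Fh p z ** cscale (1 / z) ?V" if "z \<noteq> 0" "norm z < 3" for z
    using vector_derivative_unique_at[OF has_vector_derivative_snd_line[OF has_derivative_Fh[OF assms(1) that(1)]] line[OF that]] .
  have "deriv_mean (\<lambda>z. dFh p z (0, 1)) = deriv_mean (\<lambda>z. Fh p z ** cscale (1 / z) ?V)"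
    by (rule deriv_mean_cong) (rule dFh)
  also have "\<dots> = deriv_mean (Fh p) ** cscale (1 / 1) ?V + Fh p 1 ** - ?V"
  proof (rule deriv_mean_mult[OF hol_Fh[OF assms(1)]])
    have nz: "z \<noteq> 0" if "z \<in> ball 1 1" for z :: complex
      using that by (auto simp: dist_norm)
    show "mat_holomorphic_on (\<lambda>z. cscale (1 / z) ?V) (ball 1 1)"
      using nz by (auto simp: mat_holomorphic_on_def intro!: holomorphic_intros)
    show "((\<lambda>z. cscale (1 / z) ?V $ i $ j) has_field_derivative (- ?V) $ i $ j) (at 1)" for i j
      by (auto intro!: derivative_eq_intros)
  qed
  finally have Fz_line: "((\<lambda>y. Fz (fst p, y)) has_vector_derivative Fz p ** ?V + F1 p ** - ?V) (at (snd p))"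
    using has_vector_derivative_snd_line[OF has_derivative_Fz[OF assms(1)]] \<open>cscale (1 / 1) ?V = ?V\<close>
    by (simp add: Fz_def F1_def)
  have "trace ?V = 0"
    by (simp add: trace_def sum_2)
  then have "((\<lambda>y. fS (fst p, y)) has_vector_derivative
      F1 p ** (cscale 2 (- ?V) - (?V ** e2 - e2 ** ?V)) ** adj2 (F1 p)) (at (snd p))"
    using sym_frame_derivative[of "\<lambda>y. F1 (fst p, y)" "snd p" ?V "\<lambda>y. Fz (fst p, y)" "- ?V"]
      F1_line Fz_line by (simp add: fS_def)
  moreover have "cscale 2 (- ?V) - (?V ** e2 - e2 ** ?V) = mat22 0 (- 4 * a) 0 0"
    by (simp add: mat2_eq_iff mat2_mult_nth e2_def)
  ultimately show "pd2 fS p = F1 p ** mat22 0 (- 4 * a) 0 0 ** adj2 (F1 p)"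
    using vector_derivative_unique_at[OF has_vector_derivative_snd_line[OF smooth_on_has_derivative[OF smooth_fS assms(1)]]]
    by simp
qed

end

section \<open>The two kinds of generic singularities\<close>

lemma smooth_on_swap:
  fixes h :: "real \<times> real \<Rightarrow> 'a::real_normed_vector"
  assumes "open S" "smooth_on S h"
  shows "open (prod.swap -` S :: (real \<times> real) set)" "smooth_on (prod.swap -` S) (\<lambda>p. h (prod.swap p))"
    "\<And>p. p \<in> prod.swap -` S \<Longrightarrow> pd1 (\<lambda>p. h (prod.swap p)) p = pd2 h (prod.swap p)"
    "\<And>p. p \<in> prod.swap -` S \<Longrightarrow> pd2 (\<lambda>p. h (prod.swap p)) p = pd1 h (prod.swap p)"
proof -
  have bl: "bounded_linear (prod.swap :: real \<times> real \<Rightarrow> _)"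
    unfolding prod.swap_def by (intro bounded_linear_Pair bounded_linear_fst bounded_linear_snd)
  show o: "open (prod.swap -` S :: (real \<times> real) set)"
    by (intro open_vimage assms(1) linear_continuous_on bl)
  show "smooth_on (prod.swap -` S) (\<lambda>p. h (prod.swap p))"
    by (rule smooth_on_compose[OF o assms(1,2)]) (auto simp: smooth_on_def intro!: Ck_on_linear[OF bl o] simp del: Ck_on.simps)
  fix p assume "p \<in> prod.swap -` S"
  then have "(h has_derivative frechet_derivative h (at (prod.swap p))) (at (prod.swap p))"
    by (intro smooth_on_has_derivative[OF assms(2)]) auto
  from frechet_derivative_at[OF has_derivative_compose[OF bounded_linear_imp_has_derivative[OF bl] this]]
  have "frechet_derivative (\<lambda>p. h (prod.swap p)) (at p) v = frechet_derivative h (at (prod.swap p)) (prod.swap v)" for v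
    by metis
  then show "pd1 (\<lambda>p. h (prod.swap p)) p = pd2 h (prod.swap p)" "pd2 (\<lambda>p. h (prod.swap p)) p = pd1 h (prod.swap p)"
    by simp_all
qed

lemma mat22_scaleR:
  "mat22 0 0 (complex_of_real c) 0 = c *\<^sub>R mat22 0 0 1 0"
  "mat22 0 (complex_of_real c) 0 0 = c *\<^sub>R mat22 0 1 0 0"
  by (simp_all only: mat2_eq_iff vector_scaleR_component mat22_nth) (simp_all add: scaleR_conv_of_real)

lemma conj_scaleR: "A ** (c *\<^sub>R B) ** C = c *\<^sub>R (A ** B ** C)" for A B C :: mat2
  by (simp add: mat2_eq_iff mat2_mult_nth algebra_simps)

context sym_surface
begin

text \<open>Reading \<beta> or \<gamma> off the frame equation exhibits it, up to a nonzero factor,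
  as a smooth function of (x, y), although the potentials give it only pointwise as a Laurent
  coefficient.\<close>

lemma frame_smooth_coefficients:
  fixes C :: "real \<times> real \<Rightarrow> mat2"
  assumes "smooth_on \<Omega> C"
  shows "smooth_on \<Omega> (\<lambda>p. k * Re ((adj2 (F1 p) ** C p) $ i $ j))"
proof -
  have bl: "bounded_linear (\<lambda>A :: mat2. k * Re (A $ i $ j))"
    by (intro bounded_linear_compose[OF bounded_linear_mult_right] bounded_linear_compose[OF bounded_linear_Re] bounded_linear_mat2_nth)
  have "smooth_on \<Omega> (\<lambda>p. adj2 (F1 p) ** C p)"
    using assms smooth_F1 unfolding smooth_on_def by (auto intro!: Ck_on_mat2_mult Ck_on_adj2 open_\<Omega>'(1) simp del: Ck_on.simps)
  from smooth_on_bounded_linear[OF bl open_\<Omega>'(1) this] show ?thesis .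
qed

lemma adj2_F1: "p \<in> \<Omega> \<Longrightarrow> adj2 (F1 p) ** (F1 p ** U) = U"
  by (simp add: F1_def matrix_mul_assoc adj2_mult det_Fh)

lemma scaled_fS:
  assumes f: "\<And>p. p \<in> \<Omega> \<Longrightarrow> f p = k *\<^sub>R fS p"
  shows "smooth_on \<Omega> f"
    and "p \<in> \<Omega> \<Longrightarrow> frechet_derivative f (at p) v = k *\<^sub>R frechet_derivative fS (at p) v"
proof -
  show "smooth_on \<Omega> f"
    unfolding smooth_on_def
  proof
    fix n
    have "Ck_on n \<Omega> (\<lambda>p. k *\<^sub>R fS p)"
      using smooth_fS by (intro Ck_on_scaleR[OF open_\<Omega>'(1) Ck_on_const]) (simp add: smooth_on_def)
    then show "Ck_on n \<Omega> f"
      by (rule Ck_on_transform[OF _ open_\<Omega>'(1) f])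
  qed
next
  assume p: "p \<in> \<Omega>"
  have "((\<lambda>p. k *\<^sub>R fS p) has_derivative (\<lambda>v. k *\<^sub>R frechet_derivative fS (at p) v)) (at p)"
    by (rule has_derivative_scaleR_right[OF smooth_on_has_derivative[OF smooth_fS p]])
  then have "(f has_derivative (\<lambda>v. k *\<^sub>R frechet_derivative fS (at p) v)) (at p)"
    by (rule has_derivative_transform_within_open[OF _ open_\<Omega>'(1) p]) (simp add: f)
  from fun_cong[OF frechet_derivative_at[OF this], of v]
  show "frechet_derivative f (at p) v = k *\<^sub>R frechet_derivative fS (at p) v"
    by simp
qed

lemma cuspidal_edge_fst:
  assumes "(x0, y0) \<in> \<Omega>" "k \<noteq> 0"
    and cX: "\<And>x. x \<in> Ix \<Longrightarrow> cX 1 x = mat22 0 (complex_of_real (\<alpha> x)) (complex_of_real (\<beta> x)) 0"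
    and cY: "cY (- 1) y0 = mat22 0 (complex_of_real \<gamma>) (complex_of_real \<delta>) 0"
    and nz: "\<beta> x0 = 0" "deriv \<beta> x0 \<noteq> 0" "\<gamma> \<noteq> 0" "\<alpha> x0 \<noteq> 0"
    and f: "\<And>p. p \<in> \<Omega> \<Longrightarrow> f p = k *\<^sub>R fS p"
  shows "cuspidal_edge_at (\<lambda>p. L3_coords (f p)) (x0, y0)"
proof -
  have in_I: "x0 \<in> Ix" "y0 \<in> Iy" and \<Omega>: "\<And>x y. (x, y) \<in> \<Omega> \<longleftrightarrow> x \<in> Ix \<and> y \<in> Iy"
    using assms(1) by (auto simp: \<Omega>_def)
  define b where "b p = 4 * k * Re ((adj2 (F1 p) ** pd1 F1 p) $ 2 $ 1)" for p
  have b: "b p = 4 * k * \<beta> (fst p)" if p: "p \<in> \<Omega>" for p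
  proof -
    have "fst p \<in> Ix"
      using p by (auto simp: \<Omega>_def)
    obtain U where "pd1 F1 p = F1 p ** U" "U $ 2 $ 1 = complex_of_real (\<beta> (fst p))"
      using frame_fst[OF p cX[OF \<open>fst p \<in> Ix\<close>]] by metis
    then show ?thesis
      by (simp add: b_def adj2_F1[OF p])
  qed
  have b_smooth: "smooth_on \<Omega> b"
    unfolding b_def by (rule frame_smooth_coefficients[OF smooth_on_frechet_derivative[OF smooth_F1]])
  have f_smooth: "smooth_on \<Omega> f"
    by (rule scaled_fS(1)[OF f])
  have fd: "frechet_derivative f (at p) v = k *\<^sub>R frechet_derivative fS (at p) v" if "p \<in> \<Omega>" for p v
    by (rule scaled_fS(2)[OF f that])
  obtain U where U: "pd1 F1 (x0, y0) = F1 (x0, y0) ** U" "trace U = 0" "U $ 1 $ 2 = complex_of_real (\<alpha> x0)"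
    using frame_fst[OF assms(1)] cX[OF in_I(1)] by (metis fst_conv)
  define \<sigma> where "\<sigma> = Re (G (x0, y0) 0 $ 2 $ 2)"
  have \<sigma>: "G (x0, y0) 0 $ 2 $ 2 = complex_of_real \<sigma>" "\<sigma> \<noteq> 0"
    using G0(3,4)[OF assms(1)] by (auto simp: \<sigma>_def complex_is_Real_iff complex_eq_iff)
  show ?thesis
  proof (rule cuspidal_edge_of_frame[OF open_\<Omega>'(1) assms(1) f_smooth smooth_F1 b_smooth _ _ U(1,2)])
    show "det (F1 (x0, y0)) = 1" "F1 (x0, y0) $ i $ j \<in> \<real>" for i j
      by (simp_all add: F1_def det_Fh Fh_real assms(1))
    show "pd1 f p = b p *\<^sub>R (F1 p ** mat22 0 0 1 0 ** adj2 (F1 p))" if "p \<in> \<Omega>" for p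
    proof -
      have "fst p \<in> Ix"
        using that by (auto simp: \<Omega>_def)
      have "pd1 fS p = F1 p ** mat22 0 0 (4 * complex_of_real (\<beta> (fst p))) 0 ** adj2 (F1 p)"
        using frame_fst[OF that cX[OF \<open>fst p \<in> Ix\<close>]] by metis
      also have "4 * complex_of_real (\<beta> (fst p)) = complex_of_real (4 * \<beta> (fst p))"
        by simp
      finally show ?thesis
        unfolding fd[OF that] b[OF that] mat22_scaleR conj_scaleR by simp
    qed
    have "pd2 fS (x0, y0) = F1 (x0, y0) ** mat22 0 (complex_of_real (- 4 * (\<gamma> * \<sigma>\<^sup>2))) 0 0 ** adj2 (F1 (x0, y0))"
      using frame_snd(2)[OF assms(1)] cY by (simp add: \<sigma>(1))
    then show "pd2 f (x0, y0) = (k * (- 4 * (\<gamma> * \<sigma>\<^sup>2))) *\<^sub>R (F1 (x0, y0) ** mat22 0 1 0 0 ** adj2 (F1 (x0, y0)))"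
      unfolding fd[OF assms(1)] mat22_scaleR conj_scaleR by simp
    show "k * (- 4 * (\<gamma> * \<sigma>\<^sup>2)) \<noteq> 0"
      using assms(2) nz(3) \<sigma>(2) by simp
    show "b (x0, y) = 0" if "(x0, y) \<in> \<Omega>" for y
      using b[OF that] nz(1) by simp
    \<comment> \<open>On the line y = y0 the function \<beta> equals b / (4 k), which transfers the
      hypothesis on the derivative of \<beta> to b.\<close>
    have "((\<lambda>x. b (x, y0)) has_real_derivative pd1 b (x0, y0)) (at x0)"
      using has_vector_derivative_pd1[OF smooth_on_has_derivative[OF b_smooth assms(1)]]
      by (simp add: has_real_derivative_iff_has_vector_derivative)
    from DERIV_cdivide[OF this, of "4 * k"]
    have "(\<beta> has_real_derivative pd1 b (x0, y0) / (4 * k)) (at x0)"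
      by (rule has_field_derivative_transform_within_open[OF _ open_I(1) in_I(1)])
        (simp add: b \<Omega> in_I assms(2))
    then have "deriv \<beta> x0 = pd1 b (x0, y0) / (4 * k)"
      by (rule DERIV_imp_deriv)
    with nz(2) show "pd1 b (x0, y0) \<noteq> 0"
      by auto
    show "mat22 0 0 1 0 = (mat22 0 0 1 0 :: mat2) \<and> mat22 0 1 0 0 = (mat22 0 1 0 0 :: mat2) \<and> Re (U $ 1 $ 2) \<noteq> 0 \<or>
      mat22 0 0 1 0 = (mat22 0 1 0 0 :: mat2) \<and> mat22 0 1 0 0 = (mat22 0 0 1 0 :: mat2) \<and> Re (U $ 2 $ 1) \<noteq> 0"
      using U(3) nz(4) by simp
  qed
qed

lemma cuspidal_edge_snd:
  assumes "(x0, y0) \<in> \<Omega>" "k \<noteq> 0"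
    and cX: "cX 1 x0 = mat22 0 (complex_of_real \<alpha>) (complex_of_real \<beta>) 0"
    and cY: "\<And>y. y \<in> Iy \<Longrightarrow> cY (- 1) y = mat22 0 (complex_of_real (\<gamma> y)) (complex_of_real (\<delta> y)) 0"
    and nz: "\<gamma> y0 = 0" "deriv \<gamma> y0 \<noteq> 0" "\<beta> \<noteq> 0" "\<delta> y0 \<noteq> 0"
    and f: "\<And>p. p \<in> \<Omega> \<Longrightarrow> f p = k *\<^sub>R fS p"
  shows "cuspidal_edge_at (\<lambda>p. L3_coords (f p)) (x0, y0)"
proof -
  have in_I: "x0 \<in> Ix" "y0 \<in> Iy" and \<Omega>: "\<And>x y. (x, y) \<in> \<Omega> \<longleftrightarrow> x \<in> Ix \<and> y \<in> Iy"
    using assms(1) by (auto simp: \<Omega>_def)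
  define r s where "r p = Re (G p 0 $ 1 $ 1)" and "s p = Re (G p 0 $ 2 $ 2)" for p
  have rs: "G p 0 $ 1 $ 1 = complex_of_real (r p)" "G p 0 $ 2 $ 2 = complex_of_real (s p)" "r p \<noteq> 0" "s p \<noteq> 0"
    if "p \<in> \<Omega>" for p
    using G0(3,4)[OF that] by (auto simp: r_def s_def complex_is_Real_iff complex_eq_iff)
  have F1_snd: "pd2 F1 p = F1 p ** mat22 0 (complex_of_real (\<gamma> (snd p) * (s p)\<^sup>2)) (complex_of_real (\<delta> (snd p) * (r p)\<^sup>2)) 0"
    and fS_snd: "pd2 fS p = F1 p ** mat22 0 (complex_of_real (- 4 * (\<gamma> (snd p) * (s p)\<^sup>2))) 0 0 ** adj2 (F1 p)"
    if "p \<in> \<Omega>" for p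
  proof -
    have "snd p \<in> Iy"
      using that by (auto simp: \<Omega>_def)
    show "pd2 F1 p = F1 p ** mat22 0 (complex_of_real (\<gamma> (snd p) * (s p)\<^sup>2)) (complex_of_real (\<delta> (snd p) * (r p)\<^sup>2)) 0"
      "pd2 fS p = F1 p ** mat22 0 (complex_of_real (- 4 * (\<gamma> (snd p) * (s p)\<^sup>2))) 0 0 ** adj2 (F1 p)"
      using frame_snd[OF that cY[OF \<open>snd p \<in> Iy\<close>]] rs[OF that] by simp_all
  qed
  define b where "b p = - 4 * k * Re ((adj2 (F1 p) ** pd2 F1 p) $ 1 $ 2)" for p
  have b: "b p = - 4 * k * (\<gamma> (snd p) * (s p)\<^sup>2)" if "p \<in> \<Omega>" for p
    unfolding b_def F1_snd[OF that] adj2_F1[OF that] by simp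
  have b_smooth: "smooth_on \<Omega> b"
    unfolding b_def by (rule frame_smooth_coefficients[OF smooth_on_frechet_derivative[OF smooth_F1]])
  \<comment> \<open>b differs from \<gamma> by the factor s^2; differentiability of s is needed to
    recover the derivative of \<gamma> by division.\<close>
  have s_smooth: "smooth_on \<Omega> s"
  proof -
    have i: "(\<lambda>p. (p, 0)) ` \<Omega> \<subseteq> \<Omega> \<times> (UNIV :: complex set)"
      by auto
    have o: "open (\<Omega> \<times> (UNIV :: complex set))"
      by (intro open_Times open_\<Omega>'(1) open_UNIV)
    from Ck_on_compose[OF open_\<Omega>'(1) o Ck_G Ck_on_Pair[OF open_\<Omega>'(1) Ck_on_id[OF open_\<Omega>'(1)] Ck_on_const] i]
    have "Ck_on n \<Omega> (\<lambda>p. G p 0)" for n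
      unfolding fst_conv snd_conv .
    from Ck_on_bounded_linear[OF bounded_linear_compose[OF bounded_linear_Re bounded_linear_mat2_nth] open_\<Omega>'(1) this]
    have "Ck_on n \<Omega> (\<lambda>p. Re (G p 0 $ 2 $ 2))" for n .
    then show ?thesis
      by (simp add: smooth_on_def s_def[abs_def])
  qed
  have f_smooth: "smooth_on \<Omega> f"
    by (rule scaled_fS(1)[OF f])
  have fd: "frechet_derivative f (at p) v = k *\<^sub>R frechet_derivative fS (at p) v" if "p \<in> \<Omega>" for p v
    by (rule scaled_fS(2)[OF f that])
  let ?S = "prod.swap -` \<Omega> :: (real \<times> real) set"
  have p0: "(y0, x0) \<in> ?S"
    using assms(1) by simp
  note sw_f = smooth_on_swap[OF open_\<Omega>'(1) f_smooth] and sw_F = smooth_on_swap[OF open_\<Omega>'(1) smooth_F1]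
    and sw_b = smooth_on_swap[OF open_\<Omega>'(1) b_smooth]
  \<comment> \<open>In exchanged variables the singular direction comes first again, with the roles
    of E_12 and E_21 interchanged.\<close>
  have "cuspidal_edge_at (\<lambda>p. L3_coords (f (prod.swap p))) (y0, x0)"
  proof (rule cuspidal_edge_of_frame[OF sw_f(1) p0 sw_f(2) sw_F(2) sw_b(2)])
    show "det (F1 (prod.swap (y0, x0))) = 1" "F1 (prod.swap (y0, x0)) $ i $ j \<in> \<real>" for i j
      by (simp_all add: F1_def det_Fh Fh_real assms(1))
    let ?U = "mat22 0 (complex_of_real (\<gamma> y0 * (s (x0, y0))\<^sup>2)) (complex_of_real (\<delta> y0 * (r (x0, y0))\<^sup>2)) 0"
    show "pd1 (\<lambda>p. F1 (prod.swap p)) (y0, x0) = F1 (prod.swap (y0, x0)) ** ?U"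
      using sw_F(3)[OF p0] F1_snd[OF assms(1)] by simp
    show "trace ?U = 0"
      by (simp add: trace_def sum_2)
    show "pd1 (\<lambda>p. f (prod.swap p)) p = b (prod.swap p) *\<^sub>R (F1 (prod.swap p) ** mat22 0 1 0 0 ** adj2 (F1 (prod.swap p)))"
      if "p \<in> ?S" for p
    proof -
      have p: "prod.swap p \<in> \<Omega>"
        using that by simp
      show ?thesis
        unfolding sw_f(3)[OF that] fd[OF p] fS_snd[OF p] b[OF p] mat22_scaleR conj_scaleR by simp
    qed
    have "pd1 fS (x0, y0) = F1 (x0, y0) ** mat22 0 0 (4 * complex_of_real \<beta>) 0 ** adj2 (F1 (x0, y0))"
      using frame_fst[OF assms(1)] cX by (metis fst_conv)
    also have "4 * complex_of_real \<beta> = complex_of_real (4 * \<beta>)"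
      by simp
    finally have "pd1 f (x0, y0) = (k * (4 * \<beta>)) *\<^sub>R (F1 (x0, y0) ** mat22 0 0 1 0 ** adj2 (F1 (x0, y0)))"
      unfolding fd[OF assms(1)] mat22_scaleR conj_scaleR by simp
    then show "pd2 (\<lambda>p. f (prod.swap p)) (y0, x0)
        = (k * (4 * \<beta>)) *\<^sub>R (F1 (prod.swap (y0, x0)) ** mat22 0 0 1 0 ** adj2 (F1 (prod.swap (y0, x0))))"
      using sw_f(4)[OF p0] by simp
    show "k * (4 * \<beta>) \<noteq> 0"
      using assms(2) nz(3) by simp
    show "b (prod.swap (y0, x)) = 0" if "(y0, x) \<in> ?S" for x
      using b[of "(x, y0)"] that nz(1) by simp
    have db: "((\<lambda>y. b (x0, y)) has_real_derivative pd2 b (x0, y0)) (at y0)"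
      using has_vector_derivative_pd2[OF smooth_on_has_derivative[OF b_smooth assms(1)]]
      by (simp add: has_real_derivative_iff_has_vector_derivative)
    have ds: "((\<lambda>y. s (x0, y)) has_real_derivative pd2 s (x0, y0)) (at y0)"
      using has_vector_derivative_pd2[OF smooth_on_has_derivative[OF s_smooth assms(1)]]
      by (simp add: has_real_derivative_iff_has_vector_derivative)
    have b0: "b (x0, y0) = 0"
      using b[OF assms(1)] nz(1) by simp
    \<comment> \<open>Since b vanishes at the point, the derivative of s drops out of the quotient
      rule.\<close>
    have "((\<lambda>y. b (x0, y) / (- 4 * k * (s (x0, y))\<^sup>2)) has_real_derivative pd2 b (x0, y0) / (- 4 * k * (s (x0, y0))\<^sup>2)) (at y0)"
      using assms(2) rs(4)[OF assms(1)]
      by (auto intro!: derivative_eq_intros db ds simp: b0 power2_eq_square)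
    then have "(\<gamma> has_real_derivative pd2 b (x0, y0) / (- 4 * k * (s (x0, y0))\<^sup>2)) (at y0)"
      by (rule has_field_derivative_transform_within_open[OF _ open_I(2) in_I(2)])
        (use rs(4) in \<open>simp add: b \<Omega> in_I assms(2)\<close>)
    then have "deriv \<gamma> y0 = pd2 b (x0, y0) / (- 4 * k * (s (x0, y0))\<^sup>2)"
      by (rule DERIV_imp_deriv)
    with nz(2) have "pd2 b (x0, y0) \<noteq> 0"
      by auto
    then show "pd1 (\<lambda>p. b (prod.swap p)) (y0, x0) \<noteq> 0"
      using sw_b(3)[OF p0] by simp
    show "mat22 0 1 0 0 = (mat22 0 0 1 0 :: mat2) \<and> mat22 0 0 1 0 = (mat22 0 1 0 0 :: mat2) \<and> Re (?U $ 1 $ 2) \<noteq> 0 \<or>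
      mat22 0 1 0 0 = (mat22 0 1 0 0 :: mat2) \<and> mat22 0 0 1 0 = (mat22 0 0 1 0 :: mat2) \<and> Re (?U $ 2 $ 1) \<noteq> 0"
      using nz(4) rs(3)[OF assms(1)] by simp
  qed
  then show ?thesis
    by (rule cuspidal_edge_at_swap)
qed

end

theorem proposition4p2:
  fixes H :: real
    and Ix Iy :: "real set"
    and \<psi>X \<psi>Y X Y :: "real \<Rightarrow> loop"
    and cX cY :: "int \<Rightarrow> real \<Rightarrow> mat2"
    and \<alpha> \<beta> \<gamma> \<delta> :: "real \<Rightarrow> real"
    and xb yb x0 y0 :: real
    and \<Phi> Hm Hp F :: "real \<Rightarrow> real \<Rightarrow> loop"
    and f :: "real \<times> real \<Rightarrow> mat2"
  assumes "H \<noteq> 0"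
    and "open Ix" "is_interval Ix" "open Iy" "is_interval Iy"
    and "potential_pair Ix Iy \<psi>X cX \<psi>Y cY"
    and "semi_regular Ix Iy cX cY"
    and "integrates_potential Ix xb \<psi>X X"
    and "integrates_potential Iy yb \<psi>Y Y"
    and "\<forall>x y. \<Phi> x y = loop_mult (loop_inv (X x)) (Y y)"
    and "\<forall>x\<in>Ix. cX 1 x =
      mat22 0 (complex_of_real (\<alpha> x)) (complex_of_real (\<beta> x)) 0"
    and "\<forall>y\<in>Iy. cY (- 1) y =
      mat22 0 (complex_of_real (\<gamma> y)) (complex_of_real (\<delta> y)) 0"
    and "\<forall>x\<in>Ix. \<forall>y\<in>Iy. \<Phi> x y \<in> left_big_cell"
    and "\<forall>x\<in>Ix. \<forall>y\<in>Iy. left_normalized_birkhoff (\<Phi> x y) (Hm x y) (Hp x y)"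
    and "\<forall>x y. F x y = loop_mult (Y y) (loop_inv (Hp x y))"
    and "\<forall>x y. f (x, y) = (1 / (2 * H)) *\<^sub>R sym_map 1 (F x y)"
    and "x0 \<in> Ix" "y0 \<in> Iy"
    and "(\<beta> x0 = 0 \<and> deriv \<beta> x0 \<noteq> 0 \<and> \<gamma> y0 \<noteq> 0 \<and> \<alpha> x0 \<noteq> 0) \<or>
         (\<gamma> y0 = 0 \<and> deriv \<gamma> y0 \<noteq> 0 \<and> \<beta> x0 \<noteq> 0 \<and> \<delta> y0 \<noteq> 0)"
  shows "cuspidal_edge_at (\<lambda>p. L3_coords (f p)) (x0, y0)"
proof -
  have surf: "sym_surface Ix Iy \<psi>X \<psi>Y X Y cX cY xb yb Hm Hp"
  proof
    show "left_normalized_birkhoff (loop_mult (loop_inv (X x)) (Y y)) (Hm x y) (Hp x y)" if "x \<in> Ix" "y \<in> Iy" for x y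
      using assms(10,14) that by auto
  qed (use assms in \<open>auto simp: potential_pair_def\<close>)
  interpret sym_surface Ix Iy \<psi>X \<psi>Y X Y cX cY xb yb Hm Hp
    by (rule surf)
  have p0: "(x0, y0) \<in> \<Omega>"
    using assms(17,18) by (simp add: \<Omega>_def)
  have k: "1 / (2 * H) \<noteq> 0"
    using assms(1) by simp
  have f: "f p = (1 / (2 * H)) *\<^sub>R fS p" if "p \<in> \<Omega>" for p
    using assms(15,16) sym_map_eq[OF that] by (cases p) simp
  have cX: "cX 1 x = mat22 0 (complex_of_real (\<alpha> x)) (complex_of_real (\<beta> x)) 0" if "x \<in> Ix" for x
    using assms(11) that by blast
  have cY: "cY (- 1) y = mat22 0 (complex_of_real (\<gamma> y)) (complex_of_real (\<delta> y)) 0" if "y \<in> Iy" for y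
    using assms(12) that by blast
  from assms(19) show ?thesis
  proof (elim disjE conjE)
    assume "\<beta> x0 = 0" "deriv \<beta> x0 \<noteq> 0" "\<gamma> y0 \<noteq> 0" "\<alpha> x0 \<noteq> 0"
    then show ?thesis
      using cuspidal_edge_fst[OF p0 k cX cY[OF assms(18)] _ _ _ _ f] by blast
  next
    assume "\<gamma> y0 = 0" "deriv \<gamma> y0 \<noteq> 0" "\<beta> x0 \<noteq> 0" "\<delta> y0 \<noteq> 0"
    then show ?thesis
      using cuspidal_edge_snd[OF p0 k cX[OF assms(17)] cY _ _ _ _ f] by blast
  qed
qed

end
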